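(* Let $K$ be an infinite field and let $n,r$ be positive integers. The center $Z$ of the affine Schur algebra $\widetilde{S}(n,r)$ is isomorphic as a $K$-algebra to $K[t_1,\dots,t_{r-1},t_r,t_r^{-1}]$, where $t_1,\dots,t_r$ are indeterminates. More precisely, $Z=K[c_{\varepsilon^1},\dots,c_{\varepsilon^{r-1}},c_{\varepsilon^r},c_{-\varepsilon^r}]$, where $\varepsilon^k=e^1+\cdots+e^k$ for $k=1,\dots,r$ and $e^1,\dots,e^r$ is the standard $\mathbb{Z}$-basis of $\mathbb{Z}^r$. In particular, the algebra $\widetilde{S}(n,r)$ is indecomposable.
   Context: Fix an infinite field $K$ and positive integers $n,r$. $\Sigma_r$ is the symmetric group on $r$ letters and $\widehat{\Sigma}_r=\Sigma_r\ltimes\mathbb{Z}^r$ is the extended affine Weyl group of type $A_{r-1}$. $I(\mathbb{Z},r)$ denotes the set of $r$-tuples $\underline{i}=(i_1,\dots,i_r)$ of integers, and $I(n,r)$ the subset of tuples with entries in $\{1,\dots,n\}$. $\widehat{\Sigma}_r$ acts on the right on $I(\mathbb{Z},r)$: $\Sigma_r$ acts by place permutation and $\varepsilon\in\mathbb{Z}^r$ acts by the shift $\underline{i}\varepsilon=\underline{i}+n\varepsilon$. It acts diagonally on $I(\mathbb{Z},r)\times I(\mathbb{Z},r)$; write $\sim$ for lying in the same $\widehat{\Sigma}_r$-orbit. To each pair $(\underline{i},\underline{j})$ associate a symbol $\xi_{\underline{i},\underline{j}}$, where $\xi_{\underline{i},\underline{j}}=\xi_{\underline{k},\underline{l}}$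 if and only if $(\underline{i},\underline{j})\sim(\underline{k},\underline{l})$. The affine Schur algebra $\widetilde{S}(n,r)$ is the $K$-algebra with basis the set of these symbols and multiplication $\xi_{\underline{i},\underline{j}}\,\xi_{\underline{k},\underline{l}}=\sum_{(\underline{p},\underline{q})} Z(\underline{i},\underline{j},\underline{k},\underline{l},\underline{p},\underline{q})\,\xi_{\underline{p},\underline{q}}$, the sum over representatives of $\widehat{\Sigma}_r$-orbits on $I(\mathbb{Z},r)\times I(\mathbb{Z},r)$, where $Z(\underline{i},\underline{j},\underline{k},\underline{l},\underline{p},\underline{q})=\#\{\underline{s}\in I(\mathbb{Z},r)\mid (\underline{i},\underline{j})\sim(\underline{p},\underline{s}),\ (\underline{s},\underline{q})\sim(\underline{k},\underline{l})\}$. $\Sigma_r$ also acts on $\mathbb{Z}^r$ on the right by place permutation, and $\Sigma_{\underline{i}}$, $\Sigma_\varepsilon$ denote the stabilizers in $\Sigma_r$ of $\underline{i}\in I(n,r)$ and $\varepsilon\in\mathbb{Z}^r$. For $\varepsilon\in\mathbb{Z}^r$ set $c_\varepsilon=\sum_{\underline{i}\in I(n,r)/\Sigma_r}\ \sum_{\sigma\in\Sigma_\varepsilon\backslash\Sigma_r/\Sigma_{\underline{i}}}\xi_{\underline{i},\underline{i}+n\varepsilon\sigma}$, the sums being over representatives of $\Sigma_r$-orbits and of double cosets. *)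

theory Defs
  imports "HOL-Algebra.Sym_Groups" "HOL-Algebra.Group_Action" "HOL-Algebra.QuotRing"
    "HOL-Algebra.Module" "HOL-Algebra.Subrings" "HOL-Library.Poly_Mapping"
begin

section \<open>Algebras over a field\<close>

text \<open>
  The field of scalars is a type \<open>'k\<close> of class \<^class>\<open>field\<close>; a \<open>'k\<close>-algebra is a record of
  type \<open>('k, 'a) module\<close>, whose multiplication need not be commutative.
\<close>

definition alg_iso :: "('k, 'a, 'm) module_scheme \<Rightarrow> ('k, 'b, 'n) module_scheme \<Rightarrow> ('a \<Rightarrow> 'b) set"
  where "alg_iso A B = {h \<in> ring_iso A B. \<forall>c. \<forall>x \<in> carrier A. h (c \<odot>\<^bsub>A\<^esub> x) = c \<odot>\<^bsub>B\<^esub> h x}"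

definition alg_isomorphic :: "('k, 'a, 'm) module_scheme \<Rightarrow> ('k, 'b, 'n) module_scheme \<Rightarrow> bool"
  where "alg_isomorphic A B \<longleftrightarrow> alg_iso A B \<noteq> {}"

definition alg_center :: "('k, 'a, 'm) module_scheme \<Rightarrow> 'a set"
  where "alg_center A = {z \<in> carrier A. \<forall>x \<in> carrier A. z \<otimes>\<^bsub>A\<^esub> x = x \<otimes>\<^bsub>A\<^esub> z}"

definition is_subalgebra :: "'a set \<Rightarrow> ('k, 'a, 'm) module_scheme \<Rightarrow> bool"
  where "is_subalgebra B A \<longleftrightarrow> subring B A \<and> (\<forall>c. \<forall>x \<in> B. c \<odot>\<^bsub>A\<^esub> x \<in> B)"

definition generated_subalgebra :: "('k, 'a, 'm) module_scheme \<Rightarrow> 'a set \<Rightarrow> 'a set"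
  where "generated_subalgebra A X = \<Inter> {B. is_subalgebra B A \<and> X \<subseteq> B}"

text \<open>
  A nonzero algebra is indecomposable if it is not the direct sum of two nonzero two-sided ideals,
  that is, not a direct product of two nonzero algebras. Since the algebra is unital, every
  two-sided ideal of the underlying ring is closed under the scalars.
\<close>

definition indecomposable :: "('k, 'a, 'm) module_scheme \<Rightarrow> bool"
  where "indecomposable A \<longleftrightarrow> ring A \<and> \<one>\<^bsub>A\<^esub> \<noteq> \<zero>\<^bsub>A\<^esub> \<and>
    (\<forall>I J. ideal I A \<and> ideal J A \<and> I <+>\<^bsub>A\<^esub> J = carrier A \<and> I \<inter> J = {\<zero>\<^bsub>A\<^esub>} \<longrightarrow>
      I = {\<zero>\<^bsub>A\<^esub>} \<or> J = {\<zero>\<^bsub>A\<^esub>})"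

text \<open>
  \<open>K[t\<^sub>1, \<dots>, t\<^sub>r\<^sub>-\<^sub>1, t\<^sub>r, t\<^sub>r\<inverse>]\<close>, spanned inside the group algebra of the finitely supported
  integer exponent vectors by the monomials in \<open>t\<^sub>1, \<dots>, t\<^sub>r\<close> in which only \<open>t\<^sub>r\<close> may have a
  negative exponent.
\<close>

definition laurent_algebra :: "nat \<Rightarrow> ('k::field, (nat \<Rightarrow>\<^sub>0 int) \<Rightarrow>\<^sub>0 'k) module"
  where "laurent_algebra r =
    \<lparr> carrier = {f. \<forall>a \<in> Poly_Mapping.keys f.
        Poly_Mapping.keys a \<subseteq> {1..r} \<and> (\<forall>k \<in> {1..<r}. 0 \<le> Poly_Mapping.lookup a k)},
      mult = (*), one = 1, zero = 0, add = (+),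
      smult = (\<lambda>c. Poly_Mapping.map ((*) c)) \<rparr>"


section \<open>The extended affine Weyl group and its action on tuples\<close>

text \<open>
  An \<open>r\<close>-tuple is a function on \<open>nat\<close> that is \<^const>\<open>undefined\<close> outside \<open>{1..r}\<close>. The right action
  of a permutation \<open>\<sigma>\<close> by place permutation sends \<open>(i\<^sub>1, \<dots>, i\<^sub>r)\<close> to
  \<open>(i\<^sub>\<sigma>\<^sub>(\<^sub>1\<^sub>), \<dots>, i\<^sub>\<sigma>\<^sub>(\<^sub>r\<^sub>))\<close>, i.e. it is composition.
\<close>

type_synonym tuple = "nat \<Rightarrow> int"

definition tuples :: "nat \<Rightarrow> tuple set"
  where "tuples r = {1..r} \<rightarrow>\<^sub>E UNIV"

definition bounded_tuples :: "nat \<Rightarrow> nat \<Rightarrow> tuple set"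
  where "bounded_tuples n r = {1..r} \<rightarrow>\<^sub>E {1..int n}"

definition place_perm :: "(nat \<Rightarrow> nat) \<Rightarrow> tuple \<Rightarrow> tuple"
  where "place_perm \<sigma> i = i \<circ> \<sigma>"

definition shift :: "nat \<Rightarrow> nat \<Rightarrow> tuple \<Rightarrow> tuple \<Rightarrow> tuple"
  where "shift n r \<epsilon> i = (\<lambda>k \<in> {1..r}. i k + int n * \<epsilon> k)"

text \<open>The pair \<open>(\<sigma>, \<epsilon>)\<close> stands for the product \<open>\<sigma>\<epsilon>\<close>, so that it acts first by \<open>\<sigma>\<close> and then by \<open>\<epsilon>\<close>.\<close>

definition ext_affine_weyl :: "nat \<Rightarrow> ((nat \<Rightarrow> nat) \<times> tuple) monoid"
  where "ext_affine_weyl r =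
    \<lparr> carrier = carrier (sym_group r) \<times> tuples r,
      mult = (\<lambda>(\<sigma>, \<epsilon>) (\<tau>, \<delta>). (\<sigma> \<circ> \<tau>, \<lambda>k \<in> {1..r}. place_perm \<tau> \<epsilon> k + \<delta> k)),
      one = (id, \<lambda>k \<in> {1..r}. 0) \<rparr>"

definition aff_act :: "nat \<Rightarrow> nat \<Rightarrow> (nat \<Rightarrow> nat) \<times> tuple \<Rightarrow> tuple \<Rightarrow> tuple"
  where "aff_act n r = (\<lambda>(\<sigma>, \<epsilon>) i. shift n r \<epsilon> (place_perm \<sigma> i))"

definition pair_act :: "nat \<Rightarrow> nat \<Rightarrow> (nat \<Rightarrow> nat) \<times> tuple \<Rightarrow> tuple \<times> tuple \<Rightarrow> tuple \<times> tuple"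
  where "pair_act n r w = map_prod (aff_act n r w) (aff_act n r w)"

text \<open>
  Here and below, \<^const>\<open>orbit\<close>, \<^const>\<open>orbits\<close> and \<^const>\<open>stabilizer\<close> are applied to right actions;
  their definitions only refer to the maps by which the group elements act.
\<close>

definition aff_sim :: "nat \<Rightarrow> nat \<Rightarrow> tuple \<times> tuple \<Rightarrow> tuple \<times> tuple \<Rightarrow> bool"
  where "aff_sim n r x y \<longleftrightarrow> y \<in> orbit (ext_affine_weyl r) (pair_act n r) x"

definition pair_orbits :: "nat \<Rightarrow> nat \<Rightarrow> (tuple \<times> tuple) set set"
  where "pair_orbits n r = orbits (ext_affine_weyl r) (tuples r \<times> tuples r) (pair_act n r)"


section \<open>The affine Schur algebra\<close>

definition rep :: "'a set \<Rightarrow> 'a"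
  where "rep X = (SOME x. x \<in> X)"

type_synonym 'k schur = "(tuple \<times> tuple) set \<Rightarrow>\<^sub>0 'k"

text \<open>The symbol \<open>\<xi>\<^sub>i\<^sub>,\<^sub>j\<close> is the basis vector indexed by the orbit of \<open>(i, j)\<close>.\<close>

definition xi :: "nat \<Rightarrow> nat \<Rightarrow> tuple \<Rightarrow> tuple \<Rightarrow> 'k::field schur"
  where "xi n r i j = Poly_Mapping.single (orbit (ext_affine_weyl r) (pair_act n r) (i, j)) 1"

definition schur_Z :: "nat \<Rightarrow> nat \<Rightarrow> tuple \<Rightarrow> tuple \<Rightarrow> tuple \<Rightarrow> tuple \<Rightarrow> tuple \<Rightarrow> tuple \<Rightarrow> nat"
  where "schur_Z n r i j k l p q =
    card {s \<in> tuples r. aff_sim n r (i, j) (p, s) \<and> aff_sim n r (s, q) (k, l)}"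

text \<open>
  Only finitely many orbits have a nonzero structure constant (\<open>finite_schur_Z\<close> below); the sum is
  restricted to those since \<^const>\<open>sum\<close> over an infinite set is zero. The choice of
  representatives is irrelevant by \<open>schur_mult_xi\<close>.
\<close>

definition basis_mult :: "nat \<Rightarrow> nat \<Rightarrow> (tuple \<times> tuple) set \<Rightarrow> (tuple \<times> tuple) set \<Rightarrow> 'k::field schur"
  where "basis_mult n r \<alpha> \<beta> =
    (let (i, j) = rep \<alpha>; (k, l) = rep \<beta>; Z = (\<lambda>\<gamma>. case rep \<gamma> of (p, q) \<Rightarrow> schur_Z n r i j k l p q)
     in \<Sum>\<gamma> \<in> {\<gamma> \<in> pair_orbits n r. Z \<gamma> \<noteq> 0}. Poly_Mapping.single \<gamma> (of_nat (Z \<gamma>)))"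

definition schur_smult :: "'k::field \<Rightarrow> 'k schur \<Rightarrow> 'k schur"
  where "schur_smult c = Poly_Mapping.map ((*) c)"

definition schur_mult :: "nat \<Rightarrow> nat \<Rightarrow> 'k::field schur \<Rightarrow> 'k schur \<Rightarrow> 'k schur"
  where "schur_mult n r f g =
    (\<Sum>\<alpha> \<in> Poly_Mapping.keys f. \<Sum>\<beta> \<in> Poly_Mapping.keys g.
       schur_smult (Poly_Mapping.lookup f \<alpha> * Poly_Mapping.lookup g \<beta>) (basis_mult n r \<alpha> \<beta>))"

text \<open>The identity element is the sum of the \<open>\<xi>\<^sub>i\<^sub>,\<^sub>i\<close> over representatives \<open>i\<close> of \<open>I(n,r)/\<Sigma>\<^sub>r\<close>.\<close>

definition affine_schur :: "nat \<Rightarrow> nat \<Rightarrow> ('k::field, 'k schur) module"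
  where "affine_schur n r =
    \<lparr> carrier = {f. Poly_Mapping.keys f \<subseteq> pair_orbits n r},
      mult = schur_mult n r,
      one = (\<Sum>\<omega> \<in> orbits (sym_group r) (bounded_tuples n r) place_perm. xi n r (rep \<omega>) (rep \<omega>)),
      zero = 0, add = (+),
      smult = schur_smult \<rparr>"


section \<open>The central elements\<close>

definition double_cosets :: "('g, 'm) monoid_scheme \<Rightarrow> 'g set \<Rightarrow> 'g set \<Rightarrow> 'g set set"
  where "double_cosets G H K = {(H #>\<^bsub>G\<^esub> g) <#>\<^bsub>G\<^esub> K | g. g \<in> carrier G}"

definition c_elt :: "nat \<Rightarrow> nat \<Rightarrow> tuple \<Rightarrow> 'k::field schur"
  where "c_elt n r \<epsilon> =
    (\<Sum>\<omega> \<in> orbits (sym_group r) (bounded_tuples n r) place_perm. let i = rep \<omega> in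
      \<Sum>D \<in> double_cosets (sym_group r) (stabilizer (sym_group r) place_perm \<epsilon>)
                                          (stabilizer (sym_group r) place_perm i).
        xi n r i (shift n r (place_perm (rep D) \<epsilon>) i))"

definition unit_tuple :: "nat \<Rightarrow> nat \<Rightarrow> tuple"
  where "unit_tuple r l = (\<lambda>m \<in> {1..r}. if m = l then 1 else 0)"

definition eps :: "nat \<Rightarrow> nat \<Rightarrow> tuple"
  where "eps r k = (\<lambda>m \<in> {1..r}. \<Sum>l = 1..k. unit_tuple r l m)"

definition neg_tuple :: "nat \<Rightarrow> tuple \<Rightarrow> tuple"
  where "neg_tuple r \<epsilon> = (\<lambda>m \<in> {1..r}. - \<epsilon> m)"


section \<open>Well-definedness\<close>

lemma place_perm_tuples:
  assumes "\<sigma> permutes {1..r}" "i \<in> tuples r"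
  shows "place_perm \<sigma> i \<in> tuples r"
proof -
  have "\<sigma> k = k" if "k \<notin> {1..r}" for k
    using assms(1) that by (rule permutes_not_in)
  thus ?thesis using assms(2)
    by (auto simp: tuples_def place_perm_def PiE_def extensional_def)
qed

lemma aff_act_tuples: "aff_act n r w i \<in> tuples r"
  by (cases w) (simp add: aff_act_def shift_def tuples_def)

lemma aff_act_mult:
  assumes "v \<in> carrier (ext_affine_weyl r)" "w \<in> carrier (ext_affine_weyl r)"
  shows "aff_act n r w (aff_act n r v i) = aff_act n r (v \<otimes>\<^bsub>ext_affine_weyl r\<^esub> w) i"
proof -
  obtain \<sigma> \<epsilon> \<tau> \<delta> where [simp]: "v = (\<sigma>, \<epsilon>)" "w = (\<tau>, \<delta>)" by (cases v, cases w)
  have \<tau>: "\<tau> permutes {1..r}"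
    using assms by (simp add: ext_affine_weyl_def sym_group_def)
  have "\<tau> k \<in> {1..r} \<longleftrightarrow> k \<in> {1..r}" for k
    using \<tau> by (rule permutes_in_image)
  thus ?thesis
    by (auto simp: aff_act_def ext_affine_weyl_def shift_def place_perm_def fun_eq_iff algebra_simps restrict_def)
qed

lemma aff_act_one:
  assumes "i \<in> tuples r"
  shows "aff_act n r \<one>\<^bsub>ext_affine_weyl r\<^esub> i = i"
  using assms
  by (auto simp: aff_act_def ext_affine_weyl_def shift_def place_perm_def tuples_def PiE_def extensional_def
      restrict_def fun_eq_iff)

lemma ext_affine_weyl_group: "group (ext_affine_weyl r)"
proof (rule groupI)
  fix x y z
  assume x: "x \<in> carrier (ext_affine_weyl r)" and y: "y \<in> carrier (ext_affine_weyl r)"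
    and z: "z \<in> carrier (ext_affine_weyl r)"
  obtain \<sigma> \<epsilon> \<tau> \<delta> \<rho> \<eta> where [simp]: "x = (\<sigma>, \<epsilon>)" "y = (\<tau>, \<delta>)" "z = (\<rho>, \<eta>)"
    by (cases x, cases y, cases z)
  have p: "\<sigma> permutes {1..r}" "\<tau> permutes {1..r}" "\<rho> permutes {1..r}"
    using x y z by (auto simp: ext_affine_weyl_def sym_group_def)
  show "x \<otimes>\<^bsub>ext_affine_weyl r\<^esub> y \<in> carrier (ext_affine_weyl r)"
    using p by (auto simp: ext_affine_weyl_def sym_group_def tuples_def intro: permutes_compose)
  have "\<rho> k \<in> {1..r} \<longleftrightarrow> k \<in> {1..r}" for k
    using p(3) by (rule permutes_in_image)
  thus "x \<otimes>\<^bsub>ext_affine_weyl r\<^esub> y \<otimes>\<^bsub>ext_affine_weyl r\<^esub> z =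
        x \<otimes>\<^bsub>ext_affine_weyl r\<^esub> (y \<otimes>\<^bsub>ext_affine_weyl r\<^esub> z)"
    by (auto simp: ext_affine_weyl_def place_perm_def fun_eq_iff restrict_def)
next
  show "\<one>\<^bsub>ext_affine_weyl r\<^esub> \<in> carrier (ext_affine_weyl r)"
    by (auto simp: ext_affine_weyl_def sym_group_def tuples_def permutes_id)
next
  fix x assume x: "x \<in> carrier (ext_affine_weyl r)"
  obtain \<sigma> \<epsilon> where [simp]: "x = (\<sigma>, \<epsilon>)" by (cases x)
  have p: "\<sigma> permutes {1..r}" and e: "\<epsilon> \<in> tuples r"
    using x by (auto simp: ext_affine_weyl_def sym_group_def)
  have im: "\<sigma> k \<in> {1..r} \<longleftrightarrow> k \<in> {1..r}" for k
    using p by (rule permutes_in_image)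
  show "\<one>\<^bsub>ext_affine_weyl r\<^esub> \<otimes>\<^bsub>ext_affine_weyl r\<^esub> x = x"
    using im e by (auto simp: ext_affine_weyl_def place_perm_def tuples_def PiE_def extensional_def
        restrict_def fun_eq_iff)
  let ?y = "(inv_into UNIV \<sigma>, \<lambda>k \<in> {1..r}. - \<epsilon> (inv_into UNIV \<sigma> k))"
  have "?y \<in> carrier (ext_affine_weyl r)"
    using p by (auto simp: ext_affine_weyl_def sym_group_def tuples_def permutes_inv)
  moreover have "?y \<otimes>\<^bsub>ext_affine_weyl r\<^esub> x = \<one>\<^bsub>ext_affine_weyl r\<^esub>"
    using im p by (auto simp: ext_affine_weyl_def place_perm_def restrict_def fun_eq_iff
        permutes_inverses permutes_inv_o)
  ultimately show "\<exists>y \<in> carrier (ext_affine_weyl r). y \<otimes>\<^bsub>ext_affine_weyl r\<^esub> x = \<one>\<^bsub>ext_affine_weyl r\<^esub>"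
    by blast
qed

lemma aff_act_inv:
  assumes "w \<in> carrier (ext_affine_weyl r)" "i \<in> tuples r"
  shows "aff_act n r (inv\<^bsub>ext_affine_weyl r\<^esub> w) (aff_act n r w i) = i"
    and "aff_act n r w (aff_act n r (inv\<^bsub>ext_affine_weyl r\<^esub> w) i) = i"
proof -
  interpret group "ext_affine_weyl r" by (rule ext_affine_weyl_group)
  show "aff_act n r (inv\<^bsub>ext_affine_weyl r\<^esub> w) (aff_act n r w i) = i"
    "aff_act n r w (aff_act n r (inv\<^bsub>ext_affine_weyl r\<^esub> w) i) = i"
    using assms by (simp_all add: aff_act_mult aff_act_one)
qed

lemma aff_sim_iff:
  "aff_sim n r (i, j) (k, l) \<longleftrightarrow>
    (\<exists>w \<in> carrier (ext_affine_weyl r). k = aff_act n r w i \<and> l = aff_act n r w j)"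
  by (auto simp: aff_sim_def orbit_def pair_act_def)

lemma aff_sim_refl:
  assumes "x \<in> tuples r \<times> tuples r"
  shows "aff_sim n r x x"
proof -
  interpret group "ext_affine_weyl r" by (rule ext_affine_weyl_group)
  show ?thesis using assms by (cases x) (auto simp: aff_sim_iff aff_act_one intro!: bexI[of _ "\<one>\<^bsub>ext_affine_weyl r\<^esub>"])
qed

lemma aff_sim_sym:
  assumes "x \<in> tuples r \<times> tuples r" "aff_sim n r x y"
  shows "aff_sim n r y x"
proof -
  interpret group "ext_affine_weyl r" by (rule ext_affine_weyl_group)
  obtain i j k l where [simp]: "x = (i, j)" "y = (k, l)" by (cases x, cases y)
  from assms obtain w where "w \<in> carrier (ext_affine_weyl r)" "k = aff_act n r w i" "l = aff_act n r w j"
    by (auto simp: aff_sim_iff)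
  thus ?thesis using assms(1)
    by (auto simp: aff_sim_iff aff_act_inv intro!: bexI[of _ "inv\<^bsub>ext_affine_weyl r\<^esub> w"])
qed

lemma aff_sim_sym':
  assumes "aff_sim n r (i, j) (k, l)" "i \<in> tuples r" "j \<in> tuples r"
  shows "aff_sim n r (k, l) (i, j)"
  by (rule aff_sim_sym[OF _ assms(1)]) (simp add: assms(2,3))

lemma aff_sim_trans:
  assumes "aff_sim n r x y" "aff_sim n r y z"
  shows "aff_sim n r x z"
proof -
  interpret group "ext_affine_weyl r" by (rule ext_affine_weyl_group)
  obtain i j k l p q where [simp]: "x = (i, j)" "y = (k, l)" "z = (p, q)"
    by (cases x, cases y, cases z)
  obtain v where v: "v \<in> carrier (ext_affine_weyl r)" "k = aff_act n r v i" "l = aff_act n r v j"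
    using assms(1) by (auto simp: aff_sim_iff)
  obtain w where w: "w \<in> carrier (ext_affine_weyl r)" "p = aff_act n r w k" "q = aff_act n r w l"
    using assms(2) by (auto simp: aff_sim_iff)
  have "v \<otimes>\<^bsub>ext_affine_weyl r\<^esub> w \<in> carrier (ext_affine_weyl r)"
    using v(1) w(1) by simp
  moreover have "p = aff_act n r (v \<otimes>\<^bsub>ext_affine_weyl r\<^esub> w) i"
    unfolding w(2) v(2) by (rule aff_act_mult[OF v(1) w(1)])
  moreover have "q = aff_act n r (v \<otimes>\<^bsub>ext_affine_weyl r\<^esub> w) j"
    unfolding w(3) v(3) by (rule aff_act_mult[OF v(1) w(1)])
  ultimately have "aff_sim n r (i, j) (p, q)"
    unfolding aff_sim_iff by blast
  thus ?thesis by simp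
qed

lemma pair_orbit_eq_iff:
  assumes "x \<in> tuples r \<times> tuples r" "y \<in> tuples r \<times> tuples r"
  shows "orbit (ext_affine_weyl r) (pair_act n r) x = orbit (ext_affine_weyl r) (pair_act n r) y
    \<longleftrightarrow> aff_sim n r x y"
proof -
  have O: "orbit (ext_affine_weyl r) (pair_act n r) z = {u. aff_sim n r z u}" for z
    by (simp add: aff_sim_def)
  show ?thesis
    unfolding O using assms by (blast intro: aff_sim_refl aff_sim_sym aff_sim_trans)
qed

lemma xi_eq_iff:
  assumes "i \<in> tuples r" "j \<in> tuples r" "k \<in> tuples r" "l \<in> tuples r"
  shows "(xi n r i j :: 'k::field schur) = xi n r k l \<longleftrightarrow> aff_sim n r (i, j) (k, l)"
proof -
  have "Poly_Mapping.single a (1::'k) = Poly_Mapping.single b 1 \<longleftrightarrow> a = b"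
    for a b :: "(tuple \<times> tuple) set"
    by (metis keys_single singleton_inject zero_neq_one)
  thus ?thesis using assms by (simp add: xi_def pair_orbit_eq_iff)
qed

lemma schur_Z_cong:
  assumes "i \<in> tuples r" "j \<in> tuples r" "k \<in> tuples r" "l \<in> tuples r" "p \<in> tuples r" "q \<in> tuples r"
    and 1: "aff_sim n r (i, j) (i', j')" and 2: "aff_sim n r (k, l) (k', l')"
    and 3: "aff_sim n r (p, q) (p', q')"
  shows "schur_Z n r i j k l p q = schur_Z n r i' j' k' l' p' q'"
proof -
  interpret group "ext_affine_weyl r" by (rule ext_affine_weyl_group)
  let ?W = "ext_affine_weyl r"
  from 3 obtain w where w: "w \<in> carrier ?W" and pq: "p' = aff_act n r w p" "q' = aff_act n r w q"
    by (auto simp: aff_sim_iff)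
  have a: "aff_sim n r (x, y) (aff_act n r w x, aff_act n r w y)" for x y
    using w by (auto simp: aff_sim_iff)
  have b: "aff_sim n r (x, y) (aff_act n r (inv\<^bsub>?W\<^esub> w) x, aff_act n r (inv\<^bsub>?W\<^esub> w) y)" for x y
    using w by (auto simp: aff_sim_iff)
  have ij: "aff_sim n r (i', j') (i, j)"
    by (rule aff_sim_sym'[OF 1]) (use assms in simp_all)
  have kl: "aff_sim n r (k', l') (k, l)"
    by (rule aff_sim_sym'[OF 2]) (use assms in simp_all)
  let ?A = "{s \<in> tuples r. aff_sim n r (i, j) (p, s) \<and> aff_sim n r (s, q) (k, l)}"
  let ?B = "{s \<in> tuples r. aff_sim n r (i', j') (p', s) \<and> aff_sim n r (s, q') (k', l')}"
  have "bij_betw (aff_act n r w) ?A ?B"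
  proof (rule bij_betw_byWitness[where f' = "aff_act n r (inv\<^bsub>?W\<^esub> w)"])
    show "\<forall>s\<in>?A. aff_act n r (inv\<^bsub>?W\<^esub> w) (aff_act n r w s) = s"
      using w by (simp add: aff_act_inv)
    show "\<forall>s\<in>?B. aff_act n r w (aff_act n r (inv\<^bsub>?W\<^esub> w) s) = s"
      using w by (simp add: aff_act_inv)
    show "aff_act n r w ` ?A \<subseteq> ?B"
    proof safe
      fix s assume s: "s \<in> tuples r" "aff_sim n r (i, j) (p, s)" "aff_sim n r (s, q) (k, l)"
      show "aff_act n r w s \<in> tuples r" by (rule aff_act_tuples)
      show "aff_sim n r (i', j') (p', aff_act n r w s)"
        using ij s a pq by (metis aff_sim_trans)
      have "aff_sim n r (aff_act n r w s, q') (s, q)"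
        unfolding pq by (rule aff_sim_sym'[OF a]) (use assms s in simp_all)
      thus "aff_sim n r (aff_act n r w s, q') (k', l')"
        using s 2 by (metis aff_sim_trans)
    qed
    have p: "aff_act n r (inv\<^bsub>?W\<^esub> w) p' = p" "aff_act n r (inv\<^bsub>?W\<^esub> w) q' = q"
      using pq w assms by (simp_all add: aff_act_inv)
    show "aff_act n r (inv\<^bsub>?W\<^esub> w) ` ?B \<subseteq> ?A"
    proof safe
      fix s assume s: "s \<in> tuples r" "aff_sim n r (i', j') (p', s)" "aff_sim n r (s, q') (k', l')"
      let ?s = "aff_act n r (inv\<^bsub>?W\<^esub> w) s"
      show "?s \<in> tuples r" by (rule aff_act_tuples)
      show "aff_sim n r (i, j) (p, ?s)"
        using 1 s b p by (metis aff_sim_trans)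
      have "aff_sim n r (?s, q) (s, q')"
        using aff_sim_sym'[OF b[of s q']] s pq p by (simp add: aff_act_tuples)
      thus "aff_sim n r (?s, q) (k, l)"
        using s kl by (metis aff_sim_trans)
    qed
  qed
  thus ?thesis unfolding schur_Z_def by (rule bij_betw_same_card)
qed

lemma rep_orbit:
  assumes "i \<in> tuples r" "j \<in> tuples r"
    and "rep (orbit (ext_affine_weyl r) (pair_act n r) (i, j)) = (k, l)"
  shows "aff_sim n r (i, j) (k, l)" "k \<in> tuples r" "l \<in> tuples r"
proof -
  have "aff_sim n r (i, j) (i, j)" using assms by (auto intro: aff_sim_refl)
  hence "rep (orbit (ext_affine_weyl r) (pair_act n r) (i, j)) \<in>
      orbit (ext_affine_weyl r) (pair_act n r) (i, j)"
    unfolding rep_def aff_sim_def by (rule someI)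
  thus *: "aff_sim n r (i, j) (k, l)" using assms by (simp add: aff_sim_def)
  show "k \<in> tuples r" "l \<in> tuples r" using * by (auto simp: aff_sim_iff aff_act_tuples)
qed

lemma finite_aff_transporter:
  assumes "n > 0"
  shows "finite {w \<in> carrier (ext_affine_weyl r). aff_act n r w k = j}"
proof (rule inj_on_finite[where f = fst])
  show "finite {\<sigma>. \<sigma> permutes {1..r}}" by (rule finite_permutations) simp
  show "fst ` {w \<in> carrier (ext_affine_weyl r). aff_act n r w k = j} \<subseteq> {\<sigma>. \<sigma> permutes {1..r}}"
    by (auto simp: ext_affine_weyl_def sym_group_def)
  show "inj_on fst {w \<in> carrier (ext_affine_weyl r). aff_act n r w k = j}"
  proof (rule inj_onI, clarsimp simp: aff_act_def)
    fix \<sigma> \<epsilon> \<delta>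
    assume e: "(\<sigma>, \<epsilon>) \<in> carrier (ext_affine_weyl r)" "(\<sigma>, \<delta>) \<in> carrier (ext_affine_weyl r)"
      and eq: "shift n r \<delta> (place_perm \<sigma> k) = shift n r \<epsilon> (place_perm \<sigma> k)"
    have "\<epsilon> \<in> tuples r" "\<delta> \<in> tuples r" using e by (auto simp: ext_affine_weyl_def)
    moreover have "\<epsilon> m = \<delta> m" if "m \<in> {1..r}" for m
      using fun_cong[OF eq, of m] that assms by (simp add: shift_def)
    ultimately show "\<epsilon> = \<delta>" unfolding tuples_def by (rule PiE_ext)
  qed
qed

lemma finite_schur_Z:
  assumes "n > 0" "i \<in> tuples r" "j \<in> tuples r" "k \<in> tuples r" "l \<in> tuples r"
  shows "finite {s \<in> tuples r. aff_sim n r (i, j) (p, s) \<and> aff_sim n r (s, q) (k, l)}"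
    and "finite {\<gamma> \<in> pair_orbits n r. (case rep \<gamma> of (p, q) \<Rightarrow> schur_Z n r i j k l p q) \<noteq> 0}"
proof -
  let ?W = "ext_affine_weyl r"
  interpret group ?W by (rule ext_affine_weyl_group)
  have "{s \<in> tuples r. aff_sim n r (i, j) (p, s) \<and> aff_sim n r (s, q) (k, l)} \<subseteq>
      (\<lambda>w. aff_act n r w j) ` {w \<in> carrier ?W. aff_act n r w i = p}"
    by (auto simp: aff_sim_iff)
  thus "finite {s \<in> tuples r. aff_sim n r (i, j) (p, s) \<and> aff_sim n r (s, q) (k, l)}"
    by (rule finite_subset) (intro finite_imageI finite_aff_transporter assms)
  have "{\<gamma> \<in> pair_orbits n r. (case rep \<gamma> of (p, q) \<Rightarrow> schur_Z n r i j k l p q) \<noteq> 0} \<subseteq>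
      (\<lambda>w. orbit ?W (pair_act n r) (i, aff_act n r w l)) ` {w \<in> carrier ?W. aff_act n r w k = j}"
  proof
    fix \<gamma> assume "\<gamma> \<in> {\<gamma> \<in> pair_orbits n r. (case rep \<gamma> of (p, q) \<Rightarrow> schur_Z n r i j k l p q) \<noteq> 0}"
    then obtain p0 q0 p q where g: "\<gamma> = orbit ?W (pair_act n r) (p0, q0)" "p0 \<in> tuples r" "q0 \<in> tuples r"
      and rp: "rep \<gamma> = (p, q)" and nz: "schur_Z n r i j k l p q \<noteq> 0"
      by (auto simp: pair_orbits_def orbits_def split: prod.splits)
    note R = rep_orbit[OF g(2,3) rp[unfolded g(1)]]
    have gpq: "\<gamma> = orbit ?W (pair_act n r) (p, q)"
      using R g by (simp add: pair_orbit_eq_iff)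
    from nz obtain s where s: "s \<in> tuples r" "aff_sim n r (i, j) (p, s)" "aff_sim n r (s, q) (k, l)"
      unfolding schur_Z_def by (metis (mono_tags, lifting) card.empty Collect_empty_eq)
    from s(2) obtain v where v: "v \<in> carrier ?W" "p = aff_act n r v i" "s = aff_act n r v j"
      by (auto simp: aff_sim_iff)
    have "aff_sim n r (k, l) (s, q)" by (rule aff_sim_sym'[OF s(3)]) (use s R in simp_all)
    then obtain u where u: "u \<in> carrier ?W" "s = aff_act n r u k" "q = aff_act n r u l"
      by (auto simp: aff_sim_iff)
    let ?w = "u \<otimes>\<^bsub>?W\<^esub> inv\<^bsub>?W\<^esub> v"
    have w: "?w \<in> carrier ?W" using u v by simp
    have *: "aff_act n r ?w x = aff_act n r (inv\<^bsub>?W\<^esub> v) (aff_act n r u x)" for x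
      using u v by (simp add: aff_act_mult)
    have "aff_act n r ?w k = j"
      unfolding * using u(2) v assms by (metis aff_act_inv(1))
    moreover have "aff_sim n r (i, aff_act n r ?w l) (p, q)"
      unfolding aff_sim_iff * using v u R by (intro bexI[of _ v]) (auto simp: aff_act_inv)
    hence "aff_sim n r (p, q) (i, aff_act n r ?w l)"
      by (rule aff_sim_sym') (use assms in \<open>simp_all add: aff_act_tuples\<close>)
    hence "\<gamma> = orbit ?W (pair_act n r) (i, aff_act n r ?w l)"
      unfolding gpq using R assms by (subst pair_orbit_eq_iff) (simp_all add: aff_act_tuples)
    ultimately show "\<gamma> \<in> (\<lambda>w. orbit ?W (pair_act n r) (i, aff_act n r w l)) `
        {w \<in> carrier ?W. aff_act n r w k = j}"
      using w by blast
  qed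
  thus "finite {\<gamma> \<in> pair_orbits n r. (case rep \<gamma> of (p, q) \<Rightarrow> schur_Z n r i j k l p q) \<noteq> 0}"
    by (rule finite_subset) (intro finite_imageI finite_aff_transporter assms)
qed

theorem schur_mult_xi:
  assumes "i \<in> tuples r" "j \<in> tuples r" "k \<in> tuples r" "l \<in> tuples r"
    and rep: "\<And>\<gamma>. \<gamma> \<in> pair_orbits n r \<Longrightarrow> (p \<gamma>, q \<gamma>) \<in> \<gamma>"
  shows "schur_mult n r (xi n r i j) (xi n r k l :: 'k::field schur) =
    (\<Sum>\<gamma> \<in> {\<gamma> \<in> pair_orbits n r. schur_Z n r i j k l (p \<gamma>) (q \<gamma>) \<noteq> 0}.
       schur_smult (of_nat (schur_Z n r i j k l (p \<gamma>) (q \<gamma>))) (xi n r (p \<gamma>) (q \<gamma>)))"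
proof -
  let ?O = "\<lambda>x. orbit (ext_affine_weyl r) (pair_act n r) x"
  have sm1: "schur_smult 1 f = (f :: 'k schur)" for f
    unfolding schur_smult_def
    by (intro poly_mapping_eqI) (simp add: Poly_Mapping.map.rep_eq when_def)
  have sm: "schur_smult c (Poly_Mapping.single a 1) = Poly_Mapping.single a (c :: 'k)"
    for c and a :: "(tuple \<times> tuple) set"
    unfolding schur_smult_def by (simp add: map_single)
  have L: "schur_mult n r (xi n r i j) (xi n r k l :: 'k schur) = basis_mult n r (?O (i,j)) (?O (k,l))"
    by (simp add: schur_mult_def xi_def sm1)
  obtain i' j' k' l' where r: "rep (?O (i,j)) = (i',j')" "rep (?O (k,l)) = (k',l')"
    by (meson surj_pair)
  note R1 = rep_orbit[OF assms(1,2) r(1)] and R2 = rep_orbit[OF assms(3,4) r(2)]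
  have G: "(case rep \<gamma> of (p, q) \<Rightarrow> schur_Z n r i' j' k' l' p q) = schur_Z n r i j k l (p \<gamma>) (q \<gamma>)
      \<and> xi n r (p \<gamma>) (q \<gamma>) = (Poly_Mapping.single \<gamma> 1 :: 'k schur)"
    if \<gamma>: "\<gamma> \<in> pair_orbits n r" for \<gamma>
  proof -
    from \<gamma> obtain p0 q0 where g: "\<gamma> = ?O (p0, q0)" "p0 \<in> tuples r" "q0 \<in> tuples r"
      by (auto simp: pair_orbits_def orbits_def)
    obtain p1 q1 where r1: "rep \<gamma> = (p1, q1)" by fastforce
    note R = rep_orbit[OF g(2,3) r1[unfolded g(1)]]
    have s: "aff_sim n r (p0, q0) (p \<gamma>, q \<gamma>)"
      using rep[OF \<gamma>] g by (simp add: aff_sim_def)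
    hence t: "p \<gamma> \<in> tuples r" "q \<gamma> \<in> tuples r" by (auto simp: aff_sim_iff aff_act_tuples)
    have "aff_sim n r (p \<gamma>, q \<gamma>) (p1, q1)"
      by (rule aff_sim_trans[OF aff_sim_sym'[OF s g(2,3)] R(1)])
    hence "schur_Z n r i j k l (p \<gamma>) (q \<gamma>) = schur_Z n r i' j' k' l' p1 q1"
      using assms t R1 R2 by (intro schur_Z_cong) auto
    moreover have "?O (p \<gamma>, q \<gamma>) = ?O (p0, q0)"
      by (subst pair_orbit_eq_iff) (use t g(2,3) aff_sim_sym'[OF s g(2,3)] in simp_all)
    hence "?O (p \<gamma>, q \<gamma>) = \<gamma>" unfolding g(1)[symmetric] .
    ultimately show ?thesis by (simp add: r1 xi_def)
  qed
  show ?thesis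
    unfolding L basis_mult_def r Let_def prod.case
    by (rule sum.cong) (auto simp: G sm)
qed

end

theory Submission
  imports Defs
begin

text \<open>
  Write the affine Schur algebra as an algebra of matrices indexed by \<open>I(\<int>,r)\<close>: the coefficient of
  \<open>\<xi>\<^sub>i\<^sub>,\<^sub>j\<close> is the common value of the entries on the orbit of \<open>(i,j)\<close>, and the structure constants become
  those of matrix multiplication (\<open>entry_mult\<close>). The elements correspond to the matrices that are
  invariant under the extended affine Weyl group and vanish outside a band around the diagonal
  (\<open>of_matrix_in_carrier\<close>, \<open>banded_entry\<close>).

  A symmetric Laurent polynomial \<open>F = \<Sum>\<^sub>a F\<^sub>a t\<^sup>a\<close> defines such a matrix, with entry \<open>F\<^sub>a\<close> at
  \<open>(p, p + na)\<close>. It commutes with every invariant matrix, since an invariant matrix does not change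
  when both indices are translated by \<open>na\<close> (\<open>scalar_elt_central\<close>). Products of such matrices
  correspond to products of Laurent polynomials, and \<open>c\<^sub>\<epsilon>\<close> is the matrix of the sum of the monomials
  in the orbit of \<open>t\<^sup>\<epsilon>\<close> (\<open>c_elt_eq_scalar_elt\<close>).

  Conversely, let \<open>z\<close> be central and supported in the band \<open>\<bar>p\<^sub>j - q\<^sub>j\<bar> \<le> B\<close>. Test it against the
  matrices that add \<open>c\<close> to a single entry of a prescribed residue class modulo \<open>n\<close>. When
  \<open>\<bar>c\<bar> > 2B\<close>, the terms of \<open>Xz = zX\<close> that shift a wrong place fall outside the band, and what remains is a
  relation for one place at a time (\<open>central_shift_relation\<close>). It says that nonzero entries
  occur at congruent indices only, and that an entry is unchanged when both indices are shifted at the same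
  place by the same amount. Hence \<open>z\<close> depends on \<open>(q - p)/n\<close> only, symmetrically, and is the matrix of
  a symmetric Laurent polynomial (\<open>center_affine_schur\<close>).

  The center is therefore the ring of symmetric Laurent polynomials in \<open>r\<close> variables. By a
  leading term argument in the lexicographic order this ring is
  \<open>K[e\<^sub>1, \<dots>, e\<^sub>r, e\<^sub>r\<inverse>]\<close> with algebraically independent \<open>e\<^sub>k\<close> (\<open>elem_hom_eq_zero\<close>, \<open>elem_hom_surj\<close>), and
  \<open>e\<^sub>k\<close> corresponds to \<open>c\<^sub>\<epsilon>\<close> for \<open>\<epsilon> = \<epsilon>\<^sup>k\<close>. As this ring is a domain, it contains no
  nontrivial idempotent, and the algebra is indecomposable.
\<close>

abbreviation lookup :: "('a \<Rightarrow>\<^sub>0 'b::zero) \<Rightarrow> 'a \<Rightarrow> 'b"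
  where "lookup \<equiv> Poly_Mapping.lookup"

abbreviation keys :: "('a \<Rightarrow>\<^sub>0 'b::zero) \<Rightarrow> 'a set"
  where "keys \<equiv> Poly_Mapping.keys"

abbreviation single :: "'a \<Rightarrow> 'b \<Rightarrow> ('a \<Rightarrow>\<^sub>0 'b::zero)"
  where "single \<equiv> Poly_Mapping.single"

type_synonym 'k laurent = "(nat \<Rightarrow>\<^sub>0 int) \<Rightarrow>\<^sub>0 'k"

section \<open>Linear extension of maps on exponents\<close>

text \<open>
  Linear extension \<open>\<Sum>\<^sub>a F\<^sub>a a \<mapsto> \<Sum>\<^sub>a F\<^sub>a h(a)\<close> of a map \<open>h\<close> on exponents occurs with two kinds of
  values: scalars (coefficients, matrix entries) and Laurent polynomials (substitutions). The scalar
  embedding \<open>\<phi>\<close> makes both instances of one construction.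
\<close>

locale scalar_hom =
  fixes \<phi> :: "'k::comm_ring_1 \<Rightarrow> 'b::comm_ring_1"
  assumes hom_zero: "\<phi> 0 = 0"
    and hom_add: "\<phi> (x + y) = \<phi> x + \<phi> y"
    and hom_mult: "\<phi> (x * y) = \<phi> x * \<phi> y"
begin

definition extend :: "('a \<Rightarrow> 'b) \<Rightarrow> ('a \<Rightarrow>\<^sub>0 'k) \<Rightarrow> 'b"
  where "extend h F = (\<Sum>a\<in>keys F. \<phi> (lookup F a) * h a)"

lemma extend_superset:
  assumes "finite A" "keys F \<subseteq> A"
  shows "extend h F = (\<Sum>a\<in>A. \<phi> (lookup F a) * h a)"
  unfolding extend_def using assms
  by (intro sum.mono_neutral_left) (auto simp: in_keys_iff hom_zero)

lemma extend_zero [simp]: "extend h 0 = 0"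
  by (simp add: extend_def)

lemma extend_add: "extend h (F + G) = extend h F + extend h G"
proof -
  have "extend h X = (\<Sum>a\<in>keys F \<union> keys G. \<phi> (lookup X a) * h a)" if "X \<in> {F, G, F + G}" for X
    by (rule extend_superset) (use that Poly_Mapping.keys_add[of F G] in auto)
  thus ?thesis by (simp add: lookup_add hom_add distrib_right sum.distrib)
qed

lemma extend_sum: "extend h (\<Sum>i\<in>I. F i) = (\<Sum>i\<in>I. extend h (F i))"
  by (induction I rule: infinite_finite_induct) (simp_all add: extend_add)

lemma extend_single: "extend h (single a c) = \<phi> c * h a"
  by (simp add: extend_def hom_zero)

lemma extend_mult:
  fixes F :: "'a::comm_monoid_add \<Rightarrow>\<^sub>0 'k"
  shows "extend h (F * G) =
    (\<Sum>a\<in>keys F. \<Sum>b\<in>keys G. \<phi> (lookup F a) * \<phi> (lookup G b) * h (a + b))"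
proof -
  have expand: "X = (\<Sum>a\<in>keys X. single a (lookup X a))" for X :: "'a \<Rightarrow>\<^sub>0 'k"
    by (rule poly_mapping_eqI)
      (simp add: lookup_sum lookup_single when_def in_keys_iff sum.delta' if_distrib cong: if_cong)
  have "F * G = (\<Sum>a\<in>keys F. \<Sum>b\<in>keys G. single (a + b) (lookup F a * lookup G b))"
    by (subst expand[of F], subst expand[of G])
      (simp add: sum_distrib_left sum_distrib_right mult_single sum.swap[of _ "keys G"])
  thus ?thesis by (simp add: extend_sum extend_single hom_mult)
qed

text \<open>
  Multiplicativity of \<open>h\<close> is required on the supports only: products of elementary symmetric functions
  are multiplicative in the exponent only where all exponents but the last are nonnegative.
\<close>

lemma extend_mult_hom:
  fixes F :: "'a::comm_monoid_add \<Rightarrow>\<^sub>0 'k"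
  assumes "\<And>a b. a \<in> keys F \<Longrightarrow> b \<in> keys G \<Longrightarrow> h (a + b) = h a * h b"
  shows "extend h (F * G) = extend h F * extend h G"
proof -
  have "extend h (F * G) =
      (\<Sum>a\<in>keys F. \<Sum>b\<in>keys G. \<phi> (lookup F a) * h a * (\<phi> (lookup G b) * h b))"
    unfolding extend_mult by (intro sum.cong refl) (simp add: assms algebra_simps)
  also have "\<dots> = extend h F * extend h G"
    by (simp add: extend_def sum_product)
  finally show ?thesis .
qed

end

interpretation coeff: scalar_hom "\<lambda>c::'k::comm_ring_1. c"
  by unfold_locales simp_all

interpretation const: scalar_hom "\<lambda>c::'k::comm_ring_1. single (0::'a::comm_monoid_add) c"
  by unfold_locales (simp_all add: single_add mult_single)

text \<open>
  Coefficient extraction is itself a linear extension, so that \<open>extend_mult\<close> computes the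
  coefficients of a product.
\<close>

lemma lookup_eq_extend:
  "lookup F c = coeff.extend (\<lambda>a. of_bool (a = c)) (F :: 'a \<Rightarrow>\<^sub>0 'k::comm_ring_1)"
  by (simp add: coeff.extend_def sum.delta' of_bool_def in_keys_iff if_distrib cong: if_cong)

section \<open>Leading terms in the lexicographic order\<close>

text \<open>
  Exponents carry the lexicographic order of \<^typ>\<open>nat \<Rightarrow>\<^sub>0 int\<close>, in which the smallest index decides first.
  The predicate says that \<open>F\<close> has leading term \<open>t\<^sup>a\<close> with coefficient one.
\<close>

definition monic_at :: "'k::comm_ring_1 laurent \<Rightarrow> (nat \<Rightarrow>\<^sub>0 int) \<Rightarrow> bool"
  where "monic_at F a \<longleftrightarrow> lookup F a = 1 \<and> (\<forall>b\<in>keys F. b \<le> a)"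

lemma monic_at_single: "monic_at (single a 1) a"
  by (auto simp: monic_at_def)

text \<open>
  The order is compatible with addition, hence the only pair of exponents \<open>x \<le> a\<close>, \<open>y \<le> b\<close> with sum
  \<open>a + b\<close> is \<open>(a, b)\<close>: leading terms multiply without cancellation.
\<close>

lemma monic_at_mult:
  assumes "monic_at F a" "monic_at G b"
  shows "monic_at (F * G) (a + b)"
  unfolding monic_at_def
proof safe
  have le: "x \<le> a" "y \<le> b" if "x \<in> keys F" "y \<in> keys G" for x y
    using that assms by (auto simp: monic_at_def)
  have "lookup (F * G) (a + b) = 
     (\<Sum>x\<in>keys F. \<Sum>y\<in>keys G. lookup F x * lookup G y * of_bool (x + y = a + b))"
    by (simp add: lookup_eq_extend[of "F * G"] coeff.extend_mult)
  also have "\<dots> = (\<Sum>x\<in>keys F. \<Sum>y\<in>keys G. (lookup F x * of_bool (x = a)) * (lookup G y * of_bool (y = b)))"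
  proof (intro sum.cong refl)
    fix x y assume xy: "x \<in> keys F" "y \<in> keys G"
    have "x + y = a + b \<longleftrightarrow> x = a \<and> y = b"
      using le[OF xy] by (metis add_le_less_mono add_less_le_mono order_le_less order_less_irrefl)
    thus "lookup F x * lookup G y * of_bool (x + y = a + b) =
        (lookup F x * of_bool (x = a)) * (lookup G y * of_bool (y = b))" by auto
  qed
  also have "\<dots> = lookup F a * lookup G b"
    unfolding sum_product[symmetric]
    by (simp add: lookup_eq_extend[of F a] lookup_eq_extend[of G b] coeff.extend_def)
  finally show "lookup (F * G) (a + b) = 1" using assms by (simp add: monic_at_def)
  fix c assume "c \<in> keys (F * G)"
  then obtain x y where "x \<in> keys F" "y \<in> keys G" "c = x + y"
    using keys_mult[of F G] by auto
  thus "c \<le> a + b" using le by (auto intro: add_mono)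
qed

section \<open>Exponent vectors\<close>

definition exps :: "nat \<Rightarrow> (nat \<Rightarrow>\<^sub>0 int) set"
  where "exps r = {a. keys a \<subseteq> {1..r}}"

text \<open>
  Tuples are \<^const>\<open>undefined\<close> outside \<open>{1..r}\<close>, while exponent vectors vanish there; this is the
  passage from the former to the latter.
\<close>

definition vec :: "nat \<Rightarrow> (nat \<Rightarrow> int) \<Rightarrow> (nat \<Rightarrow>\<^sub>0 int)"
  where "vec r f = Abs_poly_mapping (\<lambda>k. if k \<in> {1..r} then f k else 0)"

lemma lookup_vec [simp]: "lookup (vec r f) k = (if k \<in> {1..r} then f k else 0)"
proof -
  have "finite {k. (if k \<in> {1..r} then f k else 0) \<noteq> 0}"
    by (rule finite_subset[of _ "{1..r}"]) auto
  thus ?thesis unfolding vec_def by (subst lookup_Abs_poly_mapping) auto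
qed

lemma vec_in_exps [simp]: "vec r f \<in> exps r"
  by (auto simp: exps_def in_keys_iff split: if_splits)

lemma lookup_exps_outside: "a \<in> exps r \<Longrightarrow> k \<notin> {1..r} \<Longrightarrow> lookup a k = 0"
  by (auto simp: exps_def in_keys_iff)

lemma exps_eqI:
  assumes "a \<in> exps r" "b \<in> exps r" "\<And>k. k \<in> {1..r} \<Longrightarrow> lookup a k = lookup b k"
  shows "a = b"
  using assms by (metis lookup_exps_outside poly_mapping_eqI)

lemma exps_add: "a \<in> exps r \<Longrightarrow> b \<in> exps r \<Longrightarrow> a + b \<in> exps r"
  using Poly_Mapping.keys_add[of a b] by (auto simp: exps_def)

lemma exps_zero [simp]: "0 \<in> exps r"
  by (simp add: exps_def)

lemma less_exps_iff:
  "(a :: nat \<Rightarrow>\<^sub>0 int) < b \<longleftrightarrow> (\<exists>k. lookup a k < lookup b k \<and> (\<forall>l<k. lookup a l = lookup b l))"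
  by (simp add: less_poly_mapping.rep_eq less_fun_def)

abbreviation permute_exp :: "(nat \<Rightarrow> nat) \<Rightarrow> (nat \<Rightarrow>\<^sub>0 int) \<Rightarrow> (nat \<Rightarrow>\<^sub>0 int)"
  where "permute_exp \<equiv> Poly_Mapping.map_key"

lemma lookup_permute_exp:
  assumes "\<sigma> permutes A"
  shows "lookup (permute_exp \<sigma> a) k = lookup a (\<sigma> k)"
  using assms by (simp add: map_key.rep_eq permutes_inj)

lemma permute_exp_in_exps:
  assumes "\<sigma> permutes {1..r}" "a \<in> exps r"
  shows "permute_exp \<sigma> a \<in> exps r"
  using assms permutes_in_image[OF assms(1)]
  by (auto simp: exps_def in_keys_iff lookup_permute_exp[OF assms(1)])

lemma permute_exp_comp:
  assumes "\<sigma> permutes A" "\<tau> permutes A"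
  shows "permute_exp \<tau> (permute_exp \<sigma> a) = permute_exp (\<sigma> \<circ> \<tau>) a"
  by (rule poly_mapping_eqI)
    (simp add: lookup_permute_exp[OF assms(1)] lookup_permute_exp[OF assms(2)]
      lookup_permute_exp[OF permutes_compose[OF assms(2,1)]])

lemma permute_exp_inv:
  assumes "\<sigma> permutes A"
  shows "permute_exp \<sigma> (permute_exp (inv_into UNIV \<sigma>) a) = a"
    and "permute_exp (inv_into UNIV \<sigma>) (permute_exp \<sigma> a) = a"
  by (rule poly_mapping_eqI, simp add: lookup_permute_exp[OF assms]
      lookup_permute_exp[OF permutes_inv[OF assms]] permutes_inverses[OF assms])+

lemma permute_exp_vec:
  assumes "\<sigma> permutes {1..r}"
  shows "permute_exp \<sigma> (vec r f) = vec r (f \<circ> \<sigma>)"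
  using permutes_in_image[OF assms]
  by (intro poly_mapping_eqI) (simp add: lookup_permute_exp[OF assms] del: atLeastAtMost_iff)

lemma permute_exp_plus:
  assumes "\<sigma> permutes A"
  shows "permute_exp \<sigma> (a + b) = permute_exp \<sigma> a + permute_exp \<sigma> b"
  using assms by (simp add: map_key_plus permutes_inj)

section \<open>Symmetric Laurent polynomials\<close>

definition Sym :: "nat \<Rightarrow> 'k::comm_ring_1 laurent set"
  where "Sym r = {F. keys F \<subseteq> exps r \<and>
    (\<forall>\<sigma>. \<sigma> permutes {1..r} \<longrightarrow> (\<forall>a. lookup F (permute_exp \<sigma> a) = lookup F a))}"

text \<open>
  Invariance under permutations of the exponents is the same as being fixed by these substitutions,
  which are multiplicative. This makes closure of \<^const>\<open>Sym\<close> under products immediate.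
\<close>

definition permute_vars :: "(nat \<Rightarrow> nat) \<Rightarrow> 'k::comm_ring_1 laurent \<Rightarrow> 'k laurent"
  where "permute_vars \<sigma> = const.extend (\<lambda>a. single (permute_exp \<sigma> a) 1)"

lemma lookup_permute_vars:
  assumes "\<sigma> permutes A"
  shows "lookup (permute_vars \<sigma> F) (permute_exp \<sigma> a) = lookup F a"
proof -
  have "permute_exp \<sigma> b = permute_exp \<sigma> a \<longleftrightarrow> b = a" for b
    using permute_exp_inv(2)[OF assms] by metis
  thus ?thesis
    by (simp add: permute_vars_def const.extend_def lookup_sum mult_single lookup_single when_def
        sum.delta' in_keys_iff)
qed

lemma permute_vars_fixed_iff:
  assumes "\<sigma> permutes A"
  shows "permute_vars \<sigma> F = F \<longleftrightarrow> (\<forall>a. lookup F (permute_exp \<sigma> a) = lookup F a)"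
proof
  assume "permute_vars \<sigma> F = F"
  thus "\<forall>a. lookup F (permute_exp \<sigma> a) = lookup F a"
    using lookup_permute_vars[OF assms, of F] by simp
next
  assume *: "\<forall>a. lookup F (permute_exp \<sigma> a) = lookup F a"
  show "permute_vars \<sigma> F = F"
  proof (rule poly_mapping_eqI)
    fix b
    show "lookup (permute_vars \<sigma> F) b = lookup F b"
      using lookup_permute_vars[OF assms, of F "permute_exp (inv_into UNIV \<sigma>) b"] *
      by (metis permute_exp_inv(1)[OF assms])
  qed
qed

lemma Sym_iff:
  "F \<in> Sym r \<longleftrightarrow> keys F \<subseteq> exps r \<and> (\<forall>\<sigma>. \<sigma> permutes {1..r} \<longrightarrow> permute_vars \<sigma> F = F)"
  by (auto simp: Sym_def permute_vars_fixed_iff)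

lemma Sym_mult:
  assumes "F \<in> Sym r" "G \<in> Sym r"
  shows "F * G \<in> Sym r"
  unfolding Sym_iff
proof safe
  fix c assume "c \<in> keys (F * G)"
  then obtain a b where "a \<in> keys F" "b \<in> keys G" "c = a + b" using keys_mult[of F G] by auto
  thus "c \<in> exps r" using assms by (auto simp: Sym_def intro: exps_add)
next
  fix \<sigma> assume "\<sigma> permutes {1..r}"
  thus "permute_vars \<sigma> (F * G) = F * G"
    unfolding permute_vars_def
    by (subst const.extend_mult_hom)
      (use assms in \<open>auto simp: mult_single permute_exp_plus Sym_iff permute_vars_def\<close>)
qed

lemma Sym_add:
  assumes "F \<in> Sym r" "G \<in> Sym r"
  shows "F + G \<in> Sym r"
  using assms Poly_Mapping.keys_add[of F G] by (auto simp: Sym_def lookup_add)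

lemma Sym_zero: "0 \<in> Sym r"
  by (simp add: Sym_def)

lemma Sym_const_mono: "single (vec r (\<lambda>_. m)) c \<in> Sym r"
proof -
  have "permute_exp \<sigma> a = vec r (\<lambda>_. m) \<longleftrightarrow> a = vec r (\<lambda>_. m)" if s: "\<sigma> permutes {1..r}" for \<sigma> a
    using permute_exp_inv[OF s, of a] permute_exp_inv[OF s, of "vec r (\<lambda>_. m)"]
      permute_exp_vec[OF s, of "\<lambda>_. m"] by (auto simp: comp_def)
  hence "(vec r (\<lambda>_. m) = permute_exp \<sigma> a) = (vec r (\<lambda>_. m) = a)" if "\<sigma> permutes {1..r}" for \<sigma> a
    using that by metis
  thus ?thesis by (simp add: Sym_def lookup_single)
qed

lemma vec_zero: "vec r (\<lambda>_. 0) = 0"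
  by (rule poly_mapping_eqI) simp

lemma Sym_scalar: "single 0 c \<in> Sym r"
  using Sym_const_mono[of r 0 c] by (simp add: vec_zero)

lemma Sym_one: "1 \<in> Sym r"
  using Sym_scalar[of 1 r] by simp

lemma Sym_power: "F \<in> Sym r \<Longrightarrow> F ^ m \<in> Sym r"
  by (induction m) (simp_all add: Sym_one Sym_mult)

lemma Sym_prod: "(\<And>i. i \<in> I \<Longrightarrow> F i \<in> Sym r) \<Longrightarrow> (\<Prod>i\<in>I. F i) \<in> Sym r"
  by (induction I rule: infinite_finite_induct) (simp_all add: Sym_one Sym_mult)

lemma Sym_sum: "(\<And>i. i \<in> I \<Longrightarrow> F i \<in> Sym r) \<Longrightarrow> (\<Sum>i\<in>I. F i) \<in> Sym r"
  by (induction I rule: infinite_finite_induct) (simp_all add: Sym_zero Sym_add)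

definition orbit_sum :: "nat \<Rightarrow> (nat \<Rightarrow>\<^sub>0 int) \<Rightarrow> 'k::comm_ring_1 laurent"
  where "orbit_sum r a = (\<Sum>b\<in>{permute_exp \<sigma> a |\<sigma>. \<sigma> permutes {1..r}}. single b 1)"

lemma lookup_orbit_sum:
  "lookup (orbit_sum r a) b = of_bool (\<exists>\<sigma>. \<sigma> permutes {1..r} \<and> b = permute_exp \<sigma> a)"
proof -
  have "finite ((\<lambda>\<sigma>. permute_exp \<sigma> a) ` {\<sigma>. \<sigma> permutes {1..r}})"
    by (intro finite_imageI finite_permutations) simp
  hence "finite {permute_exp \<sigma> a |\<sigma>. \<sigma> permutes {1..r}}"
    by (simp add: setcompr_eq_image)
  thus ?thesis
    by (auto simp: orbit_sum_def lookup_sum lookup_single when_def)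
qed

lemma Sym_orbit_sum:
  assumes "a \<in> exps r"
  shows "(orbit_sum r a :: 'k::comm_ring_1 laurent) \<in> Sym r"
  unfolding Sym_def
proof (safe)
  fix b assume "b \<in> keys (orbit_sum r a :: 'k laurent)"
  thus "b \<in> exps r" using assms
    by (auto simp: in_keys_iff lookup_orbit_sum permute_exp_in_exps)
next
  fix \<sigma> b assume s: "\<sigma> permutes {1..r}"
  have "(\<exists>\<tau>. \<tau> permutes {1..r} \<and> permute_exp \<sigma> b = permute_exp \<tau> a) \<longleftrightarrow>
      (\<exists>\<tau>. \<tau> permutes {1..r} \<and> b = permute_exp \<tau> a)"
    by (metis permute_exp_comp permute_exp_inv(2) permutes_compose permutes_inv s)
  thus "lookup (orbit_sum r a :: 'k laurent) (permute_exp \<sigma> b) = lookup (orbit_sum r a) b"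
    by (simp only: lookup_orbit_sum)
qed

definition dominant :: "nat \<Rightarrow> (nat \<Rightarrow>\<^sub>0 int) set"
  where "dominant r = {a \<in> exps r. \<forall>i\<in>{1..r}. \<forall>j\<in>{1..r}. i \<le> j \<longrightarrow> lookup a j \<le> lookup a i}"

text \<open>
  Suppose a rearrangement \<open>b\<close> of a weakly decreasing \<open>a\<close> agrees with \<open>a\<close> before place \<open>k\<close> and has
  \<open>v = b\<^sub>k > a\<^sub>k\<close>. The entries \<open>\<ge> v\<close> of \<open>a\<close> all stand before place \<open>k\<close>, and \<open>b\<close> has the same ones plus
  \<open>b\<^sub>k\<close>; but a rearrangement has equally many entries \<open>\<ge> v\<close>.
\<close>

lemma permute_dominant_le:
  assumes "a \<in> dominant r" "\<sigma> permutes {1..r}"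
  shows "permute_exp \<sigma> a \<le> a"
proof (rule ccontr)
  note lk = lookup_permute_exp[OF assms(2)]
  have a: "a \<in> exps r" using assms by (simp add: dominant_def)
  assume "\<not> permute_exp \<sigma> a \<le> a"
  then obtain k where k: "lookup a k < lookup a (\<sigma> k)" "\<And>l. l < k \<Longrightarrow> lookup a l = lookup a (\<sigma> l)"
    by (auto simp: not_le less_exps_iff lk)
  have kr: "k \<in> {1..r}"
  proof (rule ccontr)
    assume "k \<notin> {1..r}"
    with k(1) show False using permutes_not_in[OF assms(2)] by fastforce
  qed
  \<comment> \<open>\<open>A\<close> and \<open>B\<close> are the places of the entries \<open>\<ge> v\<close> before and after the rearrangement.\<close>
  define v where "v = lookup a (\<sigma> k)"
  define A where "A = {j \<in> {1..r}. v \<le> lookup a j}"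
  define B where "B = {j \<in> {1..r}. v \<le> lookup a (\<sigma> j)}"
  have AB: "\<sigma> ` B = A"
  proof safe
    fix j assume "j \<in> B" thus "\<sigma> j \<in> A"
      using permutes_in_image[OF assms(2)] by (auto simp: A_def B_def)
  next
    fix j assume j: "j \<in> A"
    hence "inv_into UNIV \<sigma> j \<in> B"
      using permutes_in_image[OF permutes_inv[OF assms(2)]] permutes_inverses(1)[OF assms(2)]
      by (auto simp: A_def B_def)
    thus "j \<in> \<sigma> ` B" using permutes_inverses(1)[OF assms(2), of j] by (metis image_eqI)
  qed
  have "A \<subseteq> {1..<k}"
  proof
    fix j assume j: "j \<in> A"
    have "j < k"
    proof (rule ccontr)
      assume "\<not> j < k"
      hence "lookup a j \<le> lookup a k" using j kr assms(1) by (auto simp: dominant_def A_def)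
      thus False using j k(1) by (auto simp: A_def v_def)
    qed
    thus "j \<in> {1..<k}" using j by (auto simp: A_def)
  qed
  have "j \<in> B" if "j \<in> A" for j
  proof -
    have "j < k" using \<open>A \<subseteq> _\<close> that by auto
    thus ?thesis using that k(2)[of j] by (simp add: A_def B_def)
  qed
  moreover have "k \<in> B" using kr by (simp add: B_def v_def)
  ultimately have "insert k A \<subseteq> B" by auto
  moreover have "k \<notin> A" using \<open>A \<subseteq> _\<close> by auto
  moreover have "finite A" "finite B" by (auto simp: A_def B_def)
  ultimately have "card A < card B" by (metis card_insert_disjoint card_mono less_eq_Suc_le)
  moreover have "card A = card B"
    using AB permutes_inj[OF assms(2)] by (metis card_image inj_on_subset subset_UNIV)
  ultimately show False by simp
qed

lemma monic_at_orbit_sum: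
  assumes "a \<in> dominant r"
  shows "monic_at (orbit_sum r a :: 'k::comm_ring_1 laurent) a"
  unfolding monic_at_def lookup_orbit_sum
proof safe
  have "a = permute_exp id a" by (rule poly_mapping_eqI) (simp add: map_key.rep_eq)
  hence ex: "\<exists>\<sigma>. \<sigma> permutes {1..r} \<and> a = permute_exp \<sigma> a"
    using permutes_id by (intro exI[of _ id] conjI)
  show "of_bool (\<exists>\<sigma>. \<sigma> permutes {1..r} \<and> a = permute_exp \<sigma> a) = (1::'k)"
    by (simp only: ex of_bool_eq(2))
next
  fix b assume "b \<in> keys (orbit_sum r a :: 'k laurent)"
  then obtain \<sigma> where "\<sigma> permutes {1..r}" "b = permute_exp \<sigma> a"
    by (auto simp: in_keys_iff lookup_orbit_sum)
  thus "b \<le> a" using permute_dominant_le[OF assms] by simp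
qed

text \<open>Swapping two entries \<open>a\<^sub>i < a\<^sub>j\<close>, \<open>i < j\<close>, would give a larger exponent of the support.\<close>

lemma Sym_max_key_dominant:
  assumes "F \<in> Sym r" "a \<in> keys F" "\<And>b. b \<in> keys F \<Longrightarrow> b \<le> a"
  shows "a \<in> dominant r"
proof -
  have a: "a \<in> exps r" using assms by (auto simp: Sym_def)
  have "lookup a j \<le> lookup a i" if ij: "i \<in> {1..r}" "j \<in> {1..r}" "i \<le> j" for i j
  proof (rule ccontr)
    assume lt: "\<not> lookup a j \<le> lookup a i"
    hence "i < j" using ij by (cases "i = j") auto
    let ?t = "Transposition.transpose i j"
    have t: "?t permutes {1..r}" using ij by (intro permutes_swap_id)
    have "permute_exp ?t a \<in> keys F" using assms t by (auto simp: Sym_def in_keys_iff)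
    hence "permute_exp ?t a \<le> a" by (rule assms)
    moreover have "a < permute_exp ?t a"
      unfolding less_exps_iff using lt \<open>i < j\<close>
      by (intro exI[of _ i]) (auto simp: lookup_permute_exp[OF t] transpose_def)
    ultimately show False by simp
  qed
  thus ?thesis using a by (auto simp: dominant_def)
qed

text \<open>
  An entry of \<open>b\<close> can be moved to the first place without leaving the support, and a first entry is
  dominated by that of any lexicographic upper bound. This bounds the exponents that occur below a
  given leading term, which makes the reduction to elementary symmetric functions terminate.
\<close>

lemma Sym_entry_le:
  assumes "F \<in> Sym r" "a \<in> exps r" "\<And>b. b \<in> keys F \<Longrightarrow> b \<le> a" "b \<in> keys F" "j \<in> {1..r}"
  shows "lookup b j \<le> lookup a 1"
proof -
  let ?t = "Transposition.transpose 1 j"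
  have t: "?t permutes {1..r}" using assms(5) by (intro permutes_swap_id) auto
  have k: "permute_exp ?t b \<in> keys F" using assms t by (auto simp: Sym_def in_keys_iff)
  have "permute_exp ?t b \<in> exps r" using k assms(1) by (auto simp: Sym_def)
  hence 0: "lookup (permute_exp ?t b) 0 = lookup a 0"
    using assms(2) by (simp add: lookup_exps_outside)
  have "permute_exp ?t b \<le> a" using k by (rule assms)
  hence "lookup (permute_exp ?t b) 1 \<le> lookup a 1"
    unfolding order_le_less less_exps_iff using 0
    by (metis One_nat_def less_one linorder_neqE_nat order_less_irrefl)
  thus ?thesis by (simp only: lookup_permute_exp[OF t] transpose_apply_first)
qed

section \<open>Elementary symmetric functions generate\<close>

lemma eps_apply: "eps r k i = (if i \<in> {1..r} then of_bool (i \<le> k) else undefined)"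
proof -
  have "i \<noteq> 0 \<Longrightarrow> (\<Sum>l = 1..k. if i = l then 1 else 0) = (of_bool (i \<le> k) :: int)"
    by (simp add: sum.delta)
  thus ?thesis by (auto simp: eps_def unit_tuple_def restrict_def)
qed

definition elem_sym :: "nat \<Rightarrow> nat \<Rightarrow> 'k::comm_ring_1 laurent"
  where "elem_sym r k = orbit_sum r (vec r (eps r k))"

lemma Sym_elem_sym: "elem_sym r k \<in> Sym r"
  by (simp add: elem_sym_def Sym_orbit_sum)

lemma monic_at_elem_sym: "monic_at (elem_sym r k) (vec r (eps r k))"
  unfolding elem_sym_def
  by (rule monic_at_orbit_sum) (auto simp: dominant_def eps_apply)

lemma elem_sym_nonneg:
  assumes "a \<in> keys (elem_sym r k)"
  shows "0 \<le> lookup a i"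
proof -
  from assms obtain \<sigma> where s: "\<sigma> permutes {1..r}" "a = permute_exp \<sigma> (vec r (eps r k))"
    by (auto simp: elem_sym_def in_keys_iff lookup_orbit_sum split: if_splits)
  show ?thesis unfolding s(2) lookup_permute_exp[OF s(1)] by (auto simp: eps_apply)
qed

text \<open>
  The exponents of the monomials in \<open>K[t\<^sub>1, \<dots>, t\<^sub>r\<^sub>-\<^sub>1, t\<^sub>r, t\<^sub>r\<inverse>]\<close>.
\<close>

definition cone :: "nat \<Rightarrow> (nat \<Rightarrow>\<^sub>0 int) set"
  where "cone r = {a \<in> exps r. \<forall>k\<in>{1..<r}. 0 \<le> lookup a k}"

lemma cone_add: "a \<in> cone r \<Longrightarrow> b \<in> cone r \<Longrightarrow> a + b \<in> cone r"
  by (auto simp: cone_def exps_add lookup_add)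

lemma cone_zero: "0 \<in> cone r"
  by (simp add: cone_def)

text \<open>
  The image \<open>e\<^sub>1^a\<^sub>1 \<cdots> e\<^sub>r^a\<^sub>r\<close> of \<open>t\<^sup>a\<close>. Since \<open>e\<^sub>r\<close> is the monomial \<open>t\<^sub>1 \<cdots> t\<^sub>r\<close>, its power for a possibly
  negative exponent is written as a monomial.
\<close>

definition elem_mono :: "nat \<Rightarrow> (nat \<Rightarrow>\<^sub>0 int) \<Rightarrow> 'k::comm_ring_1 laurent"
  where "elem_mono r a =
    (\<Prod>k\<in>{1..<r}. elem_sym r k ^ nat (lookup a k)) * single (vec r (\<lambda>_. lookup a r)) 1"

lemma elem_mono_zero: "elem_mono r 0 = 1"
  by (simp add: elem_mono_def vec_zero)

lemma elem_mono_add: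
  assumes "a \<in> cone r" "b \<in> cone r"
  shows "elem_mono r (a + b) = elem_mono r a * elem_mono r b"
proof -
  have "(\<Prod>k\<in>{1..<r}. elem_sym r k ^ nat (lookup (a + b) k)) =
      (\<Prod>k\<in>{1..<r}. elem_sym r k ^ nat (lookup a k)) * (\<Prod>k\<in>{1..<r}. elem_sym r k ^ nat (lookup b k) :: 'a laurent)"
    unfolding prod.distrib[symmetric] using assms
    by (intro prod.cong refl) (simp add: cone_def lookup_add nat_add_distrib power_add)
  moreover have "vec r (\<lambda>_. lookup (a + b) r) = vec r (\<lambda>_. lookup a r) + vec r (\<lambda>_. lookup b r)"
    by (rule poly_mapping_eqI) (simp add: lookup_add)
  hence "single (vec r (\<lambda>_. lookup (a + b) r)) (1::'a) =
      single (vec r (\<lambda>_. lookup a r)) 1 * single (vec r (\<lambda>_. lookup b r)) 1"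
    by (simp add: mult_single)
  ultimately show ?thesis by (simp add: elem_mono_def algebra_simps)
qed

lemma Sym_elem_mono: "elem_mono r a \<in> Sym r"
  unfolding elem_mono_def by (intro Sym_mult Sym_prod Sym_power Sym_elem_sym Sym_const_mono)

text \<open>
  The leading exponent of \<open>e\<^sub>k\<close> is \<open>(1, \<dots>, 1, 0, \<dots>, 0)\<close> with \<open>k\<close> ones, so that the leading exponent of
  \<open>e\<^sub>1^a\<^sub>1 \<cdots> e\<^sub>r^a\<^sub>r\<close> consists of the tail sums of \<open>a\<close>. Taking tail sums is a bijection from the cone
  onto the weakly decreasing exponents, with successive differences as inverse.
\<close>

definition elem_lead :: "nat \<Rightarrow> (nat \<Rightarrow>\<^sub>0 int) \<Rightarrow> (nat \<Rightarrow>\<^sub>0 int)"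
  where "elem_lead r a = vec r (\<lambda>i. \<Sum>k\<in>{i..r}. lookup a k)"

lemma monic_at_power:
  assumes "monic_at F (vec r f)"
  shows "monic_at (F ^ m) (vec r (\<lambda>i. int m * f i))"
proof (induction m)
  case 0
  show ?case using monic_at_single[of 0] by (simp add: vec_zero)
next
  case (Suc m)
  have "vec r (\<lambda>i. int (Suc m) * f i) = vec r f + vec r (\<lambda>i. int m * f i)"
    by (rule poly_mapping_eqI) (simp add: lookup_add algebra_simps)
  thus ?case using monic_at_mult[OF assms Suc.IH] by simp
qed

lemma monic_at_prod:
  assumes "\<And>k. k \<in> A \<Longrightarrow> monic_at (F k) (vec r (f k))"
  shows "monic_at (\<Prod>k\<in>A. F k) (vec r (\<lambda>i. \<Sum>k\<in>A. f k i))"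
  using assms
proof (induction A rule: infinite_finite_induct)
  case (insert x A)
  have "vec r (\<lambda>i. \<Sum>k\<in>insert x A. f k i) = vec r (f x) + vec r (\<lambda>i. \<Sum>k\<in>A. f k i)"
    using insert.hyps by (intro poly_mapping_eqI) (simp add: lookup_add)
  thus ?case using insert by (simp add: monic_at_mult)
qed (use monic_at_single[of 0] in \<open>simp_all add: vec_zero\<close>)

lemma monic_at_elem_mono:
  assumes "a \<in> cone r"
  shows "monic_at (elem_mono r a) (elem_lead r a)"
proof -
  have "monic_at (\<Prod>k\<in>{1..<r}. elem_sym r k ^ nat (lookup a k) :: 'a laurent)
      (vec r (\<lambda>i. \<Sum>k\<in>{1..<r}. int (nat (lookup a k)) * eps r k i))"
    by (intro monic_at_prod monic_at_power monic_at_elem_sym)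
  moreover have "elem_lead r a = vec r (\<lambda>i. \<Sum>k\<in>{1..<r}. int (nat (lookup a k)) * eps r k i) +
      vec r (\<lambda>_. lookup a r)"
  proof (rule poly_mapping_eqI)
    fix i
    have "(\<Sum>k\<in>{i..r}. lookup a k) =
      (\<Sum>k\<in>{1..<r}. int (nat (lookup a k)) * eps r k i) + lookup a r" if i: "i \<in> {1..r}"
    proof -
      have "(\<Sum>k\<in>{i..r}. lookup a k) = (\<Sum>k\<in>{i..<r}. lookup a k) + lookup a r"
        using i by (simp add: sum.last_plus)
      also have "(\<Sum>k\<in>{i..<r}. lookup a k) = (\<Sum>k\<in>{1..<r}. int (nat (lookup a k)) * eps r k i)"
        using i assms by (intro sum.mono_neutral_cong_left) (auto simp: eps_apply cone_def)
      finally show ?thesis .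
    qed
    thus "lookup (elem_lead r a) i =
      lookup (vec r (\<lambda>i. \<Sum>k\<in>{1..<r}. int (nat (lookup a k)) * eps r k i) + vec r (\<lambda>_. lookup a r)) i"
      by (simp add: elem_lead_def lookup_add)
  qed
  ultimately show ?thesis
    unfolding elem_mono_def by (simp add: monic_at_mult monic_at_single)
qed

lemma elem_lead_diff:
  assumes "a \<in> exps r" "k \<in> {1..r}"
  shows "lookup (elem_lead r a) k - lookup (elem_lead r a) (Suc k) = lookup a k"
proof -
  have "(\<Sum>j\<in>{k..r}. lookup a j) = lookup a k + (\<Sum>j\<in>{Suc k..r}. lookup a j)"
    using assms(2) by (simp add: sum.atLeast_Suc_atMost)
  thus ?thesis using assms(2) by (auto simp: elem_lead_def)
qed

lemma elem_lead_inj: "inj_on (elem_lead r) (exps r)"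
  by (rule inj_onI) (metis elem_lead_diff exps_eqI)

lemma dominant_eq_elem_lead:
  assumes "b \<in> dominant r"
  obtains a where "a \<in> cone r" "elem_lead r a = b"
proof
  have b: "b \<in> exps r" using assms by (simp add: dominant_def)
  \<comment> \<open>The entry of \<open>b\<close> at \<open>r + 1\<close> is zero, so the last difference is the last entry of \<open>b\<close>.\<close>
  let ?a = "vec r (\<lambda>k. lookup b k - lookup b (Suc k))"
  show "?a \<in> cone r" using assms by (auto simp: cone_def dominant_def)
  show "elem_lead r ?a = b"
  proof (rule exps_eqI[OF _ b])
    fix i assume i: "i \<in> {1..r}"
    have "(\<Sum>k\<in>{i..r}. lookup ?a k) = (\<Sum>k\<in>{i..r}. lookup b k - lookup b (Suc k))"
      using i by (intro sum.cong) auto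
    also have "\<dots> = - (\<Sum>k\<in>{i..r}. lookup b (Suc k) - lookup b k)"
      by (simp add: sum_negf[symmetric])
    also have "\<dots> = lookup b i - lookup b (Suc r)"
      using i by (subst sum_Suc_diff) auto
    also have "lookup b (Suc r) = 0" using b by (rule lookup_exps_outside) simp
    finally show "lookup (elem_lead r ?a) i = lookup b i" using i by (simp add: elem_lead_def)
  qed (simp add: elem_lead_def)
qed

lemma keys_mult_lower:
  assumes "\<And>a. a \<in> keys F \<Longrightarrow> (m::int) \<le> lookup a i" "\<And>b. b \<in> keys G \<Longrightarrow> m' \<le> lookup b i"
    and "c \<in> keys (F * G)"
  shows "m + m' \<le> lookup c i"
  using keys_mult[of F G] assms by (fastforce simp: lookup_add)

text \<open>
  Only the last factor can contribute negative entries. This bound from below is the counterpart of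
  \<open>Sym_entry_le\<close>.
\<close>

lemma elem_mono_lower:
  assumes "b \<in> keys (elem_mono r a)" "i \<in> {1..r}"
  shows "lookup a r \<le> lookup b i"
proof -
  have pw: "0 \<le> lookup c i" if "c \<in> keys (elem_sym r k ^ m :: 'a laurent)" for c k m
    using that
  proof (induction m arbitrary: c)
    case (Suc m)
    thus ?case using keys_mult_lower[of "elem_sym r k" 0 i "elem_sym r k ^ m" 0 c] elem_sym_nonneg
      by fastforce
  qed simp
  have pr: "0 \<le> lookup c i" if "c \<in> keys (\<Prod>k\<in>A. elem_sym r k ^ f k :: 'a laurent)" for c f A
    using that
  proof (induction A arbitrary: c rule: infinite_finite_induct)
    case (insert x A)
    thus ?case
      using keys_mult_lower[of "elem_sym r x ^ f x" 0 i "\<Prod>k\<in>A. elem_sym r k ^ f k" 0 c] pw by fastforce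
  qed simp_all
  have "0 + lookup a r \<le> lookup b i"
    by (rule keys_mult_lower[OF _ _ assms(1)[unfolded elem_mono_def]]) (use pr assms(2) in auto)
  thus ?thesis by simp
qed

definition elem_hom :: "nat \<Rightarrow> 'k::comm_ring_1 laurent \<Rightarrow> 'k laurent"
  where "elem_hom r = const.extend (elem_mono r)"

lemma elem_hom_add: "elem_hom r (F + G) = elem_hom r F + elem_hom r G"
  by (simp add: elem_hom_def const.extend_add)

lemma elem_hom_mult:
  assumes "keys F \<subseteq> cone r" "keys G \<subseteq> cone r"
  shows "elem_hom r (F * G) = elem_hom r F * elem_hom r G"
  unfolding elem_hom_def by (rule const.extend_mult_hom) (use assms in \<open>auto intro: elem_mono_add dest: subsetD\<close>)

lemma elem_hom_scalar: "elem_hom r (single 0 c) = single 0 c"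
  by (simp add: elem_hom_def const.extend_single elem_mono_zero)

lemma elem_hom_one: "elem_hom r 1 = 1"
  using elem_hom_scalar[of r 1] by simp

lemma Sym_elem_hom: "elem_hom r F \<in> Sym r"
  unfolding elem_hom_def const.extend_def by (intro Sym_sum Sym_mult Sym_scalar Sym_elem_mono)

lemma lookup_scalar_mult:
  fixes G :: "'a::monoid_add \<Rightarrow>\<^sub>0 'k::comm_ring_1"
  shows "lookup (single 0 c * G) a = c * lookup G a"
  by (simp add: mult_map_scale_conv_mult[symmetric] map.rep_eq when_def)

text \<open>
  Algebraic independence of the \<open>e\<^sub>k\<close>: the products \<open>elem_mono r a\<close> have distinct leading exponents, so
  the largest one among those occurring in a linear combination cannot cancel.
\<close>

lemma elem_hom_eq_zero:
  fixes F :: "'k::comm_ring_1 laurent"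
  assumes "keys F \<subseteq> cone r" "elem_hom r F = 0"
  shows "F = 0"
proof (rule ccontr)
  assume "F \<noteq> 0"
  hence ne: "elem_lead r ` keys F \<noteq> {}" and fin: "finite (elem_lead r ` keys F)" by auto
  obtain a where a1: "a \<in> keys F" and "elem_lead r a = Max (elem_lead r ` keys F)"
    using Max_in[OF fin ne] by (auto simp: image_iff)
  hence a: "a \<in> keys F" "\<And>b. b \<in> keys F \<Longrightarrow> elem_lead r b \<le> elem_lead r a"
    using fin by auto
  have 0: "lookup F b * lookup (elem_mono r b) (elem_lead r a) = lookup F b * of_bool (b = a)"
    if b: "b \<in> keys F" for b
  proof (cases "b = a")
    case True
    have "monic_at (elem_mono r a :: 'k laurent) (elem_lead r a)"
      using assms(1) a(1) by (intro monic_at_elem_mono) auto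
    thus ?thesis using True by (simp add: monic_at_def)
  next
    case False
    have "a \<in> exps r" "b \<in> exps r" using a b assms(1) by (auto simp: cone_def)
    hence "elem_lead r b \<noteq> elem_lead r a" using False elem_lead_inj[of r] by (auto dest: inj_onD)
    hence "elem_lead r b < elem_lead r a" using a(2)[OF b] by simp
    moreover have "monic_at (elem_mono r b :: 'k laurent) (elem_lead r b)"
      using assms(1) b by (intro monic_at_elem_mono) auto
    ultimately have "lookup (elem_mono r b :: 'k laurent) (elem_lead r a) = 0"
      by (metis in_keys_iff leD monic_at_def)
    thus ?thesis using False by simp
  qed
  have "lookup (elem_hom r F) (elem_lead r a) = (\<Sum>b\<in>keys F. lookup F b * of_bool (b = a))"
    unfolding elem_hom_def const.extend_def lookup_sum by (intro sum.cong refl) (simp add: 0 lookup_scalar_mult)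
  also have "\<dots> = lookup F a" using a(1) by simp
  finally show False using assms(2) a(1) by (simp add: in_keys_iff)
qed

text \<open>
  The fundamental theorem on symmetric functions, in its Laurent version. The leading exponent of a
  symmetric \<open>H\<close> is weakly decreasing, hence is that of some \<open>elem_mono r a\<close>, and subtracting a multiple
  of the latter lowers it. All exponents stay in a fixed finite box, so the process stops.
\<close>

lemma elem_hom_surj:
  fixes F :: "'k::comm_ring_1 laurent"
  assumes "F \<in> Sym r" "r > 0"
  obtains G where "keys G \<subseteq> cone r" "elem_hom r G = F"
proof -
  define V where "V = (\<Union>b\<in>keys F. lookup b ` {1..r})"
  have "finite V" by (auto simp: V_def)
  hence "bdd_below V" "bdd_above V" by (rule bdd_below_finite, rule bdd_above_finite)
  then obtain N M where "\<forall>x\<in>V. N \<le> x" and "\<forall>x\<in>V. x \<le> M"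
    unfolding bdd_below_def bdd_above_def by (elim exE)
  hence N: "N \<le> lookup b i" and M: "lookup b i \<le> M" if "b \<in> keys F" "i \<in> {1..r}" for b i
    using that by (auto simp: V_def)
  \<comment> \<open>\<open>N\<close> stays a lower bound by \<open>elem_mono_lower\<close> and \<open>M\<close> an upper bound by \<open>Sym_entry_le\<close>.\<close>
  define Box where "Box = {b \<in> exps r. \<forall>i\<in>{1..r}. lookup b i \<in> {N..M}}"
  have "finite Box"
  proof (rule finite_subset)
    show "Box \<subseteq> vec r ` ({1..r} \<rightarrow>\<^sub>E {N..M})"
    proof
      fix b assume b: "b \<in> Box"
      have "b = vec r (restrict (lookup b) {1..r})"
        using b by (intro exps_eqI[of _ r]) (auto simp: Box_def)
      thus "b \<in> vec r ` ({1..r} \<rightarrow>\<^sub>E {N..M})" using b by (auto simp: Box_def)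
    qed
    show "finite (vec r ` ({1..r} \<rightarrow>\<^sub>E {N..M}))" by (intro finite_imageI finite_PiE) auto
  qed
  have "\<exists>G. keys G \<subseteq> cone r \<and> elem_hom r G = H"
    if "H \<in> Sym r" "keys H \<subseteq> Box" for H :: "'k laurent"
    using that
    \<comment> \<open>The measure counts the elements of the box up to the leading exponent of \<open>H\<close>.\<close>
  proof (induction "card {b \<in> Box. \<exists>c\<in>keys H. b \<le> c}" arbitrary: H rule: less_induct)
    case (less H)
    show ?case
    proof (cases "H = 0")
      case True
      thus ?thesis by (intro exI[of _ 0]) (simp add: elem_hom_def)
    next
      case False
      define m where "m = Max (keys H)"
      have m: "m \<in> keys H" "\<And>b. b \<in> keys H \<Longrightarrow> b \<le> m"
        using False by (auto simp: m_def)
      have "m \<in> dominant r" using less.prems m by (intro Sym_max_key_dominant)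
      then obtain a where a: "a \<in> cone r" "elem_lead r a = m" by (rule dominant_eq_elem_lead)
      have mono: "monic_at (elem_mono r a :: 'k laurent) m" using monic_at_elem_mono[OF a(1)] a(2) by simp
      define c where "c = lookup H m"
      define H' where "H' = H + single 0 (- c) * elem_mono r a"
      have lk: "lookup H' e = lookup H e - c * lookup (elem_mono r a) e" for e
        by (simp add: H'_def lookup_add lookup_scalar_mult)
      have S: "H' \<in> Sym r"
        unfolding H'_def using less.prems by (intro Sym_add Sym_mult Sym_scalar Sym_elem_mono)
      have lt: "b < m" if "b \<in> keys H'" for b
      proof -
        have "b \<noteq> m" using that mono by (auto simp: in_keys_iff lk c_def monic_at_def)
        moreover have "b \<in> keys H \<or> b \<in> keys (elem_mono r a :: 'k laurent)"
          using that by (auto simp: in_keys_iff lk)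
        hence "b \<le> m" using m mono by (auto simp: monic_at_def)
        ultimately show ?thesis by simp
      qed
      have mB: "m \<in> Box" using m less.prems by auto
      have ar: "lookup a r = lookup m r" 
        using assms(2) by (simp add: a(2)[symmetric] elem_lead_def)
      have "keys H' \<subseteq> Box"
      proof
        fix b assume b: "b \<in> keys H'"
        have "lookup b i \<le> M" if "i \<in> {1..r}" for i
        proof -
          have "lookup b i \<le> lookup m 1"
            by (rule Sym_entry_le[OF S _ _ b that]) (use lt mB in \<open>auto simp: Box_def intro: less_imp_le\<close>)
          also have "\<dots> \<le> M" using mB assms(2) by (auto simp: Box_def)
          finally show ?thesis .
        qed
        moreover have "N \<le> lookup b i" if i: "i \<in> {1..r}" for i
        proof -
          have "b \<in> keys H \<or> b \<in> keys (elem_mono r a :: 'k laurent)"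
            using b by (auto simp: in_keys_iff lk)
          thus ?thesis
          proof
            assume "b \<in> keys H" thus ?thesis using less.prems i by (auto simp: Box_def)
          next
            assume "b \<in> keys (elem_mono r a :: 'k laurent)"
            hence "lookup a r \<le> lookup b i" by (rule elem_mono_lower) (rule i)
            moreover have "N \<le> lookup m r" using mB assms(2) by (auto simp: Box_def)
            ultimately show ?thesis using ar by simp
          qed
        qed
        moreover have "b \<in> exps r" using S b by (auto simp: Sym_def)
        ultimately show "b \<in> Box" by (auto simp: Box_def)
      qed
      moreover have "card {b \<in> Box. \<exists>c\<in>keys H'. b \<le> c} < card {b \<in> Box. \<exists>c\<in>keys H. b \<le> c}"
      proof (rule psubset_card_mono)
        show "finite {b \<in> Box. \<exists>c\<in>keys H. b \<le> c}" using \<open>finite Box\<close> by simp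
        have "m \<in> {b \<in> Box. \<exists>c\<in>keys H. b \<le> c}" using m mB by auto
        moreover have "m \<notin> {b \<in> Box. \<exists>c\<in>keys H'. b \<le> c}" using lt by (auto dest: leD)
        moreover have "{b \<in> Box. \<exists>c\<in>keys H'. b \<le> c} \<subseteq> {b \<in> Box. \<exists>c\<in>keys H. b \<le> c}"
          using lt m by (auto intro!: bexI[of _ m] dest: order_le_less_trans less_imp_le)
        ultimately show "{b \<in> Box. \<exists>c\<in>keys H'. b \<le> c} \<subset> {b \<in> Box. \<exists>c\<in>keys H. b \<le> c}" by blast
      qed
      ultimately obtain G where G: "keys G \<subseteq> cone r" "elem_hom r G = H'"
        using less.hyps S by blast
      have "elem_hom r (G + single a c) = H"
        unfolding elem_hom_add G by (simp add: elem_hom_def const.extend_single H'_def single_uminus)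
      moreover have "keys (G + single a c) \<subseteq> cone r"
        using G a Poly_Mapping.keys_add[of G "single a c"] by (auto split: if_splits)
      ultimately show ?thesis by blast
    qed
  qed
  moreover have "keys F \<subseteq> Box" using assms(1) N M by (auto simp: Box_def Sym_def)
  ultimately show ?thesis using assms(1) that by blast
qed

section \<open>The affine Schur algebra as an algebra of matrices\<close>

abbreviation pair_class :: "nat \<Rightarrow> nat \<Rightarrow> tuple \<Rightarrow> tuple \<Rightarrow> (tuple \<times> tuple) set"
  where "pair_class n r p q \<equiv> orbit (ext_affine_weyl r) (pair_act n r) (p, q)"

text \<open>
  An element \<open>\<Sum> f\<^sub>\<gamma> \<xi>\<^sub>\<gamma>\<close> is viewed as the matrix on \<open>I(\<int>,r)\<close> whose entry at \<open>(p,q)\<close> is the coefficient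
  of the orbit of \<open>(p,q)\<close>. The matrices that arise are the invariant ones that are banded:
  invariance expresses constancy on orbits, and a band meets finitely many orbits.
\<close>

definition entry :: "nat \<Rightarrow> nat \<Rightarrow> 'k::field schur \<Rightarrow> tuple \<Rightarrow> tuple \<Rightarrow> 'k"
  where "entry n r f p q = lookup f (pair_class n r p q)"

definition weyl_invariant :: "nat \<Rightarrow> nat \<Rightarrow> (tuple \<Rightarrow> tuple \<Rightarrow> 'k) \<Rightarrow> bool"
  where "weyl_invariant n r m \<longleftrightarrow> (\<forall>w\<in>carrier (ext_affine_weyl r). \<forall>p\<in>tuples r. \<forall>q\<in>tuples r.
    m (aff_act n r w p) (aff_act n r w q) = m p q)"

definition banded :: "nat \<Rightarrow> int \<Rightarrow> (tuple \<Rightarrow> tuple \<Rightarrow> 'k::zero) \<Rightarrow> bool"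
  where "banded r B m \<longleftrightarrow> (\<forall>p\<in>tuples r. \<forall>q\<in>tuples r. m p q \<noteq> 0 \<longrightarrow> (\<forall>j\<in>{1..r}. \<bar>p j - q j\<bar> \<le> B))"

lemma aff_act_apply:
  "aff_act n r (\<sigma>, \<delta>) p k = (if k \<in> {1..r} then p (\<sigma> k) + int n * \<delta> k else undefined)"
  by (simp add: aff_act_def shift_def place_perm_def)

lemma weyl_carrier_iff:
  "(\<sigma>, \<delta>) \<in> carrier (ext_affine_weyl r) \<longleftrightarrow> \<sigma> permutes {1..r} \<and> \<delta> \<in> tuples r"
  by (simp add: ext_affine_weyl_def sym_group_def)

lemma tuples_eqI:
  assumes "p \<in> tuples r" "q \<in> tuples r" "\<And>k. k \<in> {1..r} \<Longrightarrow> p k = q k"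
  shows "p = q"
  using assms unfolding tuples_def by (rule PiE_ext)

lemma bounded_tuples_subset: "bounded_tuples n r \<subseteq> tuples r"
  by (auto simp: bounded_tuples_def tuples_def)

lemma weyl_inv_carrier:
  "w \<in> carrier (ext_affine_weyl r) \<Longrightarrow> inv\<^bsub>ext_affine_weyl r\<^esub> w \<in> carrier (ext_affine_weyl r)"
  using group.inv_closed[OF ext_affine_weyl_group] .

lemma pair_class_eq_iff:
  assumes "p \<in> tuples r" "q \<in> tuples r" "u \<in> tuples r" "v \<in> tuples r"
  shows "pair_class n r p q = pair_class n r u v \<longleftrightarrow> aff_sim n r (p, q) (u, v)"
  using assms by (intro pair_orbit_eq_iff) auto

lemma pair_class_in_orbits:
  "p \<in> tuples r \<Longrightarrow> q \<in> tuples r \<Longrightarrow> pair_class n r p q \<in> pair_orbits n r"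
  by (auto simp: pair_orbits_def orbits_def)

lemma pair_orbits_rep:
  assumes "\<gamma> \<in> pair_orbits n r"
  obtains p q where "rep \<gamma> = (p, q)" "p \<in> tuples r" "q \<in> tuples r" "\<gamma> = pair_class n r p q"
proof -
  obtain p0 q0 where 0: "p0 \<in> tuples r" "q0 \<in> tuples r" "\<gamma> = pair_class n r p0 q0"
    using assms by (auto simp: pair_orbits_def orbits_def)
  obtain p q where pq: "rep \<gamma> = (p, q)" by fastforce
  note R = rep_orbit[OF 0(1,2) pq[unfolded 0(3)]]
  have "\<gamma> = pair_class n r p q" unfolding 0(3) using R 0 by (simp add: pair_class_eq_iff)
  with that pq R show ?thesis by blast
qed

lemma mem_pair_class: "(u, v) \<in> pair_class n r p q \<longleftrightarrow> aff_sim n r (p, q) (u, v)"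
  by (simp add: aff_sim_def)

lemma mem_pair_orbit_iff:
  assumes "\<gamma> \<in> pair_orbits n r" "p \<in> tuples r" "q \<in> tuples r"
  shows "(p, q) \<in> \<gamma> \<longleftrightarrow> \<gamma> = pair_class n r p q"
proof -
  obtain u v where "u \<in> tuples r" "v \<in> tuples r" "\<gamma> = pair_class n r u v"
    using pair_orbits_rep[OF assms(1)] by metis
  thus ?thesis using assms by (simp add: mem_pair_class pair_class_eq_iff)
qed

lemma weyl_invariant_entry: "weyl_invariant n r (entry n r f)"
  unfolding weyl_invariant_def
proof (intro ballI)
  fix w p q assume "w \<in> carrier (ext_affine_weyl r)" "p \<in> tuples r" "q \<in> tuples r"
  hence "pair_class n r p q = pair_class n r (aff_act n r w p) (aff_act n r w q)"
    by (subst pair_class_eq_iff) (auto simp: aff_act_tuples aff_sim_iff)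
  thus "entry n r f (aff_act n r w p) (aff_act n r w q) = entry n r f p q"
    by (simp add: entry_def)
qed

lemma carrier_affine_schur: "f \<in> carrier (affine_schur n r) \<longleftrightarrow> keys f \<subseteq> pair_orbits n r"
  by (simp add: affine_schur_def)

lemma affine_schur_eqI:
  assumes "f \<in> carrier (affine_schur n r)" "g \<in> carrier (affine_schur n r)"
    and "\<And>p q. p \<in> tuples r \<Longrightarrow> q \<in> tuples r \<Longrightarrow> entry n r f p q = entry n r g p q"
  shows "f = g"
proof (rule poly_mapping_eqI)
  fix \<gamma>
  show "lookup f \<gamma> = lookup g \<gamma>"
  proof (cases "\<gamma> \<in> pair_orbits n r")
    case True
    then obtain p q where "p \<in> tuples r" "q \<in> tuples r" "\<gamma> = pair_class n r p q"
      using pair_orbits_rep by metis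
    thus ?thesis using assms(3) by (simp add: entry_def)
  next
    case False
    hence "\<gamma> \<notin> keys f" "\<gamma> \<notin> keys g" using assms(1,2) by (auto simp: carrier_affine_schur)
    thus ?thesis by (simp add: in_keys_iff)
  qed
qed

text \<open>
  A group element permutes the differences \<open>p\<^sub>j - q\<^sub>j\<close>, so their absolute values are bounded on every
  orbit; the sum of the bounds over the support of \<open>f\<close> serves for all of them.
\<close>

lemma banded_entry:
  assumes "f \<in> carrier (affine_schur n r)"
  obtains B where "0 \<le> B" "banded r B (entry n r f)"
proof
  define c where "c \<gamma> j = \<bar>fst (rep \<gamma>) j - snd (rep \<gamma>) j\<bar>" for \<gamma> :: "(tuple \<times> tuple) set" and j
  show "0 \<le> (\<Sum>\<gamma>\<in>keys f. \<Sum>j\<in>{1..r}. c \<gamma> j)" by (simp add: sum_nonneg c_def)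
  show "banded r (\<Sum>\<gamma>\<in>keys f. \<Sum>j\<in>{1..r}. c \<gamma> j) (entry n r f)"
    unfolding banded_def
  proof (intro ballI impI)
    fix p q j assume p: "p \<in> tuples r" and q: "q \<in> tuples r" and nz: "entry n r f p q \<noteq> 0"
      and j: "j \<in> {1..r}"
    define \<gamma> where "\<gamma> = pair_class n r p q"
    have k: "\<gamma> \<in> keys f" using nz by (simp add: entry_def \<gamma>_def in_keys_iff)
    obtain u v where uv: "rep \<gamma> = (u, v)" "u \<in> tuples r" "v \<in> tuples r" "\<gamma> = pair_class n r u v"
      using pair_orbits_rep k assms unfolding carrier_affine_schur by (metis subsetD)
    hence "aff_sim n r (u, v) (p, q)" using p q pair_class_eq_iff unfolding \<gamma>_def by metis
    then obtain \<sigma> \<delta> where w: "(\<sigma>, \<delta>) \<in> carrier (ext_affine_weyl r)"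
      "p = aff_act n r (\<sigma>, \<delta>) u" "q = aff_act n r (\<sigma>, \<delta>) v"
      by (auto simp: aff_sim_iff)
    have "\<sigma> j \<in> {1..r}" using w(1) j permutes_in_image unfolding weyl_carrier_iff by metis
    moreover have "\<bar>p j - q j\<bar> = c \<gamma> (\<sigma> j)"
      unfolding w(2,3) using j by (simp add: aff_act_apply c_def uv(1))
    ultimately have "\<bar>p j - q j\<bar> \<le> (\<Sum>j\<in>{1..r}. c \<gamma> j)"
      by (auto intro: member_le_sum simp: c_def)
    also have "\<dots> \<le> (\<Sum>\<gamma>\<in>keys f. \<Sum>j\<in>{1..r}. c \<gamma> j)"
      using k by (intro member_le_sum) (auto simp: c_def intro: sum_nonneg)
    finally show "\<bar>p j - q j\<bar> \<le> (\<Sum>\<gamma>\<in>keys f. \<Sum>j\<in>{1..r}. c \<gamma> j)" .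
  qed
qed

lemma finite_band:
  fixes p :: tuple
  shows "finite {s \<in> tuples r. \<forall>j\<in>{1..r}. \<bar>p j - s j\<bar> \<le> B}"
proof (rule finite_subset)
  show "{s \<in> tuples r. \<forall>j\<in>{1..r}. \<bar>p j - s j\<bar> \<le> B} \<subseteq> (\<Pi>\<^sub>E j\<in>{1..r}. {p j - B..p j + B})"
    by (force simp: tuples_def PiE_iff)
  show "finite (\<Pi>\<^sub>E j\<in>{1..r}. {p j - B..p j + B})" by (intro finite_PiE) auto
qed

lemma finite_row:
  assumes "f \<in> carrier (affine_schur n r)" "p \<in> tuples r"
  shows "finite {s \<in> tuples r. entry n r f p s \<noteq> 0}"
proof -
  obtain B where "0 \<le> B" "banded r B (entry n r f)" using assms(1) by (rule banded_entry)
  hence "{s \<in> tuples r. entry n r f p s \<noteq> 0} \<subseteq> {s \<in> tuples r. \<forall>j\<in>{1..r}. \<bar>p j - s j\<bar> \<le> B}"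
    using assms(2) by (auto simp: banded_def)
  thus ?thesis using finite_band finite_subset by blast
qed

text \<open>
  The structure constant \<open>Z\<close> counts the \<open>s\<close> through which \<open>(p,q)\<close> factors as a pair in the first orbit
  followed by a pair in the second.
\<close>

lemma lookup_basis_mult:
  assumes "n > 0" "\<alpha> \<in> pair_orbits n r" "\<beta> \<in> pair_orbits n r" "p \<in> tuples r" "q \<in> tuples r"
  shows "lookup (basis_mult n r \<alpha> \<beta> :: 'k::field schur) (pair_class n r p q) =
    of_nat (card {s \<in> tuples r. (p, s) \<in> \<alpha> \<and> (s, q) \<in> \<beta>})"
proof -
  obtain i j where ij: "rep \<alpha> = (i, j)" "i \<in> tuples r" "j \<in> tuples r" "\<alpha> = pair_class n r i j"
    using assms(2) by (rule pair_orbits_rep)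
  obtain k l where kl: "rep \<beta> = (k, l)" "k \<in> tuples r" "l \<in> tuples r" "\<beta> = pair_class n r k l"
    using assms(3) by (rule pair_orbits_rep)
  define Z where "Z \<gamma> = (case rep \<gamma> of (p, q) \<Rightarrow> schur_Z n r i j k l p q)" for \<gamma>
  define \<gamma> where "\<gamma> = pair_class n r p q"
  have \<gamma>: "\<gamma> \<in> pair_orbits n r" using assms by (simp add: \<gamma>_def pair_class_in_orbits)
  have fin: "finite {\<gamma> \<in> pair_orbits n r. Z \<gamma> \<noteq> 0}"
    unfolding Z_def using assms(1) ij kl by (intro finite_schur_Z)
  have "lookup (basis_mult n r \<alpha> \<beta> :: 'k schur) \<gamma> =
      lookup (\<Sum>\<gamma>\<in>{\<gamma> \<in> pair_orbits n r. Z \<gamma> \<noteq> 0}. single \<gamma> (of_nat (Z \<gamma>)) :: 'k schur) \<gamma>"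
    by (simp only: basis_mult_def Let_def ij(1) kl(1) prod.case Z_def[symmetric])
  also have "\<dots> = of_nat (Z \<gamma>)"
    using \<gamma> fin by (auto simp: lookup_sum lookup_single when_def sum.delta)
  also have "Z \<gamma> = card {s \<in> tuples r. (p, s) \<in> \<alpha> \<and> (s, q) \<in> \<beta>}"
  proof -
    obtain p' q' where pq: "rep \<gamma> = (p', q')" "p' \<in> tuples r" "q' \<in> tuples r" "\<gamma> = pair_class n r p' q'"
      using \<gamma> by (rule pair_orbits_rep)
    hence "aff_sim n r (p, q) (p', q')" using assms by (simp add: \<gamma>_def pair_class_eq_iff)
    hence "schur_Z n r i j k l p q = schur_Z n r i j k l p' q'"
      using assms ij kl by (intro schur_Z_cong aff_sim_refl) auto
    hence "Z \<gamma> = schur_Z n r i j k l p q" unfolding Z_def pq(1) by simp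
    also have "\<dots> = card {s \<in> tuples r. (p, s) \<in> \<alpha> \<and> (s, q) \<in> \<beta>}"
      unfolding schur_Z_def ij kl mem_pair_class
      by (rule arg_cong[where f = card]) (use assms ij kl in \<open>blast intro: aff_sim_sym'\<close>)
    finally show ?thesis .
  qed
  finally show ?thesis by (simp add: \<gamma>_def)
qed

lemma lookup_schur_smult: "lookup (schur_smult c f) \<gamma> = c * lookup f \<gamma>"
  by (simp add: schur_smult_def map.rep_eq when_def)

lemma entry_add: "entry n r (f + g) p q = entry n r f p q + entry n r g p q"
  by (simp add: entry_def lookup_add)

lemma entry_sum: "entry n r (\<Sum>i\<in>I. f i) p q = (\<Sum>i\<in>I. entry n r (f i) p q)"
  by (simp add: entry_def lookup_sum)

lemma entry_smult: "entry n r (schur_smult c f) p q = c * entry n r f p q"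
  by (simp add: entry_def lookup_schur_smult)

text \<open>
  By the preceding lemma the structure constants are those of matrix multiplication. The finite index
  set \<open>A\<close> is left free so that different products can be summed over a common set.
\<close>

lemma entry_mult:
  assumes "n > 0" "f \<in> carrier (affine_schur n r)" "g \<in> carrier (affine_schur n r)"
    and "p \<in> tuples r" "q \<in> tuples r"
    and "finite A" "A \<subseteq> tuples r" "{s \<in> tuples r. entry n r f p s \<noteq> 0} \<subseteq> A"
  shows "entry n r (schur_mult n r f g) p q = (\<Sum>s\<in>A. entry n r f p s * entry n r g s q)"
proof -
  have orb: "\<gamma> \<in> pair_orbits n r" if "\<gamma> \<in> keys f \<or> \<gamma> \<in> keys g" for \<gamma>
    using that assms by (auto simp: carrier_affine_schur)
  have basis: "lookup (basis_mult n r \<alpha> \<beta> :: 'a schur) (pair_class n r p q) =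
      (\<Sum>s\<in>A. of_bool (\<alpha> = pair_class n r p s) * of_bool (\<beta> = pair_class n r s q))"
    if ab: "\<alpha> \<in> keys f" "\<beta> \<in> keys g" for \<alpha> \<beta>
  proof -
    have \<alpha>: "(p, s) \<in> \<alpha> \<longleftrightarrow> \<alpha> = pair_class n r p s" and \<beta>: "(s, q) \<in> \<beta> \<longleftrightarrow> \<beta> = pair_class n r s q"
      if "s \<in> tuples r" for s
      using that ab orb assms(4,5) mem_pair_orbit_iff by blast+
    have "s \<in> A" if "s \<in> tuples r" "(p, s) \<in> \<alpha>" for s
    proof -
      have "\<alpha> = pair_class n r p s" using that \<alpha> by blast
      hence "entry n r f p s \<noteq> 0" using ab by (simp add: entry_def in_keys_iff)
      thus ?thesis using assms(8) that by blast
    qed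
    hence "{s \<in> tuples r. (p, s) \<in> \<alpha> \<and> (s, q) \<in> \<beta>} =
        {s \<in> A. \<alpha> = pair_class n r p s \<and> \<beta> = pair_class n r s q}"
      using \<alpha> \<beta> assms(7) by blast
    moreover have "of_nat (card {s \<in> A. \<alpha> = pair_class n r p s \<and> \<beta> = pair_class n r s q}) =
        (\<Sum>s\<in>A. of_bool (\<alpha> = pair_class n r p s) * of_bool (\<beta> = pair_class n r s q) :: 'a)"
      using assms(6) by (simp add: of_bool_conj[symmetric] sum_of_bool_eq Int_def)
    ultimately show ?thesis using assms ab orb by (simp add: lookup_basis_mult)
  qed
  have "entry n r (schur_mult n r f g) p q =
      (\<Sum>\<alpha>\<in>keys f. \<Sum>\<beta>\<in>keys g. lookup f \<alpha> * lookup g \<beta> *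
        (\<Sum>s\<in>A. of_bool (\<alpha> = pair_class n r p s) * of_bool (\<beta> = pair_class n r s q)))"
    unfolding entry_def schur_mult_def lookup_sum lookup_schur_smult
    by (intro sum.cong refl) (simp add: basis)
  also have "\<dots> = (\<Sum>\<alpha>\<in>keys f. \<Sum>\<beta>\<in>keys g. \<Sum>s\<in>A.
      (lookup f \<alpha> * of_bool (\<alpha> = pair_class n r p s)) * (lookup g \<beta> * of_bool (\<beta> = pair_class n r s q)))"
    unfolding sum_distrib_left by (intro sum.cong refl) (simp only: mult_ac)
  also have "\<dots> = (\<Sum>s\<in>A. \<Sum>\<alpha>\<in>keys f. \<Sum>\<beta>\<in>keys g.
      (lookup f \<alpha> * of_bool (\<alpha> = pair_class n r p s)) * (lookup g \<beta> * of_bool (\<beta> = pair_class n r s q)))"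
    by (simp only: sum.swap[of _ "keys g" A] sum.swap[of _ "keys f" A])
  also have "\<dots> = (\<Sum>s\<in>A. entry n r f p s * entry n r g s q)"
    unfolding sum_product[symmetric] entry_def
    by (simp only: lookup_eq_extend[symmetric, unfolded coeff.extend_def])
  finally show ?thesis .
qed

lemma basis_mult_in_carrier: "basis_mult n r \<alpha> \<beta> \<in> carrier (affine_schur n r)"
  unfolding carrier_affine_schur basis_mult_def Let_def split_beta
  by (rule order_trans[OF Poly_Mapping.keys_sum]) auto

lemma keys_schur_smult: "keys (schur_smult c f) \<subseteq> keys f"
  by (auto simp: in_keys_iff lookup_schur_smult)

lemma schur_mult_closed: "schur_mult n r f g \<in> carrier (affine_schur n r)"
proof -
  have "keys (basis_mult n r \<alpha> \<beta> :: 'a schur) \<subseteq> pair_orbits n r" for \<alpha> \<beta>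
    using basis_mult_in_carrier by (simp flip: carrier_affine_schur)
  thus ?thesis unfolding carrier_affine_schur schur_mult_def
    using keys_schur_smult by (fastforce dest: subsetD[OF Poly_Mapping.keys_sum])
qed

text \<open>
  Reduction of all entries modulo \<open>n\<close> into \<open>{1..n}\<close> by a shift.
\<close>

lemma bounded_representative:
  assumes "n > 0" "p \<in> tuples r"
  obtains w where "w \<in> carrier (ext_affine_weyl r)" "aff_act n r w p \<in> bounded_tuples n r"
proof
  let ?w = "(id, \<lambda>k\<in>{1..r}. - ((p k - 1) div int n))"
  show "?w \<in> carrier (ext_affine_weyl r)"
    by (simp add: weyl_carrier_iff permutes_id tuples_def)
  have "p k - int n * ((p k - 1) div int n) = (p k - 1) mod int n + 1" for k
    using mult_div_mod_eq[of "int n" "p k - 1"] by linarith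
  moreover have "0 \<le> (p k - 1) mod int n" "(p k - 1) mod int n < int n" for k
    using assms by auto
  ultimately show "aff_act n r ?w p \<in> bounded_tuples n r"
    by (auto simp: bounded_tuples_def PiE_iff extensional_def aff_act_apply) (smt (verit))
qed

text \<open>
  Inverse of \<^const>\<open>entry\<close> on invariant banded matrices. The support is finite because every orbit
  has a pair with first component in \<open>I(n,r)\<close>, and the band then leaves finitely many second
  components.
\<close>

definition of_matrix :: "nat \<Rightarrow> nat \<Rightarrow> (tuple \<Rightarrow> tuple \<Rightarrow> 'k::field) \<Rightarrow> 'k schur"
  where "of_matrix n r m =
    Abs_poly_mapping (\<lambda>\<gamma>. if \<gamma> \<in> pair_orbits n r then case rep \<gamma> of (p, q) \<Rightarrow> m p q else 0)"

lemma
  assumes "n > 0" "weyl_invariant n r m" "banded r B m"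
  shows of_matrix_in_carrier: "of_matrix n r m \<in> carrier (affine_schur n r)"
    and entry_of_matrix: "p \<in> tuples r \<Longrightarrow> q \<in> tuples r \<Longrightarrow> entry n r (of_matrix n r m) p q = m p q"
proof -
  let ?h = "\<lambda>\<gamma>. if \<gamma> \<in> pair_orbits n r then case rep \<gamma> of (p, q) \<Rightarrow> m p q else 0"
  let ?Box = "{1..r} \<rightarrow>\<^sub>E {1 - B..int n + B}"
  have "{\<gamma>. ?h \<gamma> \<noteq> 0} \<subseteq> (\<lambda>(p, q). pair_class n r p q) ` (bounded_tuples n r \<times> ?Box)"
  proof
    fix \<gamma> assume "\<gamma> \<in> {\<gamma>. ?h \<gamma> \<noteq> 0}"
    hence \<gamma>: "\<gamma> \<in> pair_orbits n r" and nz: "?h \<gamma> \<noteq> 0" by (auto split: if_splits)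
    obtain p q where pq: "rep \<gamma> = (p, q)" "p \<in> tuples r" "q \<in> tuples r" "\<gamma> = pair_class n r p q"
      using \<gamma> by (rule pair_orbits_rep)
    obtain w where w: "w \<in> carrier (ext_affine_weyl r)" "aff_act n r w p \<in> bounded_tuples n r"
      using assms(1) pq(2) by (rule bounded_representative)
    let ?p = "aff_act n r w p" and ?q = "aff_act n r w q"
    have "m ?p ?q \<noteq> 0" using nz \<gamma> pq w assms(2) by (simp add: weyl_invariant_def)
    hence "\<bar>?p j - ?q j\<bar> \<le> B" if "j \<in> {1..r}" for j
      using assms(3) that by (auto simp: banded_def aff_act_tuples)
    moreover have "?p j \<in> {1..int n}" if "j \<in> {1..r}" for j
      using w(2) that by (auto simp: bounded_tuples_def)
    ultimately have "?q j \<in> {1 - B..int n + B}" if "j \<in> {1..r}" for j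
      using that by (smt (verit) atLeastAtMost_iff)
    hence "?q \<in> ?Box" using aff_act_tuples[of n r w q] by (auto simp: tuples_def PiE_iff)
    moreover have "\<gamma> = pair_class n r ?p ?q"
      using pq w by (simp add: pair_class_eq_iff aff_act_tuples) (auto simp: aff_sim_iff)
    ultimately show "\<gamma> \<in> (\<lambda>(p, q). pair_class n r p q) ` (bounded_tuples n r \<times> ?Box)"
      using w(2) by auto
  qed
  moreover have "finite (bounded_tuples n r \<times> ?Box)"
    by (auto simp: bounded_tuples_def intro!: finite_cartesian_product finite_PiE)
  ultimately have "finite {\<gamma>. ?h \<gamma> \<noteq> 0}" using finite_surj by blast
  hence lk: "lookup (of_matrix n r m) \<gamma> = ?h \<gamma>" for \<gamma>
    unfolding of_matrix_def by (subst lookup_Abs_poly_mapping) auto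
  show "of_matrix n r m \<in> carrier (affine_schur n r)"
    by (auto simp: carrier_affine_schur in_keys_iff lk split: if_splits)
  assume p: "p \<in> tuples r" and q: "q \<in> tuples r"
  define \<gamma> where "\<gamma> = pair_class n r p q"
  have \<gamma>: "\<gamma> \<in> pair_orbits n r" using p q by (simp add: \<gamma>_def pair_class_in_orbits)
  then obtain u v where uv: "rep \<gamma> = (u, v)" "u \<in> tuples r" "v \<in> tuples r" "\<gamma> = pair_class n r u v"
    by (rule pair_orbits_rep)
  hence "aff_sim n r (u, v) (p, q)" using p q pair_class_eq_iff unfolding \<gamma>_def by metis
  hence "m p q = m u v" using assms(2) uv by (auto simp: aff_sim_iff weyl_invariant_def)
  thus "entry n r (of_matrix n r m) p q = m p q"
    using \<gamma> uv(1) by (simp add: entry_def lk flip: \<gamma>_def)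
qed

lemma schur_mult_assoc:
  assumes "n > 0" and f: "f \<in> carrier (affine_schur n r)" and g: "g \<in> carrier (affine_schur n r)"
    and h: "h \<in> carrier (affine_schur n r)"
  shows "schur_mult n r (schur_mult n r f g) h = schur_mult n r f (schur_mult n r g h)"
proof (rule affine_schur_eqI)
  fix p q assume p: "p \<in> tuples r" and q: "q \<in> tuples r"
  let ?row = "\<lambda>f p. {s \<in> tuples r. entry n r f p s \<noteq> 0}"
  note fin = finite_row[of _ n r]
  define A where "A = ?row f p"
  \<comment> \<open>One index set that is large enough for all inner products on both sides.\<close>
  define C where "C = ?row (schur_mult n r f g) p \<union> (\<Union>s\<in>A. ?row g s)"
  have A: "finite A" "A \<subseteq> tuples r" using fin[OF f p] by (auto simp: A_def)
  have C: "finite C" "C \<subseteq> tuples r"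
    using fin[OF schur_mult_closed p] fin[OF g] A
    by (auto simp: C_def subset_iff)
  have "entry n r (schur_mult n r (schur_mult n r f g) h) p q =
      (\<Sum>s\<in>C. entry n r (schur_mult n r f g) p s * entry n r h s q)"
    using assms p q C by (intro entry_mult schur_mult_closed) (auto simp: C_def)
  also have "\<dots> = (\<Sum>s\<in>C. (\<Sum>u\<in>A. entry n r f p u * entry n r g u s) * entry n r h s q)"
  proof (intro sum.cong refl)
    fix s assume "s \<in> C"
    hence "s \<in> tuples r" using C by auto
    hence "entry n r (schur_mult n r f g) p s = (\<Sum>u\<in>A. entry n r f p u * entry n r g u s)"
      using assms p A by (intro entry_mult) (auto simp: A_def)
    thus "entry n r (schur_mult n r f g) p s * entry n r h s q =
      (\<Sum>u\<in>A. entry n r f p u * entry n r g u s) * entry n r h s q" by simp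
  qed
  also have "\<dots> = (\<Sum>u\<in>A. entry n r f p u * (\<Sum>s\<in>C. entry n r g u s * entry n r h s q))"
    by (simp add: sum_distrib_left sum_distrib_right sum.swap[of _ A] mult.assoc)
  also have "\<dots> = (\<Sum>u\<in>A. entry n r f p u * entry n r (schur_mult n r g h) u q)"
  proof (intro sum.cong refl)
    fix u assume u: "u \<in> A"
    hence "u \<in> tuples r" using A by auto
    hence "entry n r (schur_mult n r g h) u q = (\<Sum>s\<in>C. entry n r g u s * entry n r h s q)"
      using assms q C u by (intro entry_mult) (auto simp: C_def)
    thus "entry n r f p u * (\<Sum>s\<in>C. entry n r g u s * entry n r h s q) =
      entry n r f p u * entry n r (schur_mult n r g h) u q" by simp
  qed
  also have "\<dots> = entry n r (schur_mult n r f (schur_mult n r g h)) p q"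
    using assms p q A by (intro entry_mult[symmetric] schur_mult_closed) (auto simp: A_def)
  finally show "entry n r (schur_mult n r (schur_mult n r f g) h) p q =
    entry n r (schur_mult n r f (schur_mult n r g h)) p q" .
qed (use assms in \<open>auto intro!: schur_mult_closed\<close>)

section \<open>Matrix units and the identity\<close>

abbreviation perm_orbits :: "nat \<Rightarrow> nat \<Rightarrow> tuple set set"
  where "perm_orbits n r \<equiv> orbits (sym_group r) (bounded_tuples n r) place_perm"

lemma bounded_tuples_permute:
  assumes "\<sigma> permutes {1..r}" "i \<in> bounded_tuples n r"
  shows "i \<circ> \<sigma> \<in> bounded_tuples n r"
proof -
  have "i \<circ> \<sigma> \<in> tuples r"
    using place_perm_tuples[OF assms(1), of i] assms(2) bounded_tuples_subset
    unfolding place_perm_def by blast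
  thus ?thesis using assms permutes_in_image[OF assms(1)]
    unfolding bounded_tuples_def tuples_def PiE_iff comp_def by metis
qed

lemma perm_orbits_rep:
  assumes "\<omega> \<in> perm_orbits n r"
  shows "rep \<omega> \<in> bounded_tuples n r" "\<omega> = {rep \<omega> \<circ> \<sigma> |\<sigma>. \<sigma> permutes {1..r}}"
proof -
  obtain i where i: "i \<in> bounded_tuples n r" "\<omega> = {i \<circ> \<sigma> |\<sigma>. \<sigma> permutes {1..r}}"
    using assms by (auto simp: orbits_def orbit_def place_perm_def sym_group_def)
  have "i \<circ> id \<in> \<omega>" unfolding i(2) using permutes_id by blast
  hence "rep \<omega> \<in> \<omega>" unfolding rep_def by (rule someI[of "\<lambda>x. x \<in> \<omega>"])
  then obtain \<tau> where t: "\<tau> permutes {1..r}" "rep \<omega> = i \<circ> \<tau>" using i(2) by auto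
  show "rep \<omega> \<in> bounded_tuples n r" unfolding t(2) using t(1) i(1) by (rule bounded_tuples_permute)
  have "i \<circ> \<sigma> = rep \<omega> \<circ> (inv_into UNIV \<tau> \<circ> \<sigma>)" for \<sigma>
    unfolding t(2) using permutes_inverses(1)[OF t(1)] by (simp add: fun_eq_iff)
  moreover have "inv_into UNIV \<tau> \<circ> \<sigma> permutes {1..r}" "\<tau> \<circ> \<sigma> permutes {1..r}" if "\<sigma> permutes {1..r}" for \<sigma>
    using that t(1) by (simp_all add: permutes_compose permutes_inv)
  moreover have "rep \<omega> \<circ> \<sigma> = i \<circ> (\<tau> \<circ> \<sigma>)" for \<sigma> unfolding t(2) by (simp add: comp_assoc)
  ultimately show "\<omega> = {rep \<omega> \<circ> \<sigma> |\<sigma>. \<sigma> permutes {1..r}}" unfolding i(2) by blast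
qed

lemma perm_orbits_rep_tuple: "\<omega> \<in> perm_orbits n r \<Longrightarrow> rep \<omega> \<in> tuples r"
  using perm_orbits_rep(1) bounded_tuples_subset by blast

lemma finite_perm_orbits: "finite (perm_orbits n r)"
proof -
  have "finite (bounded_tuples n r)" by (auto simp: bounded_tuples_def intro: finite_PiE)
  moreover have "perm_orbits n r = orbit (sym_group r) place_perm ` bounded_tuples n r"
    by (auto simp: orbits_def)
  ultimately show ?thesis by simp
qed

text \<open>
  Together with \<open>perm_orbits_disjoint\<close>: representatives of \<open>I(n,r)/\<Sigma>\<^sub>r\<close> also represent the orbits of
  the extended affine Weyl group on \<open>I(\<int>,r)\<close>.
\<close>

lemma perm_orbits_cover:
  assumes "n > 0" "p \<in> tuples r"
  obtains \<omega> w where "\<omega> \<in> perm_orbits n r" "w \<in> carrier (ext_affine_weyl r)" "p = aff_act n r w (rep \<omega>)"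
proof -
  obtain v where v: "v \<in> carrier (ext_affine_weyl r)" "aff_act n r v p \<in> bounded_tuples n r"
    using assms by (rule bounded_representative)
  define i where "i = aff_act n r v p"
  define \<omega> where "\<omega> = orbit (sym_group r) place_perm i"
  have \<omega>: "\<omega> \<in> perm_orbits n r" using v by (auto simp: \<omega>_def i_def orbits_def)
  have "i \<in> \<omega>" unfolding \<omega>_def orbit_def place_perm_def sym_group_def
    by (simp add: permutes_id exI[of _ id])
  then obtain \<sigma> where s: "\<sigma> permutes {1..r}" "i = rep \<omega> \<circ> \<sigma>"
    using perm_orbits_rep(2)[OF \<omega>] by blast
  let ?u = "(\<sigma>, \<lambda>k\<in>{1..r}. 0)"
  have u: "?u \<in> carrier (ext_affine_weyl r)" using s by (simp add: weyl_carrier_iff tuples_def)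
  have iu: "i = aff_act n r ?u (rep \<omega>)"
  proof (rule tuples_eqI[of _ r])
    show "i \<in> tuples r" by (simp add: i_def aff_act_tuples)
    show "i k = aff_act n r ?u (rep \<omega>) k" if "k \<in> {1..r}" for k
      using that by (simp add: s(2) aff_act_apply)
  qed (rule aff_act_tuples)
  let ?vi = "inv\<^bsub>ext_affine_weyl r\<^esub> v"
  have "p = aff_act n r ?vi (aff_act n r ?u (rep \<omega>))"
    using aff_act_inv(1)[OF v(1) assms(2), of n] iu by (simp add: i_def)
  hence "p = aff_act n r (?u \<otimes>\<^bsub>ext_affine_weyl r\<^esub> ?vi) (rep \<omega>)"
    using aff_act_mult[OF u weyl_inv_carrier[OF v(1)]] by simp
  moreover have "?u \<otimes>\<^bsub>ext_affine_weyl r\<^esub> ?vi \<in> carrier (ext_affine_weyl r)"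
    using u weyl_inv_carrier[OF v(1)] ext_affine_weyl_group group.is_monoid monoid.m_closed by metis
  ultimately show ?thesis using that \<omega> by blast
qed

text \<open>
  Entries in \<open>{1..n}\<close> differ by less than \<open>n\<close>, so a group element that maps one element of \<open>I(n,r)\<close> to
  another has trivial shift part. In particular the stabilizer of \<open>i\<close> is \<open>\<Sigma>\<^sub>i\<close>.
\<close>

lemma bounded_transport:
  assumes "n > 0" "i \<in> bounded_tuples n r" "(\<sigma>, \<delta>) \<in> carrier (ext_affine_weyl r)"
    and "aff_act n r (\<sigma>, \<delta>) i \<in> bounded_tuples n r"
  shows "aff_act n r (\<sigma>, \<delta>) i = i \<circ> \<sigma>" "\<delta> = (\<lambda>k\<in>{1..r}. 0)"
proof -
  have \<sigma>: "\<sigma> permutes {1..r}" and \<delta>: "\<delta> \<in> tuples r" using assms(3) by (auto simp: weyl_carrier_iff)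
  have 0: "\<delta> k = 0" if k: "k \<in> {1..r}" for k
  proof -
    have "aff_act n r (\<sigma>, \<delta>) i k \<in> {1..int n}" "i (\<sigma> k) \<in> {1..int n}"
      using assms(2,4) k permutes_in_image[OF \<sigma>, of k] unfolding bounded_tuples_def by blast+
    hence "i (\<sigma> k) + int n * \<delta> k \<in> {1..int n}" "i (\<sigma> k) \<in> {1..int n}"
      using k by (auto simp: aff_act_apply)
    hence lt: "\<bar>int n * \<delta> k\<bar> < int n" by auto
    show ?thesis
    proof (rule ccontr)
      assume "\<delta> k \<noteq> 0"
      hence "int n * 1 \<le> int n * \<bar>\<delta> k\<bar>" by (intro mult_left_mono) auto
      thus False using lt by (simp add: abs_mult)
    qed
  qed
  show "\<delta> = (\<lambda>k\<in>{1..r}. 0)" by (rule tuples_eqI[OF \<delta>]) (auto simp: tuples_def 0)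
  have "i \<circ> \<sigma> \<in> tuples r" using bounded_tuples_permute[OF \<sigma> assms(2)] bounded_tuples_subset by blast
  thus "aff_act n r (\<sigma>, \<delta>) i = i \<circ> \<sigma>"
    by (intro tuples_eqI[of _ r]) (auto simp: aff_act_tuples aff_act_apply 0)
qed

lemma perm_orbits_disjoint:
  assumes "n > 0" "\<omega> \<in> perm_orbits n r" "\<omega>' \<in> perm_orbits n r"
    and "w \<in> carrier (ext_affine_weyl r)" "rep \<omega>' = aff_act n r w (rep \<omega>)"
  shows "\<omega>' = \<omega>"
proof -
  obtain \<sigma> \<delta> where w: "w = (\<sigma>, \<delta>)" by (cases w)
  have \<sigma>: "\<sigma> permutes {1..r}" using assms(4) by (simp add: w weyl_carrier_iff)
  have eq: "rep \<omega>' = rep \<omega> \<circ> \<sigma>"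
    using bounded_transport(1)[OF assms(1) perm_orbits_rep(1)[OF assms(2)], of \<sigma> \<delta>]
      perm_orbits_rep(1)[OF assms(3)] assms(4,5) by (simp add: w)
  have "{rep \<omega>' \<circ> \<tau> |\<tau>. \<tau> permutes {1..r}} = {rep \<omega> \<circ> \<tau> |\<tau>. \<tau> permutes {1..r}}"
  proof safe
    fix \<tau> assume "\<tau> permutes {1..r}"
    thus "\<exists>\<rho>. rep \<omega>' \<circ> \<tau> = rep \<omega> \<circ> \<rho> \<and> \<rho> permutes {1..r}"
      using \<sigma> by (intro exI[of _ "\<sigma> \<circ> \<tau>"]) (simp add: eq comp_assoc permutes_compose)
    show "\<exists>\<rho>. rep \<omega> \<circ> \<tau> = rep \<omega>' \<circ> \<rho> \<and> \<rho> permutes {1..r}"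
      using \<open>\<tau> permutes _\<close> \<sigma> permutes_inverses(1)[OF \<sigma>]
      by (intro exI[of _ "inv_into UNIV \<sigma> \<circ> \<tau>"])
        (simp add: eq fun_eq_iff permutes_compose permutes_inv)
  qed
  thus ?thesis using perm_orbits_rep(2)[OF assms(2)] perm_orbits_rep(2)[OF assms(3)] by simp
qed

text \<open>
  The representatives meet every orbit, and invariance transports a row along an orbit.
\<close>

lemma weyl_invariant_eqI:
  assumes "n > 0" "weyl_invariant n r m" "weyl_invariant n r m'"
    and "\<And>\<omega> q. \<omega> \<in> perm_orbits n r \<Longrightarrow> q \<in> tuples r \<Longrightarrow> m (rep \<omega>) q = m' (rep \<omega>) q"
    and "p \<in> tuples r" "q \<in> tuples r"
  shows "m p q = m' p q"
proof -
  obtain \<omega> w where w: "\<omega> \<in> perm_orbits n r" "w \<in> carrier (ext_affine_weyl r)" "p = aff_act n r w (rep \<omega>)"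
    using assms(1,5) by (rule perm_orbits_cover)
  define q' where "q' = aff_act n r (inv\<^bsub>ext_affine_weyl r\<^esub> w) q"
  have q: "q = aff_act n r w q'" "q' \<in> tuples r"
    using aff_act_inv(2)[OF w(2) assms(6)] by (simp_all add: q'_def aff_act_tuples)
  have "m p q = m (rep \<omega>) q'" "m' p q = m' (rep \<omega>) q'"
    using assms(2,3) w(2) q(2) perm_orbits_rep_tuple[OF w(1)]
    unfolding weyl_invariant_def w(3) q(1) by blast+
  thus ?thesis using assms(4) w(1) q(2) by simp
qed

lemma entry_xi:
  assumes "i \<in> tuples r" "j \<in> tuples r" "p \<in> tuples r" "q \<in> tuples r"
  shows "entry n r (xi n r i j) p q = of_bool (aff_sim n r (i, j) (p, q))"
  using assms by (simp add: entry_def xi_def lookup_single when_def pair_class_eq_iff)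

lemma xi_in_carrier: "i \<in> tuples r \<Longrightarrow> j \<in> tuples r \<Longrightarrow> xi n r i j \<in> carrier (affine_schur n r)"
  by (simp add: carrier_affine_schur xi_def pair_class_in_orbits)

lemma sum_in_carrier:
  assumes "\<And>i. i \<in> I \<Longrightarrow> f i \<in> carrier (affine_schur n r)"
  shows "(\<Sum>i\<in>I. f i) \<in> carrier (affine_schur n r)"
  unfolding carrier_affine_schur
  by (rule order_trans[OF Poly_Mapping.keys_sum]) (use assms in \<open>auto simp: carrier_affine_schur\<close>)

text \<open>
  For a sum of elements \<open>f \<omega>'\<close>, each living in the rows of the orbit of \<open>rep \<omega>'\<close>, a single summand
  contributes to the row of \<open>rep \<omega>\<close>.
\<close>

lemma entry_perm_orbits_sum:
  assumes "n > 0" "\<omega> \<in> perm_orbits n r"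
    and "\<And>\<omega>' q. \<omega>' \<in> perm_orbits n r \<Longrightarrow> entry n r (f \<omega>') (rep \<omega>) q \<noteq> 0 \<Longrightarrow> q \<in> tuples r \<Longrightarrow>
      \<exists>w\<in>carrier (ext_affine_weyl r). rep \<omega> = aff_act n r w (rep \<omega>')"
    and "q \<in> tuples r"
  shows "entry n r (\<Sum>\<omega>\<in>perm_orbits n r. f \<omega>) (rep \<omega>) q = entry n r (f \<omega>) (rep \<omega>) q"
proof -
  have "entry n r (f \<omega>') (rep \<omega>) q = 0" if "\<omega>' \<in> perm_orbits n r - {\<omega>}" for \<omega>'
    using assms(3)[of \<omega>' q] that perm_orbits_disjoint[OF assms(1) _ assms(2)] assms(4) by blast
  hence "(\<Sum>\<omega>'\<in>perm_orbits n r. entry n r (f \<omega>') (rep \<omega>) q) = (\<Sum>\<omega>'\<in>{\<omega>}. entry n r (f \<omega>') (rep \<omega>) q)"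
    using assms(2) finite_perm_orbits by (intro sum.mono_neutral_right) auto
  thus ?thesis by (simp add: entry_sum)
qed

lemma one_affine_schur:
  "\<one>\<^bsub>affine_schur n r\<^esub> = (\<Sum>\<omega>\<in>perm_orbits n r. xi n r (rep \<omega>) (rep \<omega>))"
  by (simp add: affine_schur_def)

lemma one_in_carrier: "\<one>\<^bsub>affine_schur n r\<^esub> \<in> carrier (affine_schur n r)"
  unfolding one_affine_schur by (intro sum_in_carrier xi_in_carrier perm_orbits_rep_tuple)

lemma aff_act_eq_iff:
  assumes "w \<in> carrier (ext_affine_weyl r)" "p \<in> tuples r" "q \<in> tuples r"
  shows "aff_act n r w p = aff_act n r w q \<longleftrightarrow> p = q"
  using aff_act_inv(1)[OF assms(1)] assms(2,3) by metis

lemma entry_one: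
  assumes "n > 0" "p \<in> tuples r" "q \<in> tuples r"
  shows "entry n r \<one>\<^bsub>affine_schur n r\<^esub> p q = of_bool (p = q)"
proof (rule weyl_invariant_eqI[OF assms(1) weyl_invariant_entry _ _ assms(2,3), where m' = "\<lambda>p q. of_bool (p = q)"])
  show "weyl_invariant n r (\<lambda>p q. of_bool (p = q) :: 'a)"
    by (simp add: weyl_invariant_def aff_act_eq_iff)
  fix \<omega> q assume w: "\<omega> \<in> perm_orbits n r" and q: "q \<in> tuples r"
  note t = perm_orbits_rep_tuple
  have "entry n r (\<one>\<^bsub>affine_schur n r\<^esub>) (rep \<omega>) q = (entry n r (xi n r (rep \<omega>) (rep \<omega>)) (rep \<omega>) q :: 'a)"
    unfolding one_affine_schur
  proof (rule entry_perm_orbits_sum[OF assms(1) w _ q])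
    fix \<omega>' q assume "\<omega>' \<in> perm_orbits n r" "q \<in> tuples r"
      and "entry n r (xi n r (rep \<omega>') (rep \<omega>') :: 'a schur) (rep \<omega>) q \<noteq> 0"
    hence "aff_sim n r (rep \<omega>', rep \<omega>') (rep \<omega>, q)"
      using t t[OF w] by (simp add: entry_xi)
    thus "\<exists>w\<in>carrier (ext_affine_weyl r). rep \<omega> = aff_act n r w (rep \<omega>')"
      unfolding aff_sim_iff by blast
  qed
  also have "aff_sim n r (rep \<omega>, rep \<omega>) (rep \<omega>, q) \<longleftrightarrow> rep \<omega> = q"
    using aff_sim_refl[of "(rep \<omega>, rep \<omega>)" r n] t[OF w] by (auto simp: aff_sim_iff)
  hence "entry n r (xi n r (rep \<omega>) (rep \<omega>)) (rep \<omega>) q = (of_bool (rep \<omega> = q) :: 'a)"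
    using t[OF w] q by (simp only: entry_xi)
  finally show "entry n r (\<one>\<^bsub>affine_schur n r\<^esub>) (rep \<omega>) q = (of_bool (rep \<omega> = q) :: 'a)" .
qed

section \<open>The ring structure\<close>

lemma affine_schur_simps:
  "x \<otimes>\<^bsub>affine_schur n r\<^esub> y = schur_mult n r x y" "x \<oplus>\<^bsub>affine_schur n r\<^esub> y = x + y"
  "\<zero>\<^bsub>affine_schur n r\<^esub> = 0" "c \<odot>\<^bsub>affine_schur n r\<^esub> x = schur_smult c x"
  by (simp_all add: affine_schur_def)

lemma schur_add_closed:
  "f \<in> carrier (affine_schur n r) \<Longrightarrow> g \<in> carrier (affine_schur n r) \<Longrightarrow> f + g \<in> carrier (affine_schur n r)"
  using Poly_Mapping.keys_add[of f g] by (auto simp: carrier_affine_schur)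

lemma schur_zero_closed: "0 \<in> carrier (affine_schur n r)"
  by (simp add: carrier_affine_schur)

lemma schur_smult_closed:
  "f \<in> carrier (affine_schur n r) \<Longrightarrow> schur_smult c f \<in> carrier (affine_schur n r)"
  using keys_schur_smult[of c f] by (auto simp: carrier_affine_schur)

lemma schur_uminus_closed: "f \<in> carrier (affine_schur n r) \<Longrightarrow> - f \<in> carrier (affine_schur n r)"
  by (auto simp: carrier_affine_schur in_keys_iff)

lemma entry_mult_row:
  assumes "n > 0" "f \<in> carrier (affine_schur n r)" "g \<in> carrier (affine_schur n r)"
    and "p \<in> tuples r" "q \<in> tuples r"
  shows "entry n r (schur_mult n r f g) p q =
    (\<Sum>s\<in>{s \<in> tuples r. entry n r f p s \<noteq> 0}. entry n r f p s * entry n r g s q)"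
  using assms by (intro entry_mult finite_row) auto

lemma affine_schur_ring:
  assumes "n > 0"
  shows "ring (affine_schur n r :: ('k::field, 'k schur) module)"
proof (rule ringI)
  let ?S = "affine_schur n r :: ('k, 'k schur) module"
  note closed = schur_add_closed schur_zero_closed schur_mult_closed one_in_carrier
  show "abelian_group ?S"
  proof (rule abelian_groupI)
    fix x assume "x \<in> carrier ?S"
    thus "\<exists>y\<in>carrier ?S. y \<oplus>\<^bsub>?S\<^esub> x = \<zero>\<^bsub>?S\<^esub>"
      by (intro bexI[of _ "- x"]) (simp_all add: affine_schur_simps schur_uminus_closed)
  qed (auto simp: affine_schur_simps closed algebra_simps)
  show "monoid ?S"
  proof (rule monoidI)
    fix x assume x: "x \<in> carrier ?S"
    show "\<one>\<^bsub>?S\<^esub> \<otimes>\<^bsub>?S\<^esub> x = x"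
    proof (rule affine_schur_eqI)
      fix p q assume p: "p \<in> tuples r" and q: "q \<in> tuples r"
      have "entry n r (schur_mult n r \<one>\<^bsub>?S\<^esub> x) p q = (\<Sum>s\<in>{p}. entry n r \<one>\<^bsub>?S\<^esub> p s * entry n r x s q)"
        using assms p q x one_in_carrier by (intro entry_mult) (auto simp: entry_one)
      thus "entry n r (\<one>\<^bsub>?S\<^esub> \<otimes>\<^bsub>?S\<^esub> x) p q = entry n r x p q"
        using p assms by (simp add: affine_schur_simps entry_one)
    qed (use x in \<open>simp_all add: affine_schur_simps closed\<close>)
    show "x \<otimes>\<^bsub>?S\<^esub> \<one>\<^bsub>?S\<^esub> = x"
    proof (rule affine_schur_eqI)
      fix p q assume p: "p \<in> tuples r" and q: "q \<in> tuples r"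
      let ?A = "{s \<in> tuples r. entry n r x p s \<noteq> 0} \<union> {q}"
      have fin: "finite {s \<in> tuples r. entry n r x p s \<noteq> 0}" using x p by (rule finite_row)
      have "entry n r (schur_mult n r x \<one>\<^bsub>?S\<^esub>) p q = (\<Sum>s\<in>?A. entry n r x p s * entry n r \<one>\<^bsub>?S\<^esub> s q)"
        using assms p q x one_in_carrier fin by (intro entry_mult) auto
      also have "\<dots> = (\<Sum>s\<in>?A. entry n r x p s * of_bool (s = q))"
        using assms q by (intro sum.cong refl) (auto simp: entry_one)
      also have "\<dots> = entry n r x p q" using fin by simp
      finally show "entry n r (x \<otimes>\<^bsub>?S\<^esub> \<one>\<^bsub>?S\<^esub>) p q = entry n r x p q"
        by (simp add: affine_schur_simps)
    qed (use x in \<open>simp_all add: affine_schur_simps closed\<close>)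
  qed (auto simp: affine_schur_simps closed schur_mult_assoc[OF assms])
  fix x y z assume x: "x \<in> carrier ?S" and y: "y \<in> carrier ?S" and z: "z \<in> carrier ?S"
  show "(x \<oplus>\<^bsub>?S\<^esub> y) \<otimes>\<^bsub>?S\<^esub> z = x \<otimes>\<^bsub>?S\<^esub> z \<oplus>\<^bsub>?S\<^esub> y \<otimes>\<^bsub>?S\<^esub> z"
  proof (rule affine_schur_eqI)
    fix p q assume p: "p \<in> tuples r" and q: "q \<in> tuples r"
    let ?row = "\<lambda>x. {s \<in> tuples r. entry n r x p s \<noteq> 0}"
    define A where "A = ?row x \<union> ?row y \<union> ?row (x + y)"
    have A: "finite A" "A \<subseteq> tuples r"
      unfolding A_def using finite_row[OF _ p] x y closed(1)[OF x y] by auto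
    have "entry n r (schur_mult n r u z) p q = (\<Sum>s\<in>A. entry n r u p s * entry n r z s q)"
      if "u \<in> {x, y, x + y}" for u
      using that assms p q x y z A closed(1)[OF x y] by (intro entry_mult) (auto simp: A_def)
    thus "entry n r ((x \<oplus>\<^bsub>?S\<^esub> y) \<otimes>\<^bsub>?S\<^esub> z) p q = entry n r (x \<otimes>\<^bsub>?S\<^esub> z \<oplus>\<^bsub>?S\<^esub> y \<otimes>\<^bsub>?S\<^esub> z) p q"
      by (simp add: affine_schur_simps entry_add distrib_right sum.distrib)
  qed (use x y z in \<open>simp_all add: affine_schur_simps closed\<close>)
  show "z \<otimes>\<^bsub>?S\<^esub> (x \<oplus>\<^bsub>?S\<^esub> y) = z \<otimes>\<^bsub>?S\<^esub> x \<oplus>\<^bsub>?S\<^esub> z \<otimes>\<^bsub>?S\<^esub> y"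
  proof (rule affine_schur_eqI)
    fix p q assume p: "p \<in> tuples r" and q: "q \<in> tuples r"
    have "entry n r (schur_mult n r z u) p q =
        (\<Sum>s\<in>{s \<in> tuples r. entry n r z p s \<noteq> 0}. entry n r z p s * entry n r u s q)"
      if "u \<in> {x, y, x + y}" for u
      using that assms p q x y z closed(1)[OF x y] by (intro entry_mult_row) auto
    thus "entry n r (z \<otimes>\<^bsub>?S\<^esub> (x \<oplus>\<^bsub>?S\<^esub> y)) p q = entry n r (z \<otimes>\<^bsub>?S\<^esub> x \<oplus>\<^bsub>?S\<^esub> z \<otimes>\<^bsub>?S\<^esub> y) p q"
      by (simp add: affine_schur_simps entry_add distrib_left sum.distrib)
  qed (use x y z in \<open>simp_all add: affine_schur_simps closed\<close>)
qed

section \<open>Scalar matrices with symmetric entries\<close>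

text \<open>
  The vector space with basis \<open>I(\<int>,r)\<close> is a free module over the Laurent polynomials in \<open>r\<close> variables,
  with basis \<open>I(n,r)\<close>; this is the action of the monomial \<open>t\<^sup>a\<close>.
\<close>

definition translate :: "nat \<Rightarrow> nat \<Rightarrow> (nat \<Rightarrow>\<^sub>0 int) \<Rightarrow> tuple \<Rightarrow> tuple"
  where "translate n r a = shift n r (lookup a)"

lemma translate_apply:
  "translate n r a p k = (if k \<in> {1..r} then p k + int n * lookup a k else undefined)"
  by (simp add: translate_def shift_def)

lemma translate_tuples [simp]: "translate n r a p \<in> tuples r"
  by (simp add: translate_def shift_def tuples_def)

lemma translate_add: "translate n r b (translate n r a p) = translate n r (a + b) p"
  by (rule tuples_eqI[of _ r]) (simp_all add: translate_apply lookup_add algebra_simps)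

lemma translate_zero: "p \<in> tuples r \<Longrightarrow> translate n r 0 p = p"
  by (rule tuples_eqI[of _ r]) (simp_all add: translate_apply)

lemma translate_inj:
  assumes "n > 0" "a \<in> exps r" "b \<in> exps r" "translate n r a p = translate n r b p"
  shows "a = b"
proof (rule exps_eqI[OF assms(2,3)])
  fix k assume "k \<in> {1..r}"
  thus "lookup a k = lookup b k"
    using fun_cong[OF assms(4), of k] assms(1) by (simp add: translate_apply)
qed

lemma translate_uminus:
  assumes "p \<in> tuples r" "q \<in> tuples r"
  shows "q = translate n r a p \<longleftrightarrow> p = translate n r (- a) q"
  using assms translate_add[of n r "- a" a p] translate_add[of n r a "- a" q] translate_zero
  by (metis add.left_inverse add.right_inverse translate_add)

lemma translate_aff_act:
  "translate n r a p = aff_act n r (id, \<lambda>k\<in>{1..r}. lookup a k) p"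
  by (rule tuples_eqI[of _ r]) (simp_all add: aff_act_tuples translate_apply aff_act_apply)

lemma translate_weyl: "(id, \<lambda>k\<in>{1..r}. lookup a k) \<in> carrier (ext_affine_weyl r)"
  by (simp add: weyl_carrier_iff permutes_id tuples_def)

lemma aff_act_translate:
  assumes "(\<sigma>, \<delta>) \<in> carrier (ext_affine_weyl r)"
  shows "aff_act n r (\<sigma>, \<delta>) (translate n r a p) =
    translate n r (permute_exp \<sigma> a) (aff_act n r (\<sigma>, \<delta>) p)"
proof (rule tuples_eqI[of _ r])
  have \<sigma>: "\<sigma> permutes {1..r}" using assms by (simp add: weyl_carrier_iff)
  fix k assume k: "k \<in> {1..r}"
  hence "\<sigma> k \<in> {1..r}" using permutes_in_image[OF \<sigma>] by blast
  thus "aff_act n r (\<sigma>, \<delta>) (translate n r a p) k = translate n r (permute_exp \<sigma> a) (aff_act n r (\<sigma>, \<delta>) p) k"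
    using k by (simp add: aff_act_apply translate_apply lookup_permute_exp[OF \<sigma>])
qed (simp_all add: aff_act_tuples)

text \<open>
  The matrix of multiplication by \<open>F\<close>. It is invariant for symmetric \<open>F\<close>, since a
  group element carries translation by \<open>a\<close> into translation by the permuted \<open>a\<close>.
\<close>

definition scalar_matrix :: "nat \<Rightarrow> nat \<Rightarrow> 'k::field laurent \<Rightarrow> tuple \<Rightarrow> tuple \<Rightarrow> 'k"
  where "scalar_matrix n r F p q = coeff.extend (\<lambda>a. of_bool (q = translate n r a p)) F"

lemma scalar_matrix_translate:
  assumes "n > 0" "keys F \<subseteq> exps r" "a \<in> exps r"
  shows "scalar_matrix n r F p (translate n r a p) = lookup F a"
proof -
  have "translate n r a p = translate n r b p \<longleftrightarrow> b = a" if "b \<in> keys F" for b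
    using translate_inj[OF assms(1) assms(3), of b] assms(2) that by blast
  hence "scalar_matrix n r F p (translate n r a p) = (\<Sum>b\<in>keys F. lookup F b * of_bool (b = a))"
    unfolding scalar_matrix_def coeff.extend_def by (intro sum.cong refl) simp
  also have "\<dots> = lookup F a"
    by (rule lookup_eq_extend[symmetric, unfolded coeff.extend_def])
  finally show ?thesis .
qed

lemma scalar_matrix_nonzero:
  assumes "scalar_matrix n r F p q \<noteq> 0"
  obtains a where "a \<in> keys F" "q = translate n r a p"
proof -
  obtain a where "a \<in> keys F" "lookup F a * of_bool (q = translate n r a p) \<noteq> 0"
    using assms unfolding scalar_matrix_def coeff.extend_def by (meson sum.neutral)
  with that show ?thesis by (auto split: if_splits simp: of_bool_def)
qed

lemma scalar_matrix_invariant: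
  assumes "n > 0" "F \<in> Sym r"
  shows "weyl_invariant n r (scalar_matrix n r F)"
  unfolding weyl_invariant_def
proof (intro ballI)
  fix w p q assume w: "w \<in> carrier (ext_affine_weyl r)" and p: "p \<in> tuples r" and q: "q \<in> tuples r"
  obtain \<sigma> \<delta> where [simp]: "w = (\<sigma>, \<delta>)" by (cases w)
  have \<sigma>: "\<sigma> permutes {1..r}" using w by (simp add: weyl_carrier_iff)
  have F: "keys F \<subseteq> exps r" using assms(2) by (simp add: Sym_def)
  show "scalar_matrix n r F (aff_act n r w p) (aff_act n r w q) = scalar_matrix n r F p q"
  proof (cases "\<exists>a\<in>exps r. q = translate n r a p")
    case True
    then obtain a where a: "a \<in> exps r" "q = translate n r a p" by blast
    have "scalar_matrix n r F (aff_act n r w p) (aff_act n r w q) = lookup F (permute_exp \<sigma> a)"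
      using w a permute_exp_in_exps[OF \<sigma> a(1)] assms(1) F
      by (simp add: aff_act_translate scalar_matrix_translate)
    also have "\<dots> = lookup F a" using assms(2) \<sigma> by (simp add: Sym_def)
    also have "\<dots> = scalar_matrix n r F p q" using a assms(1) F by (simp add: scalar_matrix_translate)
    finally show ?thesis .
  next
    case False
    hence "scalar_matrix n r F p q = 0" using F by (metis scalar_matrix_nonzero subsetD)
    moreover have "scalar_matrix n r F (aff_act n r w p) (aff_act n r w q) = 0"
    proof (rule ccontr)
      assume "scalar_matrix n r F (aff_act n r w p) (aff_act n r w q) \<noteq> 0"
      then obtain a where a: "a \<in> keys F" "aff_act n r w q = translate n r a (aff_act n r w p)"
        by (rule scalar_matrix_nonzero)
      define b where "b = permute_exp (inv_into UNIV \<sigma>) a"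
      have "aff_act n r w (translate n r b p) = aff_act n r w q"
        using w a(2) by (simp add: aff_act_translate b_def permute_exp_inv[OF \<sigma>])
      hence "q = translate n r b p" using w q by (simp add: aff_act_eq_iff)
      moreover have "b \<in> exps r" using a F permute_exp_in_exps[OF permutes_inv[OF \<sigma>]] by (auto simp: b_def)
      ultimately show False using False by blast
    qed
    ultimately show ?thesis by simp
  qed
qed

lemma scalar_matrix_banded:
  "banded r (\<Sum>a\<in>keys F. \<Sum>j\<in>{1..r}. \<bar>int n * lookup a j\<bar>) (scalar_matrix n r F)"
  unfolding banded_def
proof (intro ballI impI)
  fix p q j assume "scalar_matrix n r F p q \<noteq> 0" and j: "j \<in> {1..r}"
  then obtain a where a: "a \<in> keys F" "q = translate n r a p" by (metis scalar_matrix_nonzero)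
  have "\<bar>p j - q j\<bar> = \<bar>int n * lookup a j\<bar>" using j a(2) by (simp add: translate_apply)
  also have "\<dots> \<le> (\<Sum>j\<in>{1..r}. \<bar>int n * lookup a j\<bar>)" using j by (intro member_le_sum) auto
  also have "\<dots> \<le> (\<Sum>a\<in>keys F. \<Sum>j\<in>{1..r}. \<bar>int n * lookup a j\<bar>)"
    using a(1) by (intro member_le_sum) (auto intro: sum_nonneg)
  finally show "\<bar>p j - q j\<bar> \<le> (\<Sum>a\<in>keys F. \<Sum>j\<in>{1..r}. \<bar>int n * lookup a j\<bar>)" .
qed

definition scalar_elt :: "nat \<Rightarrow> nat \<Rightarrow> 'k::field laurent \<Rightarrow> 'k schur"
  where "scalar_elt n r F = of_matrix n r (scalar_matrix n r F)"

lemma scalar_elt_in_carrier: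
  "n > 0 \<Longrightarrow> F \<in> Sym r \<Longrightarrow> scalar_elt n r F \<in> carrier (affine_schur n r)"
  unfolding scalar_elt_def
  by (rule of_matrix_in_carrier[OF _ scalar_matrix_invariant scalar_matrix_banded])

lemma entry_scalar_elt:
  "n > 0 \<Longrightarrow> F \<in> Sym r \<Longrightarrow> p \<in> tuples r \<Longrightarrow> q \<in> tuples r \<Longrightarrow>
    entry n r (scalar_elt n r F) p q = scalar_matrix n r F p q"
  unfolding scalar_elt_def
  by (rule entry_of_matrix[OF _ scalar_matrix_invariant scalar_matrix_banded])

text \<open>
  Multiplying by the element of \<open>F\<close> takes weighted sums of entries over translations of the row index (from the
  left) or inverse translations of the column index (from the right). By invariance
  of \<open>g\<close> under translations these agree, which is why these elements are central.
\<close>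

lemma entry_scalar_elt_mult:
  assumes "n > 0" "F \<in> Sym r" "g \<in> carrier (affine_schur n r)" "p \<in> tuples r" "q \<in> tuples r"
  shows "entry n r (schur_mult n r (scalar_elt n r F) g) p q =
    coeff.extend (\<lambda>a. entry n r g (translate n r a p) q) F"
proof -
  have F: "keys F \<subseteq> exps r" using assms(2) by (simp add: Sym_def)
  let ?A = "(\<lambda>a. translate n r a p) ` keys F"
  have "entry n r (schur_mult n r (scalar_elt n r F) g) p q =
      (\<Sum>s\<in>?A. entry n r (scalar_elt n r F) p s * entry n r g s q)"
  proof (rule entry_mult[OF assms(1) scalar_elt_in_carrier[OF assms(1,2)] assms(3-5)])
    show "{s \<in> tuples r. entry n r (scalar_elt n r F) p s \<noteq> 0} \<subseteq> ?A"
      using assms by (auto simp: entry_scalar_elt elim!: scalar_matrix_nonzero)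
  qed auto
  also have "\<dots> = (\<Sum>a\<in>keys F. entry n r (scalar_elt n r F) p (translate n r a p) *
      entry n r g (translate n r a p) q)"
  proof (subst sum.reindex)
    show "inj_on (\<lambda>a. translate n r a p) (keys F)"
      using F translate_inj[OF assms(1)] by (intro inj_onI) blast
  qed simp
  also have "\<dots> = coeff.extend (\<lambda>a. entry n r g (translate n r a p) q) F"
    unfolding coeff.extend_def using assms F
    by (intro sum.cong refl) (simp add: entry_scalar_elt scalar_matrix_translate subset_iff)
  finally show ?thesis .
qed

lemma entry_mult_scalar_elt:
  assumes "n > 0" "F \<in> Sym r" "g \<in> carrier (affine_schur n r)" "p \<in> tuples r" "q \<in> tuples r"
  shows "entry n r (schur_mult n r g (scalar_elt n r F)) p q =
    coeff.extend (\<lambda>a. entry n r g p (translate n r (- a) q)) F"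
proof -
  have F: "keys F \<subseteq> exps r" using assms(2) by (simp add: Sym_def)
  let ?B = "(\<lambda>a. translate n r (- a) q) ` keys F"
  let ?A = "{s \<in> tuples r. entry n r g p s \<noteq> 0} \<union> ?B"
  have eq: "q = translate n r a s \<longleftrightarrow> s = translate n r (- a) q" if "s \<in> tuples r" for a s
    using translate_uminus[OF that assms(5)] .
  have fin: "finite ?A" using finite_row[OF assms(3,4)] by simp
  have "entry n r (schur_mult n r g (scalar_elt n r F)) p q =
      (\<Sum>s\<in>?A. entry n r g p s * entry n r (scalar_elt n r F) s q)"
    by (rule entry_mult[OF assms(1,3) scalar_elt_in_carrier[OF assms(1,2)] assms(4,5) fin]) auto
  also have "\<dots> = (\<Sum>s\<in>?B. entry n r g p s * entry n r (scalar_elt n r F) s q)"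
  proof (rule sum.mono_neutral_right[OF fin])
    show "\<forall>s\<in>?A - ?B. entry n r g p s * entry n r (scalar_elt n r F) s q = 0"
    proof
      fix s assume s: "s \<in> ?A - ?B"
      hence "s \<in> tuples r" by auto
      moreover have "scalar_matrix n r F s q = 0"
      proof (rule ccontr)
        assume "scalar_matrix n r F s q \<noteq> 0"
        then obtain a where "a \<in> keys F" "q = translate n r a s" by (rule scalar_matrix_nonzero)
        thus False using s eq \<open>s \<in> tuples r\<close> by blast
      qed
      ultimately show "entry n r g p s * entry n r (scalar_elt n r F) s q = 0"
        using assms by (simp add: entry_scalar_elt)
    qed
  qed simp
  also have "\<dots> = (\<Sum>a\<in>keys F. entry n r g p (translate n r (- a) q) *
      entry n r (scalar_elt n r F) (translate n r (- a) q) q)"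
  proof (subst sum.reindex)
    have "- a \<in> exps r" if "a \<in> keys F" for a using F that by (auto simp: exps_def)
    thus "inj_on (\<lambda>a. translate n r (- a) q) (keys F)"
      using translate_inj[OF assms(1)] by (intro inj_onI) (metis add.inverse_inverse)
  qed simp
  also have "\<dots> = coeff.extend (\<lambda>a. entry n r g p (translate n r (- a) q)) F"
    unfolding coeff.extend_def
  proof (intro sum.cong refl)
    fix a assume a: "a \<in> keys F"
    have "scalar_matrix n r F (translate n r (- a) q) (translate n r a (translate n r (- a) q)) = lookup F a"
      using a F assms(1) by (intro scalar_matrix_translate) auto
    moreover have "translate n r a (translate n r (- a) q) = q"
      using assms(5) by (simp add: translate_add translate_zero)
    ultimately show "entry n r g p (translate n r (- a) q) *
        entry n r (scalar_elt n r F) (translate n r (- a) q) q =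
        lookup F a * entry n r g p (translate n r (- a) q)"
      using assms by (simp add: entry_scalar_elt)
  qed
  finally show ?thesis .
qed

lemma scalar_elt_central:
  assumes "n > 0" "F \<in> Sym r"
  shows "scalar_elt n r F \<in> alg_center (affine_schur n r)"
  unfolding alg_center_def
proof (intro CollectI conjI ballI)
  show "scalar_elt n r F \<in> carrier (affine_schur n r)" using assms by (rule scalar_elt_in_carrier)
  fix g :: "'a schur" assume g: "g \<in> carrier (affine_schur n r)"
  show "scalar_elt n r F \<otimes>\<^bsub>affine_schur n r\<^esub> g = g \<otimes>\<^bsub>affine_schur n r\<^esub> scalar_elt n r F"
    unfolding affine_schur_simps
  proof (rule affine_schur_eqI)
    fix p q assume p: "p \<in> tuples r" and q: "q \<in> tuples r"
    have "entry n r g (translate n r a p) q = entry n r g p (translate n r (- a) q)" for a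
    proof -
      have "entry n r g (translate n r a p) (translate n r a (translate n r (- a) q)) =
          entry n r g p (translate n r (- a) q)"
        using weyl_invariant_entry[of n r g] translate_weyl[of a r] p
        unfolding translate_aff_act[where a = a] weyl_invariant_def by simp
      thus ?thesis using q by (simp add: translate_add translate_zero)
    qed
    thus "entry n r (schur_mult n r (scalar_elt n r F) g) p q =
        entry n r (schur_mult n r g (scalar_elt n r F)) p q"
      using assms g p q by (simp add: entry_scalar_elt_mult entry_mult_scalar_elt)
  qed (use assms g in \<open>auto intro!: schur_mult_closed scalar_elt_in_carrier\<close>)
qed

lemma scalar_elt_add:
  assumes "n > 0" "F \<in> Sym r" "G \<in> Sym r"
  shows "scalar_elt n r (F + G) = scalar_elt n r F + scalar_elt n r G"
  by (rule affine_schur_eqI[of _ n r])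
    (use assms in \<open>auto intro!: schur_add_closed scalar_elt_in_carrier Sym_add
      simp: entry_add entry_scalar_elt Sym_add scalar_matrix_def coeff.extend_add\<close>)

lemma scalar_elt_mult:
  assumes "n > 0" "F \<in> Sym r" "G \<in> Sym r"
  shows "scalar_elt n r (F * G) = schur_mult n r (scalar_elt n r F) (scalar_elt n r G)"
proof (rule affine_schur_eqI[of _ n r])
  fix p q assume p: "p \<in> tuples r" and q: "q \<in> tuples r"
  have "entry n r (schur_mult n r (scalar_elt n r F) (scalar_elt n r G)) p q =
      coeff.extend (\<lambda>a. scalar_matrix n r G (translate n r a p) q) F"
    using assms p q scalar_elt_in_carrier[OF assms(1,3)]
    by (simp add: entry_scalar_elt_mult entry_scalar_elt)
  also have "\<dots> = scalar_matrix n r (F * G) p q"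
    by (simp add: scalar_matrix_def coeff.extend_mult)
      (simp add: coeff.extend_def translate_add sum_distrib_left mult.assoc)
  finally show "entry n r (scalar_elt n r (F * G)) p q =
      entry n r (schur_mult n r (scalar_elt n r F) (scalar_elt n r G)) p q"
    using assms p q by (simp add: entry_scalar_elt Sym_mult)
qed (use assms in \<open>auto intro!: schur_mult_closed scalar_elt_in_carrier Sym_mult\<close>)

lemma scalar_elt_one:
  assumes "n > 0"
  shows "scalar_elt n r 1 = \<one>\<^bsub>affine_schur n r\<^esub>"
proof (rule affine_schur_eqI[of _ n r])
  fix p q assume p: "p \<in> tuples r" and q: "q \<in> tuples r"
  have "scalar_matrix n r (single 0 1) p q = (of_bool (p = q) :: 'a)"
    using translate_zero[OF p] unfolding scalar_matrix_def by (subst coeff.extend_single) auto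
  thus "entry n r (scalar_elt n r 1) p q = (entry n r \<one>\<^bsub>affine_schur n r\<^esub> p q :: 'a)"
    using assms p q by (simp add: entry_scalar_elt Sym_one entry_one)
qed (use assms in \<open>auto intro: scalar_elt_in_carrier Sym_one one_in_carrier\<close>)

lemma scalar_elt_smult:
  assumes "n > 0" "F \<in> Sym r"
  shows "scalar_elt n r (single 0 c * F) = schur_smult c (scalar_elt n r F)"
proof (rule affine_schur_eqI[of _ n r])
  fix p q assume p: "p \<in> tuples r" and q: "q \<in> tuples r"
  have "scalar_matrix n r (single 0 c * F) p q = c * scalar_matrix n r F p q"
  proof (cases "c = 0")
    case False
    hence "keys (single 0 c * F) = keys F" by (auto simp: in_keys_iff lookup_scalar_mult)
    thus ?thesis
      by (simp only: scalar_matrix_def coeff.extend_def lookup_scalar_mult sum_distrib_left mult.assoc)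
  qed (simp add: scalar_matrix_def)
  thus "entry n r (scalar_elt n r (single 0 c * F)) p q =
      entry n r (schur_smult c (scalar_elt n r F)) p q"
    using assms p q by (simp add: entry_scalar_elt entry_smult Sym_mult Sym_scalar)
qed (use assms in \<open>auto intro!: schur_smult_closed scalar_elt_in_carrier Sym_mult Sym_scalar\<close>)

lemma scalar_elt_inj:
  assumes "n > 0" "F \<in> Sym r" "G \<in> Sym r" "scalar_elt n r F = scalar_elt n r G"
  shows "F = G"
proof (rule poly_mapping_eqI)
  fix a
  have FG: "keys F \<subseteq> exps r" "keys G \<subseteq> exps r" using assms by (auto simp: Sym_def)
  show "lookup F a = lookup G a"
  proof (cases "a \<in> exps r")
    case True
    define p where "p = translate n r 0 (\<lambda>_. 0)"
    have p: "p \<in> tuples r" by (simp add: p_def)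
    have "scalar_matrix n r F p (translate n r a p) = scalar_matrix n r G p (translate n r a p)"
      using assms p by (metis entry_scalar_elt translate_tuples)
    thus ?thesis using assms FG True by (simp add: scalar_matrix_translate)
  next
    case False
    hence "a \<notin> keys F" "a \<notin> keys G" using FG by auto
    thus ?thesis by (simp add: in_keys_iff)
  qed
qed

section \<open>The elements \<open>c\<^sub>\<epsilon>\<close>\<close>

lemma (in group) double_coset_eq:
  assumes "subgroup H G" "subgroup L G" "g \<in> carrier G" "x \<in> (H #> g) <#> L"
  shows "(H #> g) <#> L = (H #> x) <#> L"
proof -
  note cl = subgroup.mem_carrier[OF assms(1)] subgroup.mem_carrier[OF assms(2)] assms(3)
  obtain h k where hk: "h \<in> H" "k \<in> L" "x = h \<otimes> g \<otimes> k"
    using assms(4) by (auto simp: r_coset_def set_mult_def)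
  show ?thesis
  proof (intro equalityI subsetI)
    fix y assume "y \<in> (H #> g) <#> L"
    then obtain h' k' where y: "h' \<in> H" "k' \<in> L" "y = h' \<otimes> g \<otimes> k'"
      by (auto simp: r_coset_def set_mult_def)
    have "y = (h' \<otimes> inv h) \<otimes> x \<otimes> (inv k \<otimes> k')"
    proof -
      have "(h' \<otimes> inv h) \<otimes> x \<otimes> (inv k \<otimes> k') = h' \<otimes> (inv h \<otimes> h) \<otimes> g \<otimes> (k \<otimes> inv k) \<otimes> k'"
      proof -
        have "h' \<in> carrier G" "h \<in> carrier G" "k \<in> carrier G" "k' \<in> carrier G" using y hk cl by auto
        thus ?thesis unfolding hk(3) using cl(3) by (simp only: m_assoc m_closed inv_closed)
      qed
      also have "\<dots> = y" using y hk cl by simp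
      finally show ?thesis ..
    qed
    moreover have "h' \<otimes> inv h \<in> H" "inv k \<otimes> k' \<in> L"
      using y hk assms by (simp_all add: subgroup.m_closed subgroup.m_inv_closed)
    ultimately show "y \<in> (H #> x) <#> L" by (auto simp: r_coset_def set_mult_def)
  next
    fix y assume "y \<in> (H #> x) <#> L"
    then obtain h' k' where y: "h' \<in> H" "k' \<in> L" "y = h' \<otimes> x \<otimes> k'"
      by (auto simp: r_coset_def set_mult_def)
    have "y = (h' \<otimes> h) \<otimes> g \<otimes> (k \<otimes> k')" using y hk cl by (simp add: m_assoc)
    moreover have "h' \<otimes> h \<in> H" "k \<otimes> k' \<in> L" using y hk assms by (simp_all add: subgroup.m_closed)
    ultimately show "y \<in> (H #> g) <#> L" by (auto simp: r_coset_def set_mult_def)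
  qed
qed

lemma (in group) double_coset_self:
  assumes "subgroup H G" "subgroup L G" "x \<in> carrier G"
  shows "x \<in> (H #> x) <#> L"
proof -
  have "x = \<one> \<otimes> x \<otimes> \<one>" using assms(3) by simp
  thus ?thesis using subgroup.one_closed[OF assms(1)] subgroup.one_closed[OF assms(2)]
    by (auto simp: r_coset_def set_mult_def)
qed

lemma mem_stabilizer_perm:
  "h \<in> stabilizer (sym_group r) place_perm x \<longleftrightarrow> h permutes {1..r} \<and> x \<circ> h = x"
  by (auto simp: stabilizer_def sym_group_def place_perm_def)

lemma subgroup_stabilizer_perm: "subgroup (stabilizer (sym_group r) place_perm x) (sym_group r)"
proof (rule group.subgroupI[OF sym_group_is_group])
  show "stabilizer (sym_group r) place_perm x \<subseteq> carrier (sym_group r)" by (auto simp: stabilizer_def)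
  show "stabilizer (sym_group r) place_perm x \<noteq> {}"
    using permutes_id[of "{1..r}"] mem_stabilizer_perm[of id] by auto
next
  fix h assume "h \<in> stabilizer (sym_group r) place_perm x"
  hence h: "h permutes {1..r}" "x \<circ> h = x" by (simp_all only: mem_stabilizer_perm)
  have "x \<circ> inv_into UNIV h = (x \<circ> h) \<circ> inv_into UNIV h" by (simp only: h(2))
  also have "\<dots> = x" by (simp only: comp_assoc permutes_inv_o(1)[OF h(1)] comp_id)
  finally show "inv\<^bsub>sym_group r\<^esub> h \<in> stabilizer (sym_group r) place_perm x"
    using h(1) by (subst sym_group_inv_equality) (auto simp: sym_group_carrier mem_stabilizer_perm permutes_inv)
  fix k assume "k \<in> stabilizer (sym_group r) place_perm x"
  hence k: "k permutes {1..r}" "x \<circ> k = x" by (simp_all only: mem_stabilizer_perm)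
  have "x \<circ> (h \<circ> k) = x" by (simp only: comp_assoc[symmetric] h(2) k(2))
  thus "h \<otimes>\<^bsub>sym_group r\<^esub> k \<in> stabilizer (sym_group r) place_perm x"
    using h(1) k(1) by (simp only: mem_stabilizer_perm sym_group_mult) (simp add: permutes_compose)
qed

text \<open>
  Double cosets partition the group.
\<close>

lemma sum_double_cosets:
  assumes "\<sigma> permutes {1..r}" "subgroup H (sym_group r)" "subgroup L (sym_group r)"
  shows "(\<Sum>D\<in>double_cosets (sym_group r) H L. of_bool (\<sigma> \<in> D)) = (1 :: 'k::field)"
proof -
  interpret group "sym_group r" by (rule sym_group_is_group)
  let ?G = "sym_group r"
  let ?D0 = "(H #>\<^bsub>?G\<^esub> \<sigma>) <#>\<^bsub>?G\<^esub> L"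
  have s: "\<sigma> \<in> carrier ?G" using assms(1) by (simp add: sym_group_carrier)
  have D0: "?D0 \<in> double_cosets ?G H L" using s by (auto simp: double_cosets_def)
  have uniq: "\<sigma> \<in> D \<longleftrightarrow> D = ?D0" if "D \<in> double_cosets ?G H L" for D
  proof
    assume "\<sigma> \<in> D"
    with that obtain g where "g \<in> carrier ?G" "D = (H #>\<^bsub>?G\<^esub> g) <#>\<^bsub>?G\<^esub> L"
      by (auto simp: double_cosets_def)
    with \<open>\<sigma> \<in> D\<close> show "D = ?D0" using double_coset_eq[OF assms(2,3)] by blast
  qed (use double_coset_self[OF assms(2,3) s] in simp)
  have "double_cosets ?G H L \<subseteq> Pow (carrier ?G)"
  proof
    fix D assume "D \<in> double_cosets ?G H L"
    then obtain g where "g \<in> carrier ?G" "D = (H #>\<^bsub>?G\<^esub> g) <#>\<^bsub>?G\<^esub> L"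
      by (auto simp: double_cosets_def)
    thus "D \<in> Pow (carrier ?G)"
      using setmult_subset_G[OF r_coset_subset_G[OF subgroup.subset[OF assms(2)]] subgroup.subset[OF assms(3)]]
      by simp
  qed
  moreover have "finite (carrier ?G)" by (simp add: sym_group_def finite_permutations)
  ultimately have "finite (double_cosets ?G H L)" by (meson finite_Pow_iff finite_subset)
  moreover have "(\<Sum>D\<in>double_cosets ?G H L. of_bool (\<sigma> \<in> D)) =
      (\<Sum>D\<in>double_cosets ?G H L. of_bool (D = ?D0) :: 'k)"
    using uniq by (intro sum.cong) auto
  ultimately show ?thesis using D0 by simp
qed

lemma rep_double_coset:
  assumes "D \<in> double_cosets (sym_group r) H L"
    and "subgroup H (sym_group r)" "subgroup L (sym_group r)"
  shows "rep D permutes {1..r}" "D = {h \<circ> rep D \<circ> k |h k. h \<in> H \<and> k \<in> L}"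
proof -
  interpret group "sym_group r" by (rule sym_group_is_group)
  let ?G = "sym_group r"
  obtain g where g: "g \<in> carrier ?G" "D = (H #>\<^bsub>?G\<^esub> g) <#>\<^bsub>?G\<^esub> L"
    using assms(1) by (auto simp: double_cosets_def)
  have "g \<in> D" unfolding g(2) by (rule double_coset_self[OF assms(2,3) g(1)])
  hence rD: "rep D \<in> D" unfolding rep_def by (rule someI[of "\<lambda>x. x \<in> D"])
  have "D \<subseteq> carrier ?G" unfolding g(2)
    by (intro setmult_subset_G r_coset_subset_G subgroup.subset assms g)
  thus "rep D permutes {1..r}" using rD by (auto simp: sym_group_carrier)
  have "D = (H #>\<^bsub>?G\<^esub> rep D) <#>\<^bsub>?G\<^esub> L"
    using double_coset_eq[OF assms(2,3) g(1)] rD g(2) by metis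
  also have "\<dots> = {h \<circ> rep D \<circ> k |h k. h \<in> H \<and> k \<in> L}"
    by (auto simp: r_coset_def set_mult_def sym_group_mult)
  finally show "D = {h \<circ> rep D \<circ> k |h k. h \<in> H \<and> k \<in> L}" .
qed

lemma shift_tuples [simp]: "shift n r \<delta> i \<in> tuples r"
  by (simp add: shift_def tuples_def)

lemma shift_inj:
  assumes "n > 0" "\<delta> \<in> tuples r" "\<epsilon> \<in> tuples r" "shift n r \<delta> i = shift n r \<epsilon> i"
  shows "\<delta> = \<epsilon>"
proof (rule tuples_eqI[OF assms(2,3)])
  fix k assume "k \<in> {1..r}"
  thus "\<delta> k = \<epsilon> k" using fun_cong[OF assms(4), of k] assms(1) by (simp add: shift_def)
qed

text \<open>
  By \<open>bounded_transport\<close>, a group element that fixes \<open>i \<in> I(n,r)\<close> is a permutation in \<open>\<Sigma>\<^sub>i\<close>.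
\<close>

lemma bounded_pair_sim_iff:
  assumes "n > 0" "i \<in> bounded_tuples n r"
  shows "aff_sim n r (i, shift n r \<delta> i) (i, q) \<longleftrightarrow>
    (\<exists>k\<in>stabilizer (sym_group r) place_perm i. q = shift n r (\<delta> \<circ> k) i)"
proof
  assume "aff_sim n r (i, shift n r \<delta> i) (i, q)"
  then obtain \<sigma> \<eta> where w: "(\<sigma>, \<eta>) \<in> carrier (ext_affine_weyl r)"
    "i = aff_act n r (\<sigma>, \<eta>) i" "q = aff_act n r (\<sigma>, \<eta>) (shift n r \<delta> i)"
    by (auto simp: aff_sim_iff)
  have \<sigma>: "\<sigma> permutes {1..r}" using w(1) by (simp add: weyl_carrier_iff)
  note T = bounded_transport[OF assms w(1)]
  have i: "i \<circ> \<sigma> = i" and \<eta>: "\<eta> = (\<lambda>k\<in>{1..r}. 0)" using T w(2) assms(2) by simp_all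
  have "q = shift n r (\<delta> \<circ> \<sigma>) i"
  proof (rule tuples_eqI[of _ r])
    fix k assume k: "k \<in> {1..r}"
    hence "\<sigma> k \<in> {1..r}" using permutes_in_image[OF \<sigma>] by blast
    thus "q k = shift n r (\<delta> \<circ> \<sigma>) i k"
      using k fun_cong[OF i, of k] by (simp add: w(3) aff_act_apply \<eta> shift_def)
  qed (simp_all add: w(3) aff_act_tuples)
  thus "\<exists>k\<in>stabilizer (sym_group r) place_perm i. q = shift n r (\<delta> \<circ> k) i"
    using \<sigma> i by (auto simp: mem_stabilizer_perm)
next
  assume "\<exists>k\<in>stabilizer (sym_group r) place_perm i. q = shift n r (\<delta> \<circ> k) i"
  then obtain \<sigma> where \<sigma>: "\<sigma> permutes {1..r}" "i \<circ> \<sigma> = i" "q = shift n r (\<delta> \<circ> \<sigma>) i"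
    by (auto simp: mem_stabilizer_perm)
  let ?w = "(\<sigma>, \<lambda>k\<in>{1..r}. 0)"
  have "?w \<in> carrier (ext_affine_weyl r)" using \<sigma> by (simp add: weyl_carrier_iff tuples_def)
  moreover have "i = aff_act n r ?w i"
    using assms(2) bounded_tuples_subset fun_cong[OF \<sigma>(2)]
    by (intro tuples_eqI[of _ r]) (auto simp: aff_act_tuples aff_act_apply)
  moreover have "q = aff_act n r ?w (shift n r \<delta> i)"
  proof (rule tuples_eqI[of _ r])
    fix k assume k: "k \<in> {1..r}"
    hence "\<sigma> k \<in> {1..r}" using permutes_in_image[OF \<sigma>(1)] by blast
    thus "q k = aff_act n r ?w (shift n r \<delta> i) k"
      using k fun_cong[OF \<sigma>(2), of k] by (simp add: \<sigma>(3) aff_act_apply shift_def)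
  qed (simp_all add: \<sigma>(3) aff_act_tuples)
  ultimately show "aff_sim n r (i, shift n r \<delta> i) (i, q)" unfolding aff_sim_iff by blast
qed

lemma scalar_matrix_orbit_sum:
  assumes "n > 0"
  shows "scalar_matrix n r (orbit_sum r (vec r \<epsilon>)) p q =
    (of_bool (\<exists>\<sigma>. \<sigma> permutes {1..r} \<and> q = shift n r (\<epsilon> \<circ> \<sigma>) p) :: 'k::field)"
proof -
  let ?F = "orbit_sum r (vec r \<epsilon>) :: 'k laurent"
  have F: "keys ?F \<subseteq> exps r" using Sym_orbit_sum[of "vec r \<epsilon>" r] by (auto simp: Sym_def)
  have tr: "translate n r (permute_exp \<sigma> (vec r \<epsilon>)) p = shift n r (\<epsilon> \<circ> \<sigma>) p"
    if "\<sigma> permutes {1..r}" for \<sigma>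
    by (rule tuples_eqI[of _ r]) (simp_all add: permute_exp_vec[OF that] translate_apply, simp add: shift_def)
  show ?thesis
  proof (cases "\<exists>\<sigma>. \<sigma> permutes {1..r} \<and> q = shift n r (\<epsilon> \<circ> \<sigma>) p")
    case True
    then obtain \<sigma> where \<sigma>: "\<sigma> permutes {1..r}" "q = shift n r (\<epsilon> \<circ> \<sigma>) p" by blast
    let ?a = "permute_exp \<sigma> (vec r \<epsilon>)"
    have "scalar_matrix n r ?F p (translate n r ?a p) = lookup ?F ?a"
      by (rule scalar_matrix_translate[OF assms F permute_exp_in_exps[OF \<sigma>(1) vec_in_exps]])
    moreover have "lookup ?F ?a = of_bool True"
      unfolding lookup_orbit_sum by (rule arg_cong[where f = of_bool]) (use \<sigma>(1) in blast)
    ultimately show ?thesis using True by (simp add: tr[OF \<sigma>(1)] \<sigma>(2))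
  next
    case False
    have "scalar_matrix n r ?F p q = 0"
    proof (rule ccontr)
      assume "scalar_matrix n r ?F p q \<noteq> 0"
      then obtain a where "a \<in> keys ?F" "q = translate n r a p" by (rule scalar_matrix_nonzero)
      thus False using False tr by (auto simp: in_keys_iff lookup_orbit_sum)
    qed
    thus ?thesis using False by simp
  qed
qed

text \<open>
  Row \<open>i\<close> of \<open>c\<^sub>\<epsilon>\<close> has entry at \<open>i + n\<epsilon>\<sigma>\<close> the number of \<open>(\<Sigma>\<^sub>\<epsilon>, \<Sigma>\<^sub>i)\<close>-double cosets \<open>D\<close> with
  representative \<open>g\<close> such that \<open>\<epsilon>gk = \<epsilon>\<sigma>\<close> for some \<open>k \<in> \<Sigma>\<^sub>i\<close>. This condition
  means \<open>\<sigma> \<in> D\<close>, so the number is one: \<open>c\<^sub>\<epsilon>\<close> is multiplication by the sum of the monomials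
  in the orbit of \<open>t\<^sup>\<epsilon>\<close>.
\<close>

lemma c_elt_eq_scalar_elt:
  assumes "n > 0" "\<epsilon> \<in> tuples r"
  shows "c_elt n r \<epsilon> = (scalar_elt n r (orbit_sum r (vec r \<epsilon>)) :: 'k::field schur)"
proof -
  let ?H = "stabilizer (sym_group r) place_perm \<epsilon>"
  let ?L = "\<lambda>i. stabilizer (sym_group r) place_perm i"
  define \<D> where "\<D> \<omega> = double_cosets (sym_group r) ?H (?L (rep \<omega>))" for \<omega>
  define f :: "tuple set \<Rightarrow> 'k schur" where
    "f \<omega> = (\<Sum>D\<in>\<D> \<omega>. xi n r (rep \<omega>) (shift n r (place_perm (rep D) \<epsilon>) (rep \<omega>)))" for \<omega>
  have c: "c_elt n r \<epsilon> = (\<Sum>\<omega>\<in>perm_orbits n r. f \<omega>)"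
    by (simp add: c_elt_def f_def \<D>_def Let_def)
  let ?F = "orbit_sum r (vec r \<epsilon>) :: 'k laurent"
  have F: "?F \<in> Sym r" by (rule Sym_orbit_sum) simp
  have pp: "place_perm \<sigma> \<epsilon> = \<epsilon> \<circ> \<sigma>" for \<sigma> by (simp add: place_perm_def)
  have rep_perm: "rep D permutes {1..r}" if "D \<in> \<D> \<omega>" for D \<omega>
    using rep_double_coset(1)[OF that[unfolded \<D>_def] subgroup_stabilizer_perm subgroup_stabilizer_perm] .
  have ent_f: "entry n r (f \<omega>') (rep \<omega>) q = (\<Sum>D\<in>\<D> \<omega>'.
      of_bool (aff_sim n r (rep \<omega>', shift n r (place_perm (rep D) \<epsilon>) (rep \<omega>')) (rep \<omega>, q)))"
    if "\<omega> \<in> perm_orbits n r" "\<omega>' \<in> perm_orbits n r" "q \<in> tuples r" for \<omega> \<omega>' q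
    using that by (simp add: f_def entry_sum entry_xi perm_orbits_rep_tuple)
  have car: "c_elt n r \<epsilon> \<in> (carrier (affine_schur n r) :: 'k schur set)"
    unfolding c f_def by (intro sum_in_carrier xi_in_carrier perm_orbits_rep_tuple shift_tuples)
  have main: "entry n r (c_elt n r \<epsilon>) (rep \<omega>) q = scalar_matrix n r ?F (rep \<omega>) q"
    if \<omega>: "\<omega> \<in> perm_orbits n r" and q: "q \<in> tuples r" for \<omega> q
  proof -
    define i where "i = rep \<omega>"
    have i: "i \<in> bounded_tuples n r" using perm_orbits_rep(1)[OF \<omega>] by (simp add: i_def)
    have "entry n r (c_elt n r \<epsilon>) (rep \<omega>) q = entry n r (f \<omega>) (rep \<omega>) q"
      unfolding c
    proof (rule entry_perm_orbits_sum[OF assms(1) \<omega> _ q])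
      fix \<omega>' q assume "\<omega>' \<in> perm_orbits n r" "entry n r (f \<omega>') (rep \<omega>) q \<noteq> 0" "q \<in> tuples r"
      then obtain D where "aff_sim n r (rep \<omega>', shift n r (place_perm (rep D) \<epsilon>) (rep \<omega>')) (rep \<omega>, q)"
        unfolding ent_f[OF \<omega> \<open>\<omega>' \<in> _\<close> \<open>q \<in> _\<close>]
        by (auto elim!: sum.not_neutral_contains_not_neutral split: if_splits)
      thus "\<exists>w\<in>carrier (ext_affine_weyl r). rep \<omega> = aff_act n r w (rep \<omega>')"
        by (auto simp: aff_sim_iff)
    qed
    also have "\<dots> = (\<Sum>D\<in>\<D> \<omega>. of_bool (\<exists>k\<in>?L i. q = shift n r (\<epsilon> \<circ> rep D \<circ> k) i))"
      unfolding ent_f[OF \<omega> \<omega> q] by (simp only: pp i_def[symmetric] bounded_pair_sim_iff[OF assms(1) i])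
    also have "\<dots> = of_bool (\<exists>\<sigma>. \<sigma> permutes {1..r} \<and> q = shift n r (\<epsilon> \<circ> \<sigma>) i)"
    proof (cases "\<exists>\<sigma>. \<sigma> permutes {1..r} \<and> q = shift n r (\<epsilon> \<circ> \<sigma>) i")
      case False
      have "\<not> (\<exists>k\<in>?L i. q = shift n r (\<epsilon> \<circ> rep D \<circ> k) i)" if "D \<in> \<D> \<omega>" for D
      proof
        assume "\<exists>k\<in>?L i. q = shift n r (\<epsilon> \<circ> rep D \<circ> k) i"
        then obtain k where "k permutes {1..r}" "q = shift n r (\<epsilon> \<circ> (rep D \<circ> k)) i"
          by (auto simp: mem_stabilizer_perm comp_assoc)
        thus False using False permutes_compose rep_perm[OF that] by blast
      qed
      thus ?thesis using False by simp
    next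
      case True
      then obtain \<sigma> where \<sigma>: "\<sigma> permutes {1..r}" "q = shift n r (\<epsilon> \<circ> \<sigma>) i" by blast
      have "(\<exists>k\<in>?L i. q = shift n r (\<epsilon> \<circ> rep D \<circ> k) i) \<longleftrightarrow> \<sigma> \<in> D" if D: "D \<in> \<D> \<omega>" for D
      proof -
        let ?g = "rep D"
        have g: "?g permutes {1..r}" using rep_perm[OF D] .
        have Deq: "D = {h \<circ> ?g \<circ> k |h k. h \<in> ?H \<and> k \<in> ?L i}"
          using rep_double_coset(2)[OF D[unfolded \<D>_def] subgroup_stabilizer_perm subgroup_stabilizer_perm]
          by (simp only: i_def)
        have tup: "\<epsilon> \<circ> \<tau> \<in> tuples r" if "\<tau> permutes {1..r}" for \<tau>
          using place_perm_tuples[OF that assms(2)] by (simp add: place_perm_def)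
        show ?thesis
        proof
          assume "\<exists>k\<in>?L i. q = shift n r (\<epsilon> \<circ> ?g \<circ> k) i"
          then obtain k where k: "k \<in> ?L i" "k permutes {1..r}" "q = shift n r (\<epsilon> \<circ> (?g \<circ> k)) i"
            by (auto simp: mem_stabilizer_perm comp_assoc)
          have gk: "?g \<circ> k permutes {1..r}" using permutes_compose[OF k(2) g] .
          have eq: "\<epsilon> \<circ> \<sigma> = \<epsilon> \<circ> (?g \<circ> k)"
            by (rule shift_inj[OF assms(1) tup[OF \<sigma>(1)] tup[OF gk] trans[OF \<sigma>(2)[symmetric] k(3)]])
          \<comment> \<open>The element \<open>h = \<sigma>(gk)\<inverse>\<close> fixes \<open>\<epsilon>\<close> since \<open>\<epsilon>\<sigma> = \<epsilon>gk\<close>.\<close>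
          define h where "h = \<sigma> \<circ> inv_into UNIV (?g \<circ> k)"
          have "\<epsilon> \<circ> h = (\<epsilon> \<circ> (?g \<circ> k)) \<circ> inv_into UNIV (?g \<circ> k)"
            unfolding h_def comp_assoc[symmetric] eq[unfolded comp_assoc[symmetric]] ..
          also have "\<dots> = \<epsilon>" by (simp only: comp_assoc[of \<epsilon>] permutes_inv_o(1)[OF gk] comp_id)
          finally have "h \<in> ?H"
            using permutes_compose[OF permutes_inv[OF gk] \<sigma>(1)] by (simp add: mem_stabilizer_perm h_def)
          moreover have "\<sigma> = h \<circ> ?g \<circ> k"
            unfolding h_def comp_assoc permutes_inv_o(2)[OF gk] comp_id ..
          ultimately show "\<sigma> \<in> D" using k(1) by (subst Deq) blast
        next
          assume "\<sigma> \<in> D"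
          then obtain h k where hk: "h \<in> ?H" "k \<in> ?L i" "\<sigma> = h \<circ> ?g \<circ> k" using Deq by blast
          have "\<epsilon> \<circ> h = \<epsilon>" using hk(1) by (simp only: mem_stabilizer_perm)
          hence "\<epsilon> \<circ> \<sigma> = \<epsilon> \<circ> ?g \<circ> k" unfolding hk(3) comp_assoc[symmetric] by simp
          thus "\<exists>k\<in>?L i. q = shift n r (\<epsilon> \<circ> ?g \<circ> k) i" using \<sigma>(2) hk(2) by auto
        qed
      qed
      hence "(\<Sum>D\<in>\<D> \<omega>. of_bool (\<exists>k\<in>?L i. q = shift n r (\<epsilon> \<circ> rep D \<circ> k) i)) =
          (\<Sum>D\<in>\<D> \<omega>. of_bool (\<sigma> \<in> D) :: 'k)" by simp
      also have "\<dots> = 1"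
        unfolding \<D>_def by (rule sum_double_cosets[OF \<sigma>(1) subgroup_stabilizer_perm subgroup_stabilizer_perm])
      finally show ?thesis using True by simp
    qed
    also have "\<dots> = scalar_matrix n r ?F i q" by (simp only: scalar_matrix_orbit_sum[OF assms(1)])
    finally show ?thesis by (simp only: i_def)
  qed
  show ?thesis
  proof (rule affine_schur_eqI[OF car scalar_elt_in_carrier[OF assms(1) F]])
    fix p q assume p: "p \<in> tuples r" and q: "q \<in> tuples r"
    have "entry n r (c_elt n r \<epsilon>) p q = scalar_matrix n r ?F p q"
      by (rule weyl_invariant_eqI[OF assms(1) weyl_invariant_entry scalar_matrix_invariant[OF assms(1) F] main p q])
    thus "entry n r (c_elt n r \<epsilon>) p q = entry n r (scalar_elt n r ?F) p q"
      using assms(1) F p q by (simp only: entry_scalar_elt)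
  qed
qed

section \<open>Every central element is a scalar matrix\<close>

text \<open>
  For \<open>c \<noteq> 0\<close> this adds \<open>c\<close> to one entry of residue class \<open>a\<close>, summed over the places where it is
  possible. In tensor notation it is \<open>\<Sum>\<^sub>j 1 \<otimes> \<dots> \<otimes> x \<otimes> \<dots> \<otimes> 1\<close> with \<open>x\<close> a matrix unit times a
  power of \<open>t\<close>.
\<close>

definition shift_matrix :: "nat \<Rightarrow> nat \<Rightarrow> int \<Rightarrow> int \<Rightarrow> tuple \<Rightarrow> tuple \<Rightarrow> 'k::field"
  where "shift_matrix n r a c p q =
    of_bool (\<exists>j\<in>{1..r}. p j mod int n = a mod int n \<and> q = p(j := p j + c))"

lemma tuples_fun_upd: "p \<in> tuples r \<Longrightarrow> j \<in> {1..r} \<Longrightarrow> p(j := x) \<in> tuples r"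
  by (auto simp: tuples_def PiE_iff extensional_def)

lemma shift_matrix_invariant: "weyl_invariant n r (shift_matrix n r a c :: _ \<Rightarrow> _ \<Rightarrow> 'k::field)"
proof -
  define P where "P p q \<longleftrightarrow> (\<exists>j\<in>{1..r}. p j mod int n = a mod int n \<and> q = p(j := p j + c))" for p q :: tuple
  have step: "P (aff_act n r w p) (aff_act n r w q)" 
    if w: "w \<in> carrier (ext_affine_weyl r)" and p: "p \<in> tuples r" and P: "P p q" for w p q
  proof -
    obtain \<sigma> \<delta> where [simp]: "w = (\<sigma>, \<delta>)" by (cases w)
    have \<sigma>: "\<sigma> permutes {1..r}" using w by (simp add: weyl_carrier_iff)
    obtain j where j: "j \<in> {1..r}" "p j mod int n = a mod int n" "q = p(j := p j + c)"
      using P by (auto simp: P_def)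
    define k where "k = inv_into UNIV \<sigma> j"
    have k: "k \<in> {1..r}" "\<sigma> k = j"
      using j(1) permutes_in_image[OF permutes_inv[OF \<sigma>]] permutes_inverses(1)[OF \<sigma>] by (auto simp: k_def)
    have "aff_act n r w q = (aff_act n r w p)(k := aff_act n r w p k + c)"
    proof (rule tuples_eqI[of _ r])
      fix l assume "l \<in> {1..r}"
      moreover have "\<sigma> l = j \<longleftrightarrow> l = k" using k(2) permutes_inj[OF \<sigma>] by (auto dest: injD)
      ultimately show "aff_act n r w q l = ((aff_act n r w p)(k := aff_act n r w p k + c)) l"
        by (auto simp: j(3) aff_act_apply k)
    qed (use k in \<open>simp_all add: aff_act_tuples tuples_fun_upd\<close>)
    moreover have "aff_act n r w p k mod int n = a mod int n"
      using k j(2) by (simp add: aff_act_apply)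
    ultimately show ?thesis using k(1) by (auto simp: P_def)
  qed
  have "P (aff_act n r w p) (aff_act n r w q) \<longleftrightarrow> P p q"
    if "w \<in> carrier (ext_affine_weyl r)" "p \<in> tuples r" "q \<in> tuples r" for w p q
    using step[OF that(1,2)] step[OF weyl_inv_carrier[OF that(1)] aff_act_tuples, of n w p "aff_act n r w q"]
    by (auto simp: aff_act_inv(1)[OF that(1)] that(2,3))
  thus ?thesis by (simp add: weyl_invariant_def shift_matrix_def P_def)
qed

lemma shift_matrix_banded: "banded r \<bar>c\<bar> (shift_matrix n r a c :: _ \<Rightarrow> _ \<Rightarrow> 'k::field)"
  by (auto simp: banded_def shift_matrix_def)

lemma shift_matrix_upd:
  assumes "j \<in> {1..r}" "c \<noteq> 0"
  shows "shift_matrix n r a c p (p(j := p j + c)) = of_bool (p j mod int n = a mod int n)"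
proof -
  have "p(j := p j + c) = p(l := p l + c) \<longleftrightarrow> l = j" for l
    using assms(2) by (auto simp: fun_eq_iff)
  thus ?thesis using assms(1) by (auto simp: shift_matrix_def)
qed

text \<open>
  The key to the upper bound on the center. Compare the entries of \<open>Xz = zX\<close> at \<open>(p, q + ce\<^sub>j)\<close>, where
  \<open>X\<close> is a \<^const>\<open>shift_matrix\<close> whose step \<open>c\<close> exceeds twice the width of the band of \<open>z\<close>. A shift at any
  place other than \<open>j\<close> leaves the entries at \<open>j\<close> too far apart for \<open>z\<close>, so on either side only the
  shift at \<open>j\<close> survives. A large \<open>c\<close> thus isolates a single tensor factor.
\<close>

lemma central_shift_relation:
  fixes z :: "'k::field schur"
  assumes "n > 0" "z \<in> alg_center (affine_schur n r)" "banded r B (entry n r z)"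
    and "0 \<le> B" "2 * B < \<bar>c\<bar>" "p \<in> tuples r" "q \<in> tuples r" "j \<in> {1..r}" "\<bar>p j - q j\<bar> \<le> B"
  shows "of_bool (p j mod int n = a mod int n) * entry n r z (p(j := p j + c)) (q(j := q j + c)) =
    entry n r z p q * of_bool (q j mod int n = a mod int n)"
proof -
  define X where "X = (of_matrix n r (shift_matrix n r a c) :: 'k schur)"
  have X: "X \<in> carrier (affine_schur n r)"
    and eX: "\<And>u v. u \<in> tuples r \<Longrightarrow> v \<in> tuples r \<Longrightarrow> entry n r X u v = shift_matrix n r a c u v"
    unfolding X_def
    by (rule of_matrix_in_carrier[OF assms(1) shift_matrix_invariant shift_matrix_banded],
        rule entry_of_matrix[OF assms(1) shift_matrix_invariant shift_matrix_banded])
  have z: "z \<in> carrier (affine_schur n r)" and comm: "schur_mult n r z X = schur_mult n r X z"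
    using assms(2) X by (auto simp: alg_center_def affine_schur_simps)
  let ?p = "p(j := p j + c)" and ?q = "q(j := q j + c)"
  have c0: "c \<noteq> 0" using assms(4,5) by auto
  have pq: "?p \<in> tuples r" "?q \<in> tuples r" using assms by (simp_all add: tuples_fun_upd)
  have far: "entry n r z u v = 0" if "u \<in> tuples r" "v \<in> tuples r" "\<bar>u j - v j\<bar> > B" for u v
    using assms(3,8) that unfolding banded_def by (meson not_le)
  let ?row = "\<lambda>f. {s \<in> tuples r. entry n r f p s \<noteq> 0}"
  have "entry n r (schur_mult n r X z) p ?q = (\<Sum>s\<in>?row X \<union> {?p}. entry n r X p s * entry n r z s ?q)"
    using assms X z pq by (intro entry_mult) (auto intro: finite_row)
  also have "\<dots> = (\<Sum>s\<in>{?p}. entry n r X p s * entry n r z s ?q)"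
  proof (rule sum.mono_neutral_right)
    show "\<forall>s\<in>?row X \<union> {?p} - {?p}. entry n r X p s * entry n r z s ?q = 0"
    proof
      fix s assume s: "s \<in> ?row X \<union> {?p} - {?p}"
      hence st: "s \<in> tuples r" by auto
      from s obtain l where l: "s = p(l := p l + c)"
        using assms(6) eX[of p s] by (auto simp: shift_matrix_def split: if_splits)
      hence "l \<noteq> j" using s by auto
      hence "\<bar>s j - ?q j\<bar> > B" using l assms(5,9) by auto
      thus "entry n r X p s * entry n r z s ?q = 0" using far[OF st pq(2)] by simp
    qed
  qed (use assms X in \<open>auto intro: finite_row\<close>)
  also have "\<dots> = of_bool (p j mod int n = a mod int n) * entry n r z ?p ?q"
    using eX[OF assms(6) pq(1)] by (simp add: shift_matrix_upd[OF assms(8) c0] del: fun_upd_apply)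
  finally have 1: "entry n r (schur_mult n r X z) p ?q =
    of_bool (p j mod int n = a mod int n) * entry n r z ?p ?q" .
  have "entry n r (schur_mult n r z X) p ?q = (\<Sum>s\<in>?row z \<union> {q}. entry n r z p s * entry n r X s ?q)"
    using assms X z pq by (intro entry_mult) (auto intro: finite_row)
  also have "\<dots> = (\<Sum>s\<in>{q}. entry n r z p s * entry n r X s ?q)"
  proof (rule sum.mono_neutral_right)
    show "\<forall>s\<in>?row z \<union> {q} - {q}. entry n r z p s * entry n r X s ?q = 0"
    proof
      fix s assume s: "s \<in> ?row z \<union> {q} - {q}"
      hence st: "s \<in> tuples r" by auto
      show "entry n r z p s * entry n r X s ?q = 0"
      proof (rule ccontr)
        assume nz: "entry n r z p s * entry n r X s ?q \<noteq> 0"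
        then obtain l where l: "?q = s(l := s l + c)"
          using eX[OF st pq(2)] by (auto simp: shift_matrix_def split: if_splits)
        have "l \<noteq> j"
        proof
          assume "l = j"
          hence "s k = q k" for k using fun_cong[OF l, of k] by (cases "k = j") auto
          thus False using s by auto
        qed
        hence "s j = q j + c" using fun_cong[OF l, of j] by simp
        hence "\<bar>p j - s j\<bar> > B" using assms(5,9) by auto
        thus False using far[OF assms(6) st] nz by simp
      qed
    qed
  qed (use assms z in \<open>auto intro: finite_row\<close>)
  also have "\<dots> = entry n r z p q * of_bool (q j mod int n = a mod int n)"
    using eX[OF assms(7) pq(2)] by (simp add: shift_matrix_upd[OF assms(8) c0] del: fun_upd_apply)
  finally show ?thesis using 1 comm by simp
qed

text \<open>
  If \<open>p\<^sub>j\<close> and \<open>q\<^sub>j\<close> were incongruent, choosing the residue class of \<open>q\<^sub>j\<close> for \<open>a\<close> would kill the left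
  side of \<open>central_shift_relation\<close> but not the right.
\<close>

lemma central_congruent:
  fixes z :: "'k::field schur"
  assumes "n > 0" "z \<in> alg_center (affine_schur n r)" "banded r B (entry n r z)" "0 \<le> B"
    and "p \<in> tuples r" "q \<in> tuples r" "entry n r z p q \<noteq> 0" "j \<in> {1..r}"
  shows "p j mod int n = q j mod int n"
proof -
  have "\<bar>p j - q j\<bar> \<le> B" using assms by (auto simp: banded_def)
  moreover have "2 * B < \<bar>2 * B + 1\<bar>" by simp
  ultimately have "of_bool (p j mod int n = q j mod int n) *
      entry n r z (p(j := p j + (2 * B + 1))) (q(j := q j + (2 * B + 1))) = entry n r z p q"
    using central_shift_relation[OF assms(1-4) _ assms(5,6,8), of "2 * B + 1" "q j"] by simp
  thus ?thesis using assms(7) by (cases "p j mod int n = q j mod int n") simp_all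
qed

text \<open>
  Large steps \<open>c\<close> are covered by \<open>central_shift_relation\<close>, and an arbitrary step is a difference of
  two large ones.
\<close>

lemma central_shift_invariant:
  fixes z :: "'k::field schur"
  assumes "n > 0" "z \<in> alg_center (affine_schur n r)"
    and "p \<in> tuples r" "q \<in> tuples r" "j \<in> {1..r}"
  shows "entry n r z (p(j := p j + d)) (q(j := q j + d)) = entry n r z p q"
proof -
  have "z \<in> carrier (affine_schur n r)" using assms(2) by (simp add: alg_center_def)
  then obtain B where B: "banded r B (entry n r z)" "0 \<le> B" by (rule banded_entry)
  show ?thesis
  proof (cases "\<bar>p j - q j\<bar> \<le> B \<and> p j mod int n = q j mod int n")
    case True
    have shift: "entry n r z (u(j := u j + c)) (v(j := v j + c)) = entry n r z u v"
      if "2 * B < \<bar>c\<bar>" "u \<in> tuples r" "v \<in> tuples r" "\<bar>u j - v j\<bar> \<le> B" "u j mod int n = v j mod int n" for c u v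
      using central_shift_relation[OF assms(1,2) B that(1-3) assms(5) that(4), of "u j"] that(5) by simp
    \<comment> \<open>Both \<open>M\<close> and \<open>d + M\<close> exceed \<open>2 B\<close>.\<close>
    define M where "M = 2 * B + 1 + \<bar>d\<bar>"
    let ?p = "p(j := p j + d)" and ?q = "q(j := q j + d)"
    have "entry n r z (?p(j := ?p j + M)) (?q(j := ?q j + M)) = entry n r z ?p ?q"
      using True assms B by (intro shift) (auto simp: M_def tuples_fun_upd intro: mod_add_cong)
    moreover have "entry n r z (p(j := p j + (d + M))) (q(j := q j + (d + M))) = entry n r z p q"
      using True assms B by (intro shift) (auto simp: M_def)
    ultimately show ?thesis by (simp add: add.assoc)
  next
    case False
    have "(p j + d) mod int n = (q j + d) mod int n \<longleftrightarrow> p j mod int n = q j mod int n"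
      by (simp add: mod_eq_dvd_iff)
    hence F': "\<not> (\<bar>p j - q j\<bar> \<le> B \<and> (p j + d) mod int n = (q j + d) mod int n)" using False by simp
    have zero: "entry n r z u v = 0"
      if "u \<in> tuples r" "v \<in> tuples r" "\<not> (\<bar>u j - v j\<bar> \<le> B \<and> u j mod int n = v j mod int n)" for u v
      using central_congruent[OF assms(1,2) B that(1,2) _ assms(5)] B(1) that assms(5)
      unfolding banded_def by blast
    have "entry n r z p q = 0" using zero[OF assms(3,4)] False by blast
    moreover have "entry n r z (p(j := p j + d)) (q(j := q j + d)) = 0"
      using F' by (intro zero tuples_fun_upd assms) simp_all
    ultimately show ?thesis by simp
  qed
qed

text \<open>
  Moving the places to zero one after the other, an entry of a central element depends on the
  difference of its indices only.
\<close>

lemma central_translation_invariant: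
  fixes z :: "'k::field schur"
  assumes "n > 0" "z \<in> alg_center (affine_schur n r)" "p \<in> tuples r" "q \<in> tuples r"
  shows "entry n r z (\<lambda>k\<in>{1..r}. 0) (\<lambda>k\<in>{1..r}. q k - p k) = entry n r z p q"
proof -
  define u where "u J = (\<lambda>k\<in>{1..r}. if k \<in> J then 0 else p k)" for J
  define v where "v J = (\<lambda>k\<in>{1..r}. if k \<in> J then q k - p k else q k)" for J
  have t: "u J \<in> tuples r" "v J \<in> tuples r" for J by (auto simp: u_def v_def tuples_def)
  have "entry n r z (u J) (v J) = entry n r z p q" if "finite J" "J \<subseteq> {1..r}" for J
    using that
  proof (induction J rule: finite_induct)
    case empty
    have "u {} = p" "v {} = q" using assms t
      by (auto intro!: tuples_eqI[of _ r] simp: u_def v_def tuples_def)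
    thus ?case by simp
  next
    case (insert j J)
    have "u (insert j J) = (u J)(j := u J j + (- p j))" "v (insert j J) = (v J)(j := v J j + (- p j))"
      using insert by (auto simp: u_def v_def fun_eq_iff)
    thus ?case
      using central_shift_invariant[OF assms(1,2) t(1)[of J] t(2)[of J], of j "- p j"] insert
      by (simp del: fun_upd_apply)
  qed
  from this[of "{1..r}"] have "entry n r z (u {1..r}) (v {1..r}) = entry n r z p q" by simp
  moreover have "u {1..r} = (\<lambda>k\<in>{1..r}. 0)" "v {1..r} = (\<lambda>k\<in>{1..r}. q k - p k)"
    by (auto simp: u_def v_def fun_eq_iff)
  ultimately show ?thesis by simp
qed

text \<open>
  The row at zero provides the coefficients of \<open>F\<close>, which is symmetric because permutations fix zero.
\<close>

lemma central_is_scalar: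
  fixes z :: "'k::field schur"
  assumes "n > 0" "z \<in> alg_center (affine_schur n r)"
  obtains F where "F \<in> Sym r" "scalar_elt n r F = z"
proof -
  have z: "z \<in> carrier (affine_schur n r)" using assms(2) by (simp add: alg_center_def)
  then obtain B where B: "banded r B (entry n r z)" "0 \<le> B" by (rule banded_entry)
  define o0 :: tuple where "o0 = (\<lambda>k\<in>{1..r}. 0)"
  have o0: "o0 \<in> tuples r" by (simp add: o0_def tuples_def)
  define h where "h a = (if a \<in> exps r then entry n r z o0 (translate n r a o0) else 0)" for a
  define F where "F = Abs_poly_mapping h"
  have "finite {a. h a \<noteq> 0}"
  proof (rule inj_on_finite)
    show "inj_on (\<lambda>a. translate n r a o0) {a. h a \<noteq> 0}"
      using translate_inj[OF assms(1)] by (intro inj_onI) (auto simp: h_def split: if_splits)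
    show "(\<lambda>a. translate n r a o0) ` {a. h a \<noteq> 0} \<subseteq> {s \<in> tuples r. entry n r z o0 s \<noteq> 0}"
      by (auto simp: h_def split: if_splits)
    show "finite {s \<in> tuples r. entry n r z o0 s \<noteq> 0}" using z o0 by (rule finite_row)
  qed
  hence lk: "lookup F = h" unfolding F_def by (rule lookup_Abs_poly_mapping)
  have Fe: "keys F \<subseteq> exps r" by (auto simp: in_keys_iff lk h_def split: if_splits)
  have FS: "F \<in> Sym r"
    unfolding Sym_def
  proof (intro CollectI conjI allI impI Fe)
    fix \<sigma> a assume \<sigma>: "\<sigma> permutes {1..r}"
    have ex: "permute_exp \<sigma> a \<in> exps r \<longleftrightarrow> a \<in> exps r"
      using permute_exp_in_exps[OF \<sigma>, of a] permute_exp_inv(2)[OF \<sigma>, of a]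
        permute_exp_in_exps[OF permutes_inv[OF \<sigma>], of "permute_exp \<sigma> a"] by metis
    let ?w = "(\<sigma>, \<lambda>k\<in>{1..r}. 0)"
    have w: "?w \<in> carrier (ext_affine_weyl r)" using \<sigma> by (simp add: weyl_carrier_iff tuples_def)
    have w0: "aff_act n r ?w o0 = o0"
      using permutes_in_image[OF \<sigma>]
      by (intro tuples_eqI[OF aff_act_tuples o0]) (simp add: aff_act_apply o0_def del: atLeastAtMost_iff)
    have "entry n r z (aff_act n r ?w o0) (aff_act n r ?w (translate n r a o0)) =
        entry n r z o0 (translate n r a o0)"
      using weyl_invariant_entry w o0 translate_tuples unfolding weyl_invariant_def by blast
    hence "entry n r z o0 (translate n r (permute_exp \<sigma> a) o0) = entry n r z o0 (translate n r a o0)"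
      by (simp only: aff_act_translate[OF w] w0)
    thus "lookup F (permute_exp \<sigma> a) = lookup F a" by (simp only: lk h_def ex)
  qed
  have "scalar_elt n r F = z"
  proof (rule affine_schur_eqI[OF scalar_elt_in_carrier[OF assms(1) FS] z])
    fix p q assume p: "p \<in> tuples r" and q: "q \<in> tuples r"
    show "entry n r (scalar_elt n r F) p q = entry n r z p q"
    proof (cases "\<forall>j\<in>{1..r}. p j mod int n = q j mod int n")
      case True
      define a where "a = vec r (\<lambda>k. (q k - p k) div int n)"
      have dv: "int n * ((q k - p k) div int n) = q k - p k" if "k \<in> {1..r}" for k
      proof -
        have "q k mod int n = p k mod int n" using True that by simp
        hence "int n dvd q k - p k" by (simp add: mod_eq_dvd_iff)
        thus ?thesis by simp
      qed
      have qa: "q = translate n r a p"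
        by (rule tuples_eqI[OF q translate_tuples]) (use dv in \<open>auto simp: translate_apply a_def\<close>)
      have oa: "(\<lambda>k\<in>{1..r}. q k - p k) = translate n r a o0"
        by (rule tuples_eqI[OF _ translate_tuples])
          (use dv in \<open>auto simp: translate_apply a_def o0_def tuples_def\<close>)
      have "entry n r (scalar_elt n r F) p q = scalar_matrix n r F p q"
        using assms(1) FS p q by (rule entry_scalar_elt)
      also have "\<dots> = scalar_matrix n r F p (translate n r a p)"
        using qa by (rule arg_cong)
      also have "\<dots> = lookup F a"
        by (rule scalar_matrix_translate[OF assms(1) Fe]) (simp add: a_def)
      also have "\<dots> = entry n r z o0 (translate n r a o0)" by (simp add: lk h_def a_def)
      also have "\<dots> = entry n r z p q"
        using central_translation_invariant[OF assms p q] by (simp only: oa flip: o0_def)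
      finally show ?thesis .
    next
      case False
      hence "entry n r z p q = 0" using central_congruent[OF assms B p q] by blast
      moreover have "scalar_matrix n r F p q = 0"
      proof (rule ccontr)
        assume "scalar_matrix n r F p q \<noteq> 0"
        then obtain a where "q = translate n r a p" by (rule scalar_matrix_nonzero)
        thus False using False by (auto simp: translate_apply)
      qed
      ultimately show ?thesis using assms(1) FS p q by (simp add: entry_scalar_elt)
    qed
  qed
  with FS show ?thesis by (rule that)
qed

theorem center_affine_schur:
  assumes "n > 0"
  shows "alg_center (affine_schur n r :: ('k::field, 'k schur) module) = scalar_elt n r ` Sym r"
proof (intro equalityI subsetI)
  fix z :: "'k schur" assume "z \<in> alg_center (affine_schur n r)"
  then obtain F where "F \<in> Sym r" "scalar_elt n r F = z" using assms central_is_scalar by blast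
  thus "z \<in> scalar_elt n r ` Sym r" by blast
qed (use assms scalar_elt_central in blast)

section \<open>The center is a Laurent polynomial ring\<close>

text \<open>
  The isomorphism is wanted from the center to the Laurent algebra, but the natural homomorphism \<open>h\<close>
  goes the other way and has to be inverted.
\<close>

lemma alg_isomorphicI:
  assumes "bij_betw h (carrier A) (carrier B)"
    and "\<one>\<^bsub>A\<^esub> \<in> carrier A" "h \<one>\<^bsub>A\<^esub> = \<one>\<^bsub>B\<^esub>"
    and "\<And>x y. x \<in> carrier A \<Longrightarrow> y \<in> carrier A \<Longrightarrow> x \<otimes>\<^bsub>A\<^esub> y \<in> carrier A \<and> h (x \<otimes>\<^bsub>A\<^esub> y) = h x \<otimes>\<^bsub>B\<^esub> h y"
    and "\<And>x y. x \<in> carrier A \<Longrightarrow> y \<in> carrier A \<Longrightarrow> x \<oplus>\<^bsub>A\<^esub> y \<in> carrier A \<and> h (x \<oplus>\<^bsub>A\<^esub> y) = h x \<oplus>\<^bsub>B\<^esub> h y"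
    and "\<And>c x. x \<in> carrier A \<Longrightarrow> c \<odot>\<^bsub>A\<^esub> x \<in> carrier A \<and> h (c \<odot>\<^bsub>A\<^esub> x) = c \<odot>\<^bsub>B\<^esub> h x"
  shows "alg_isomorphic B A"
proof -
  define g where "g = inv_into (carrier A) h"
  have bij: "bij_betw g (carrier B) (carrier A)" unfolding g_def using assms(1) by (rule bij_betw_inv_into)
  have gh: "g (h x) = x" if "x \<in> carrier A" for x
    unfolding g_def using assms(1) that by (rule bij_betw_inv_into_left)
  have ex: "\<exists>x\<in>carrier A. y = h x" if "y \<in> carrier B" for y
    using assms(1) that by (auto simp: bij_betw_def)
  have "g \<in> ring_iso B A"
    unfolding ring_iso_def ring_hom_def
  proof (intro CollectI conjI allI impI bij)
    show "g \<in> carrier B \<rightarrow> carrier A" using bij by (auto simp: bij_betw_def)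
    show "g \<one>\<^bsub>B\<^esub> = \<one>\<^bsub>A\<^esub>" using assms(2,3) gh by metis
    fix u v assume "u \<in> carrier B \<and> v \<in> carrier B"
    then obtain x y where "x \<in> carrier A" "y \<in> carrier A" "u = h x" "v = h y" using ex by blast
    thus "g (u \<otimes>\<^bsub>B\<^esub> v) = g u \<otimes>\<^bsub>A\<^esub> g v" "g (u \<oplus>\<^bsub>B\<^esub> v) = g u \<oplus>\<^bsub>A\<^esub> g v"
      using assms(4,5) gh by metis+
  qed
  moreover have "g (c \<odot>\<^bsub>B\<^esub> u) = c \<odot>\<^bsub>A\<^esub> g u" if "u \<in> carrier B" for c u
    using ex[OF that] assms(6) gh by metis
  ultimately show ?thesis by (auto simp: alg_isomorphic_def alg_iso_def)
qed

lemma laurent_algebra_simps: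
  "f \<in> carrier (laurent_algebra r) \<longleftrightarrow> keys f \<subseteq> cone r"
  "f \<otimes>\<^bsub>laurent_algebra r\<^esub> g = f * g" "f \<oplus>\<^bsub>laurent_algebra r\<^esub> g = f + g"
  "\<one>\<^bsub>laurent_algebra r\<^esub> = 1" "c \<odot>\<^bsub>laurent_algebra r\<^esub> f = single 0 c * f"
  by (auto simp: laurent_algebra_def cone_def exps_def mult_map_scale_conv_mult)

lemma keys_scalar_mult:
  fixes f :: "'a::monoid_add \<Rightarrow>\<^sub>0 'k::comm_ring_1"
  shows "keys (single 0 c * f) \<subseteq> keys f"
  by (auto simp: in_keys_iff lookup_scalar_mult)

lemma scalar_elt_elem_hom_bij:
  assumes "n > 0" "r > 0"
  shows "bij_betw (\<lambda>f. scalar_elt n r (elem_hom r f)) (carrier (laurent_algebra r))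
    (alg_center (affine_schur n r :: ('k::field, 'k schur) module))"
  unfolding bij_betw_def
proof
  show "inj_on (\<lambda>f. scalar_elt n r (elem_hom r f) :: 'k schur) (carrier (laurent_algebra r))"
  proof (rule inj_onI)
    fix f g :: "'k laurent" assume fg: "f \<in> carrier (laurent_algebra r)" "g \<in> carrier (laurent_algebra r)"
      and "scalar_elt n r (elem_hom r f) = scalar_elt n r (elem_hom r g)"
    hence "elem_hom r f = elem_hom r g" using assms scalar_elt_inj Sym_elem_hom by blast
    moreover have "elem_hom r f = elem_hom r (f - g) + elem_hom r g"
      by (simp add: elem_hom_add[symmetric])
    ultimately have "elem_hom r (f - g) = 0" by simp
    moreover have "keys (f - g) \<subseteq> cone r"
    proof
      fix a assume "a \<in> keys (f - g)"
      hence "a \<in> keys f \<or> a \<in> keys g" by (auto simp: in_keys_iff lookup_minus)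
      thus "a \<in> cone r" using fg by (auto simp: laurent_algebra_simps)
    qed
    ultimately have "f - g = 0" using elem_hom_eq_zero by blast
    thus "f = g" by simp
  qed
  show "(\<lambda>f. scalar_elt n r (elem_hom r f)) ` carrier (laurent_algebra r) =
      alg_center (affine_schur n r :: ('k, 'k schur) module)"
    unfolding center_affine_schur[OF assms(1)]
  proof (intro equalityI subsetI)
    fix z :: "'k schur" assume "z \<in> scalar_elt n r ` Sym r"
    then obtain F where "F \<in> Sym r" "z = scalar_elt n r F" by blast
    moreover from this obtain G where "keys G \<subseteq> cone r" "elem_hom r G = F"
      using elem_hom_surj assms(2) by blast
    ultimately show "z \<in> (\<lambda>f. scalar_elt n r (elem_hom r f)) ` carrier (laurent_algebra r)"
      by (auto simp: laurent_algebra_simps)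
  qed (auto simp: Sym_elem_hom)
qed

lemma center_isomorphic_laurent:
  assumes "n > 0" "r > 0"
  defines "S \<equiv> (affine_schur n r :: ('k::field, 'k schur) module)"
  shows "alg_isomorphic (S\<lparr>carrier := alg_center S\<rparr>) (laurent_algebra r :: ('k, _) module)"
proof (rule alg_isomorphicI[where h = "\<lambda>f. scalar_elt n r (elem_hom r f)"])
  show "bij_betw (\<lambda>f. scalar_elt n r (elem_hom r f)) (carrier (laurent_algebra r))
      (carrier (S\<lparr>carrier := alg_center S\<rparr>))"
    using scalar_elt_elem_hom_bij[OF assms(1,2)] by (simp add: S_def)
  show "\<one>\<^bsub>laurent_algebra r\<^esub> \<in> carrier (laurent_algebra r :: ('k, _) module)"
    by (simp add: laurent_algebra_simps cone_zero)
  show "scalar_elt n r (elem_hom r \<one>\<^bsub>laurent_algebra r :: ('k, _) module\<^esub>) = \<one>\<^bsub>S\<lparr>carrier := alg_center S\<rparr>\<^esub>"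
    using assms(1) by (simp add: laurent_algebra_simps elem_hom_one scalar_elt_one S_def)
  fix f g :: "'k laurent" and c
  assume f: "f \<in> carrier (laurent_algebra r)"
  hence kf: "keys f \<subseteq> cone r" by (simp add: laurent_algebra_simps)
  have "keys (single 0 c * f) \<subseteq> cone r" using kf keys_scalar_mult[of c f] by blast
  moreover have "elem_hom r (single 0 c * f) = single 0 c * elem_hom r f"
  proof -
    have "keys (single 0 c :: 'k laurent) \<subseteq> cone r" by (auto simp: cone_zero)
    thus ?thesis using elem_hom_mult[OF _ kf] by (simp add: elem_hom_scalar)
  qed
  ultimately show "c \<odot>\<^bsub>laurent_algebra r\<^esub> f \<in> carrier (laurent_algebra r) \<and>
      scalar_elt n r (elem_hom r (c \<odot>\<^bsub>laurent_algebra r\<^esub> f)) =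
      c \<odot>\<^bsub>S\<lparr>carrier := alg_center S\<rparr>\<^esub> scalar_elt n r (elem_hom r f)"
    using assms(1) Sym_elem_hom[of r f]
    by (simp add: laurent_algebra_simps scalar_elt_smult S_def affine_schur_simps)
  assume "g \<in> carrier (laurent_algebra r)"
  hence kg: "keys g \<subseteq> cone r" by (simp add: laurent_algebra_simps)
  have "keys (f * g) \<subseteq> cone r"
    using keys_mult[of f g] kf kg cone_add by blast
  thus "f \<otimes>\<^bsub>laurent_algebra r\<^esub> g \<in> carrier (laurent_algebra r) \<and>
      scalar_elt n r (elem_hom r (f \<otimes>\<^bsub>laurent_algebra r\<^esub> g)) =
      scalar_elt n r (elem_hom r f) \<otimes>\<^bsub>S\<lparr>carrier := alg_center S\<rparr>\<^esub> scalar_elt n r (elem_hom r g)"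
    using assms(1) kf kg Sym_elem_hom[of r f] Sym_elem_hom[of r g]
    by (simp add: laurent_algebra_simps elem_hom_mult scalar_elt_mult S_def affine_schur_simps)
  have "keys (f + g) \<subseteq> cone r" using Poly_Mapping.keys_add[of f g] kf kg by blast
  thus "f \<oplus>\<^bsub>laurent_algebra r\<^esub> g \<in> carrier (laurent_algebra r) \<and>
      scalar_elt n r (elem_hom r (f \<oplus>\<^bsub>laurent_algebra r\<^esub> g)) =
      scalar_elt n r (elem_hom r f) \<oplus>\<^bsub>S\<lparr>carrier := alg_center S\<rparr>\<^esub> scalar_elt n r (elem_hom r g)"
    using assms(1) Sym_elem_hom[of r f] Sym_elem_hom[of r g]
    by (simp add: laurent_algebra_simps elem_hom_add scalar_elt_add S_def affine_schur_simps)
qed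

section \<open>Generators\<close>

lemma scalar_elt_zero:
  assumes "n > 0"
  shows "scalar_elt n r 0 = 0"
  using scalar_elt_add[OF assms Sym_zero Sym_zero] by simp

lemma orbit_sum_const:
  assumes "\<And>k. k \<in> {1..r} \<Longrightarrow> f k = m"
  shows "orbit_sum r (vec r f) = single (vec r (\<lambda>_. m)) 1"
proof -
  have v: "vec r f = vec r (\<lambda>_. m)" by (rule poly_mapping_eqI) (simp add: assms)
  have "permute_exp \<sigma> (vec r (\<lambda>_. m)) = vec r (\<lambda>_. m)" if "\<sigma> permutes {1..r}" for \<sigma>
    by (simp add: permute_exp_vec[OF that] comp_def)
  hence "(\<lambda>\<sigma>. permute_exp \<sigma> (vec r (\<lambda>_. m))) ` {\<sigma>. \<sigma> permutes {1..r}} = {vec r (\<lambda>_. m)}"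
    using permutes_id[of "{1..r}"] by (intro equalityI) (auto intro: image_eqI[of _ _ id] dest: sym)
  hence "{permute_exp \<sigma> (vec r f) |\<sigma>. \<sigma> permutes {1..r}} = {vec r (\<lambda>_. m)}"
    unfolding v by (simp only: setcompr_eq_image)
  thus ?thesis by (simp add: orbit_sum_def)
qed

text \<open>
  A subalgebra with the given elements contains every \<open>scalar_elt n r F\<close> with \<open>F\<close> in the image of
  \<^const>\<open>elem_hom\<close>, since \<open>F\<close> is a combination of products of \<open>e\<^sub>1, \<dots>, e\<^sub>r\<close> and \<open>e\<^sub>r\<inverse>\<close>.
\<close>

lemma center_generated:
  assumes "n > 0" "r > 0"
  defines "S \<equiv> (affine_schur n r :: ('k::field, 'k schur) module)"
  shows "alg_center S =
    generated_subalgebra S ((\<lambda>k. c_elt n r (eps r k)) ` {1..r} \<union> {c_elt n r (neg_tuple r (eps r r))})"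
    (is "_ = generated_subalgebra S ?X")
proof
  have elem: "c_elt n r (eps r k) = (scalar_elt n r (elem_sym r k) :: 'k schur)" for k
    unfolding elem_sym_def by (rule c_elt_eq_scalar_elt[OF assms(1)]) (simp add: eps_def tuples_def)
  have neg: "c_elt n r (neg_tuple r (eps r r)) = (scalar_elt n r (single (vec r (\<lambda>_. -1)) 1) :: 'k schur)"
  proof -
    have "neg_tuple r (eps r r) \<in> tuples r" by (simp add: neg_tuple_def tuples_def)
    moreover have "orbit_sum r (vec r (neg_tuple r (eps r r))) = (single (vec r (\<lambda>_. -1)) 1 :: 'k laurent)"
      by (rule orbit_sum_const) (simp add: neg_tuple_def eps_apply)
    ultimately show ?thesis using c_elt_eq_scalar_elt[OF assms(1)] by metis
  qed
  have ring: "ring S" unfolding S_def using assms(1) by (rule affine_schur_ring)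
  have cen: "alg_center S = scalar_elt n r ` Sym r" unfolding S_def by (rule center_affine_schur[OF assms(1)])
  have smul: "c \<odot>\<^bsub>S\<^esub> scalar_elt n r F = scalar_elt n r (single 0 c * F)" if "F \<in> Sym r" for c F
    using that assms(1) by (simp add: S_def affine_schur_simps scalar_elt_smult)
  have mul: "scalar_elt n r F \<otimes>\<^bsub>S\<^esub> scalar_elt n r G = scalar_elt n r (F * G)" if "F \<in> Sym r" "G \<in> Sym r" for F G
    using that assms(1) by (simp add: S_def affine_schur_simps scalar_elt_mult)
  have add: "scalar_elt n r F \<oplus>\<^bsub>S\<^esub> scalar_elt n r G = scalar_elt n r (F + G)" if "F \<in> Sym r" "G \<in> Sym r" for F G
    using that assms(1) by (simp add: S_def affine_schur_simps scalar_elt_add)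
  have one: "\<one>\<^bsub>S\<^esub> = scalar_elt n r 1" using assms(1) by (simp add: S_def scalar_elt_one)
  have zero: "\<zero>\<^bsub>S\<^esub> = scalar_elt n r 0" using assms(1) by (simp add: S_def affine_schur_simps scalar_elt_zero)
  have car: "scalar_elt n r F \<in> carrier S" if "F \<in> Sym r" for F
    using that assms(1) by (simp add: S_def scalar_elt_in_carrier)
  have "is_subalgebra (alg_center S) S"
    unfolding is_subalgebra_def
  proof
    show "subring (alg_center S) S"
    proof (rule ring.subringI[OF ring])
      show "alg_center S \<subseteq> carrier S" by (auto simp: alg_center_def)
      show "\<one>\<^bsub>S\<^esub> \<in> alg_center S" unfolding cen one using Sym_one by blast
      fix x y assume "x \<in> alg_center S" "y \<in> alg_center S"
      then obtain F G where FG: "F \<in> Sym r" "G \<in> Sym r" "x = scalar_elt n r F" "y = scalar_elt n r G"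
        unfolding cen by blast
      show "x \<otimes>\<^bsub>S\<^esub> y \<in> alg_center S" "x \<oplus>\<^bsub>S\<^esub> y \<in> alg_center S"
        unfolding cen FG(3,4) mul[OF FG(1,2)] add[OF FG(1,2)]
        using Sym_mult[OF FG(1,2)] Sym_add[OF FG(1,2)] by (simp_all only: image_eqI[OF refl])
    next
      fix x assume "x \<in> alg_center S"
      then obtain F where F: "F \<in> Sym r" "x = scalar_elt n r F" unfolding cen by blast
      have mF: "single 0 (-1) * F \<in> Sym r" using F by (intro Sym_mult Sym_scalar)
      have "single 0 (-1) * F + F = 0" by (simp add: single_uminus)
      hence "scalar_elt n r (single 0 (-1) * F) \<oplus>\<^bsub>S\<^esub> x = \<zero>\<^bsub>S\<^esub>"
        using add[OF mF F(1)] by (simp add: F(2) zero)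
      hence "\<ominus>\<^bsub>S\<^esub> x = scalar_elt n r (single 0 (-1) * F)"
        using abelian_group.minus_equality[OF ring.is_abelian_group[OF ring]] car F mF by blast
      thus "\<ominus>\<^bsub>S\<^esub> x \<in> alg_center S" unfolding cen using mF by blast
    qed
    show "\<forall>c. \<forall>x\<in>alg_center S. c \<odot>\<^bsub>S\<^esub> x \<in> alg_center S"
      unfolding cen by (auto simp: smul intro!: imageI Sym_mult Sym_scalar)
  qed
  moreover have "?X \<subseteq> alg_center S"
    unfolding cen elem neg using Sym_elem_sym Sym_const_mono by blast
  ultimately show "generated_subalgebra S ?X \<subseteq> alg_center S"
    by (auto simp: generated_subalgebra_def)
  show "alg_center S \<subseteq> generated_subalgebra S ?X"
    unfolding generated_subalgebra_def
  proof (intro Inter_greatest)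
    fix B assume "B \<in> {B. is_subalgebra B S \<and> ?X \<subseteq> B}"
    hence sub: "subring B S" and sc: "\<And>c x. x \<in> B \<Longrightarrow> c \<odot>\<^bsub>S\<^esub> x \<in> B" and X: "?X \<subseteq> B"
      by (auto simp: is_subalgebra_def)
    \<comment> \<open>The ring structure of \<open>B\<close> is transported to Laurent polynomials, where sums, products and
      powers are available as operations.\<close>
    define T where "T = {F \<in> Sym r. scalar_elt n r F \<in> B}"
    have T1: "1 \<in> T" using subringE(3)[OF sub] one Sym_one by (simp add: T_def)
    have T0: "0 \<in> T" using subringE(2)[OF sub] zero Sym_zero by (simp add: T_def)
    have Tm: "F * G \<in> T" if "F \<in> T" "G \<in> T" for F G
      using that subringE(6)[OF sub, of "scalar_elt n r F" "scalar_elt n r G"] mul[of F G] Sym_mult[of F r G]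
      by (simp add: T_def)
    have Ta: "F + G \<in> T" if "F \<in> T" "G \<in> T" for F G
      using that subringE(7)[OF sub, of "scalar_elt n r F" "scalar_elt n r G"] add[of F G] Sym_add[of F r G]
      by (simp add: T_def)
    have Tc: "single 0 c * F \<in> T" if "F \<in> T" for c F
      using that sc[of "scalar_elt n r F" c] smul[of F c] Sym_mult[OF Sym_scalar, of F r c]
      by (simp add: T_def)
    have Tp: "F ^ m \<in> T" if "F \<in> T" for F m
      using that by (induction m) (simp_all add: T1 Tm)
    have Te: "elem_sym r k \<in> T" if "k \<in> {1..r}" for k
    proof -
      have "c_elt n r (eps r k) \<in> B" using X that by blast
      thus ?thesis by (simp add: T_def Sym_elem_sym elem)
    qed
    have Tprod: "(\<Prod>k\<in>I. f k) \<in> T" if "\<And>k. k \<in> I \<Longrightarrow> f k \<in> T" for I :: "nat set" and f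
      using that by (induction I rule: infinite_finite_induct) (simp_all add: T1 Tm)
    have Tsum: "(\<Sum>k\<in>I. f k) \<in> T" if "\<And>k. k \<in> I \<Longrightarrow> f k \<in> T" for I :: "(nat \<Rightarrow>\<^sub>0 int) set" and f
      using that by (induction I rule: infinite_finite_induct) (simp_all add: T0 Ta)
    have pow: "single (vec r (\<lambda>_. s)) 1 ^ m = (single (vec r (\<lambda>_. int m * s)) 1 :: 'k laurent)" for s m
    proof (induction m)
      case (Suc m)
      have "vec r (\<lambda>_. s) + vec r (\<lambda>_. int m * s) = vec r (\<lambda>_. int (Suc m) * s)"
        by (rule poly_mapping_eqI) (simp add: lookup_add algebra_simps)
      thus ?case using Suc by (simp add: mult_single)
    qed (simp add: vec_zero)
    have Tu: "single (vec r (\<lambda>_. m)) 1 \<in> T" for m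
    proof (cases "0 \<le> m")
      case True
      have "elem_sym r r = (single (vec r (\<lambda>_. 1)) 1 :: 'k laurent)"
        unfolding elem_sym_def by (rule orbit_sum_const) (simp add: eps_apply)
      moreover have "elem_sym r r \<in> T" using assms(2) by (intro Te) auto
      ultimately show ?thesis using Tp[of "elem_sym r r" "nat m"] pow[of 1 "nat m"] True by simp
    next
      case False
      have "c_elt n r (neg_tuple r (eps r r)) \<in> B" using X by blast
      hence "single (vec r (\<lambda>_. -1)) 1 \<in> T" by (simp add: T_def Sym_const_mono neg)
      from Tp[OF this, of "nat (- m)"] show ?thesis using pow[of "-1" "nat (- m)"] False by simp
    qed
    show "alg_center S \<subseteq> B"
    proof
      fix x assume "x \<in> alg_center S"
      then obtain G where G: "x = scalar_elt n r (elem_hom r G)"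
        using elem_hom_surj[OF _ assms(2)] unfolding cen by blast
      have "elem_hom r G \<in> T"
        unfolding elem_hom_def const.extend_def elem_mono_def
        by (intro Tsum Tc Tm Tprod Tp Te Tu) auto
      thus "x \<in> B" by (simp add: G T_def)
    qed
  qed
qed

section \<open>Indecomposability\<close>

text \<open>
  Products of elements of the two ideals lie in their intersection. So for \<open>x = u + v\<close> multiplication
  by \<open>e\<close> from either side gives \<open>u\<close>, and by \<open>f\<close> gives \<open>v\<close>.
\<close>

lemma (in ring) ideal_decomposition_central:
  assumes "ideal I R" "ideal J R" "I <+>\<^bsub>R\<^esub> J = carrier R" "I \<inter> J = {\<zero>}"
  obtains e f where "e \<in> I" "f \<in> J" "\<one> = e \<oplus> f" "e \<otimes> f = \<zero>"
    "\<And>x. x \<in> carrier R \<Longrightarrow> e \<otimes> x = x \<otimes> e" "\<And>x. x \<in> carrier R \<Longrightarrow> f \<otimes> x = x \<otimes> f"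
proof -
  interpret I: ideal I R by (rule assms)
  interpret J: ideal J R by (rule assms)
  have split: "\<exists>u\<in>I. \<exists>v\<in>J. x = u \<oplus> v" if "x \<in> carrier R" for x
  proof -
    have "x \<in> I <+>\<^bsub>R\<^esub> J" using that assms(3) by simp
    thus ?thesis by (auto simp: set_add_def')
  qed
  obtain e f where e: "e \<in> I" and f: "f \<in> J" and ef: "\<one> = e \<oplus> f"
    using split[OF one_closed] by blast
  note car = I.Icarr[OF e] J.Icarr[OF f]
  have prod0: "x \<otimes> y = \<zero>" "y \<otimes> x = \<zero>" if xy: "x \<in> I" "y \<in> J" for x y
  proof -
    have "x \<otimes> y \<in> I \<inter> J" "y \<otimes> x \<in> I \<inter> J"
      using xy I.I_r_closed I.I_l_closed J.I_r_closed J.I_l_closed I.Icarr J.Icarr by simp_all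
    thus "x \<otimes> y = \<zero>" "y \<otimes> x = \<zero>" unfolding assms(4) by simp_all
  qed
  have unit: "x \<otimes> e = u" "e \<otimes> x = u" "x \<otimes> f = v" "f \<otimes> x = v"
    if uv: "u \<in> I" "v \<in> J" "x = u \<oplus> v" for x u v
  proof -
    note c = car I.Icarr[OF uv(1)] J.Icarr[OF uv(2)]
    note z = prod0[OF uv(1) f] prod0[OF e uv(2)]
    have "u \<otimes> (e \<oplus> f) = u" "(e \<oplus> f) \<otimes> u = u" "v \<otimes> (e \<oplus> f) = v" "(e \<oplus> f) \<otimes> v = v"
      using c by (simp_all flip: ef)
    hence "u \<otimes> e = u" "e \<otimes> u = u" "v \<otimes> f = v" "f \<otimes> v = v"
      using c z by (simp_all add: l_distr r_distr)
    thus "x \<otimes> e = u" "e \<otimes> x = u" "x \<otimes> f = v" "f \<otimes> x = v"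
      using c z by (simp_all add: uv(3) l_distr r_distr)
  qed
  have "e \<otimes> x = x \<otimes> e" "f \<otimes> x = x \<otimes> f" if x: "x \<in> carrier R" for x
  proof -
    obtain u v where uv: "u \<in> I" "v \<in> J" "x = u \<oplus> v" using split[OF x] by blast
    show "e \<otimes> x = x \<otimes> e" "f \<otimes> x = x \<otimes> f" unfolding unit[OF uv] by (rule refl)+
  qed
  with that e f ef prod0(1)[OF e f] show ?thesis by blast
qed

text \<open>
  A decomposition would give central \<open>e\<close>, \<open>f\<close> with product zero and sum one. The center is a domain,
  being isomorphic to a subring of the Laurent polynomials, so one of them vanishes.
\<close>

lemma affine_schur_indecomposable:
  assumes "n > 0"
  shows "indecomposable (affine_schur n r :: ('k::field, 'k schur) module)"
proof -
  let ?S = "affine_schur n r :: ('k, 'k schur) module"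
  interpret ring ?S using assms by (rule affine_schur_ring)
  have zero: "\<zero>\<^bsub>?S\<^esub> = scalar_elt n r 0"
    using assms by (simp add: affine_schur_simps scalar_elt_zero)
  have "\<one>\<^bsub>?S\<^esub> \<noteq> \<zero>\<^bsub>?S\<^esub>"
    unfolding zero scalar_elt_one[OF assms, symmetric]
    using scalar_elt_inj[OF assms Sym_one Sym_zero, where 'a = 'k] by auto
  moreover have "I = {\<zero>\<^bsub>?S\<^esub>} \<or> J = {\<zero>\<^bsub>?S\<^esub>}"
    if I: "ideal I ?S" and J: "ideal J ?S" and IJ: "I <+>\<^bsub>?S\<^esub> J = carrier ?S" "I \<inter> J = {\<zero>\<^bsub>?S\<^esub>}" for I J
  proof -
    interpret I: ideal I ?S by (rule I)
    interpret J: ideal J ?S by (rule J)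
    obtain e f where e: "e \<in> I" and f: "f \<in> J" and ef: "\<one>\<^bsub>?S\<^esub> = e \<oplus>\<^bsub>?S\<^esub> f"
      and ef0: "e \<otimes>\<^bsub>?S\<^esub> f = \<zero>\<^bsub>?S\<^esub>"
      and comm: "\<And>x. x \<in> carrier ?S \<Longrightarrow> e \<otimes>\<^bsub>?S\<^esub> x = x \<otimes>\<^bsub>?S\<^esub> e"
        "\<And>x. x \<in> carrier ?S \<Longrightarrow> f \<otimes>\<^bsub>?S\<^esub> x = x \<otimes>\<^bsub>?S\<^esub> f"
      by (rule ideal_decomposition_central[OF I J IJ]) (rule that)
    note car = I.Icarr[OF e] J.Icarr[OF f]
    have "e \<in> alg_center ?S" "f \<in> alg_center ?S"
      unfolding alg_center_def using comm car by blast+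
    then obtain E F where EF: "E \<in> Sym r" "F \<in> Sym r" "e = scalar_elt n r E" "f = scalar_elt n r F"
      unfolding center_affine_schur[OF assms] by blast
    have "scalar_elt n r (E * F) = (scalar_elt n r 0 :: 'k schur)"
      using ef0 EF assms by (simp add: scalar_elt_mult affine_schur_simps scalar_elt_zero)
    hence "E * F = 0" using scalar_elt_inj[OF assms Sym_mult[OF EF(1,2)] Sym_zero] by blast
    hence "E = 0 \<or> F = 0" by simp
    thus ?thesis
    proof
      assume "E = 0"
      hence "e = \<zero>\<^bsub>?S\<^esub>" using EF(3) zero by simp
      hence "\<one>\<^bsub>?S\<^esub> = f" unfolding ef by (simp only: l_zero[OF car(2)])
      hence "J = carrier ?S" using f J.one_imp_carrier by metis
      thus ?thesis using IJ(2) I.a_subset by blast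
    next
      assume "F = 0"
      hence "f = \<zero>\<^bsub>?S\<^esub>" using EF(4) zero by simp
      hence "\<one>\<^bsub>?S\<^esub> = e" unfolding ef by (simp only: r_zero[OF car(1)])
      hence "I = carrier ?S" using e I.one_imp_carrier by metis
      thus ?thesis using IJ(2) J.a_subset by blast
    qed
  qed
  ultimately show ?thesis unfolding indecomposable_def using ring_axioms by blast
qed

theorem theorem4p5:
  fixes n r :: nat
  assumes "infinite (UNIV :: 'k::field set)" and "n > 0" and "r > 0"
  defines "S \<equiv> (affine_schur n r :: ('k, 'k schur) module)"
  shows "alg_isomorphic (S\<lparr>carrier := alg_center S\<rparr>) (laurent_algebra r :: ('k, _) module) \<and>
    alg_center S =
      generated_subalgebra S ((\<lambda>k. c_elt n r (eps r k)) ` {1..r} \<union> {c_elt n r (neg_tuple r (eps r r))}) \<and>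
    indecomposable S"
  unfolding S_def
  using center_isomorphic_laurent[OF assms(2,3)] center_generated[OF assms(2,3)]
    affine_schur_indecomposable[OF assms(2)]
  by (intro conjI)

end
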